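(* Assume the standing assumptions below and fix any splitting $1\le p<N$, $N_0,\dots,N_p\ge 1$, $\sum_i N_i=N$. Then: (a) For every $i\in\{0,\dots,p-1\}$ and every parameter $\theta_i=(\bar x_i,\bar d_i)$ the subproblem $P_i(\bar x_i,\bar d_i)$ is feasible and has a unique optimal solution, which is an affine function of $\theta_i$; likewise $P_p(\bar x_p)$ has a unique optimal solution affine in $\theta_p=\bar x_p$. Consequently the optimal value functions are quadratic, $V_i(\theta_i)=\tfrac12\theta_i^T\hat H_i\theta_i+\hat f_i^T\theta_i+\hat c_i$, and all data $\hat H_i,\hat f_i,\hat c_i,\mathcal A_i,T_i,D_i\mathbf a_i$ of block $i$ are computed from the data of block $i$ alone (independently of the other blocks). (b) $\mathrm{MPC}_N$ is equivalent to the master problem $\mathrm{MPC}_p$: $$\min_{\hat x_0,\dots,\hat x_p,\hat u_0,\dots,\hat u_{p-1}}\ \sum_{i=0}^{p-1}V_i(\hat x_i,\hat u_i)+V_p(\hat x_p)\quad\text{s.t.}\quad \hat x_0=\bar x,\ \ \hat x_{i+1}=\mathcal A_i\hat x_i+T_i\hat u_i+D_i\mathbf a_i,\ i=0,\dots,p-1,$$ which is an equality-constrained convex QP with the same stagewise structure as $\mathrm{MPC}_N$ but horizon $p$. Precisely: the optimal values coincide, and if $(\hat x^*,\hat u^* )$ is optimal for the master problem and $(x^*_{t,i},u^*_{t,i})$ denotes the optimal solution of $P_i(\hat x^*_i,\hat u^*_i)$ ($i<p$), resp. of $P_p(\hat x^*_p)$, then $x^*_{N_i,i}=x^*_{0,i+1}$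 and $x^*_{\tau_i+t}:=x^*_{t,i}$, $u^*_{\tau_i+t}:=u^*_{t,i}$ defines the unique optimal solution of $\mathrm{MPC}_N$. (c) Let $\hat\lambda_{-1},\dots,\hat\lambda_{p-1}$ be the optimal multipliers of the master problem ($\hat\lambda_{-1}\leftrightarrow \hat x_0=\bar x$, $\hat\lambda_i\leftrightarrow$ the $i$-th dynamics constraint, same sign convention as below). Then for each $i<p$ there is an optimal multiplier vector of $P_i(\hat x^*_i,\hat u^*_i)$ with $\lambda_{tc,i}=-\hat\lambda_i$; with this choice (and the unique multipliers of $P_p(\hat x_p^* )$) one has $\lambda_{0,0}=\hat\lambda_{-1}$, $\lambda_{N_i,i}=\lambda_{0,i+1}=\hat\lambda_i$ for $i<p$, and $\lambda^*_{\tau_i+t}:=\lambda_{t,i}$ ($t=0,\dots,N_i$, $i=0,\dots,p$) is the optimal multiplier vector of $\mathrm{MPC}_N$.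
   Context: Problem $\mathrm{MPC}_N$ ($N\ge2$): variables $x_0,\dots,x_N\in\mathbb R^{n_x}$, $u_t\in\mathbb R^{n_{u,t}}$ ($t=0,\dots,N-1$); minimize $\sum_{t=0}^{N-1}\big(\tfrac12[x_t;u_t]^TH_t[x_t;u_t]+f_t^T[x_t;u_t]+c_t\big)+\tfrac12x_N^TH_Nx_N+f_N^Tx_N+c_N$ subject to $x_0=\bar x$ and $x_{t+1}=A_tx_t+B_tu_t+a_t$, $t=0,\dots,N-1$. Standing assumptions: $H_t=\begin{bmatrix}H_{x,t}&H_{xu,t}\\H_{xu,t}^T&H_{u,t}\end{bmatrix}$ is symmetric positive semidefinite with $H_{u,t}$ positive definite, $H_N$ is symmetric positive semidefinite, and the equality constraints have full row rank (LICQ). Multipliers: $\lambda_0\leftrightarrow x_0=\bar x$, $\lambda_{t+1}\leftrightarrow x_{t+1}=A_tx_t+B_tu_t+a_t$. Sign convention (used for every problem here): for each constraint written as $\ell=r$ with $\ell$ the displayed left-hand side and multiplier $\mu$, the Lagrangian is objective $+\sum\mu^T(r-\ell)$, and KKT stationarity is vanishing of its gradient (e.g. $H_{x,t}x_t+H_{xu,t}u_t+f_{x,t}-\lambda_t+A_t^T\lambda_{t+1}=0$). Splitting: $\tau_i=\sum_{j<i}N_j$; block data $A_{t,i}=A_{\tau_i+t}$, $B_{t,i}=B_{\tau_i+t}$, $a_{t,i}=a_{\tau_i+t}$, $H_{t,i}=H_{\tau_i+t}$, $f_{t,i}=f_{\tau_i+t}$, $c_{t,i}=c_{\tau_i+t}$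 for $t=0,\dots,N_i-1$, and $H_{N_p,p}=H_N$, $f_{N_p,p}=f_N$, $c_{N_p,p}=c_N$. Products: $\prod_{t=t_0}^{t_1}A_t=A_{t_1}\cdots A_{t_0}$, empty product $=I$. For $i<p$: $\mathcal A_i=\prod_{t=0}^{N_i-1}A_{t,i}$; $D_{j,i}=\prod_{s=j+1}^{N_i-1}A_{s,i}$; $D_i=[D_{0,i}\ \cdots\ D_{N_i-1,i}]$; $S_i=[D_{0,i}B_{0,i}\ \cdots\ D_{N_i-1,i}B_{N_i-1,i}]$ (controllability matrix); $\mathbf a_i=(a_{0,i};\dots;a_{N_i-1,i})$; $T_i$ is a matrix whose columns form a basis of the range of $S_i$. Subproblem $P_i(\bar x_i,\bar d_i)$, $i<p$: minimize $\sum_{t=0}^{N_i-1}\big(\tfrac12[x_{t,i};u_{t,i}]^TH_{t,i}[x_{t,i};u_{t,i}]+f_{t,i}^T[x_{t,i};u_{t,i}]+c_{t,i}\big)$ over $x_{0,i},\dots,x_{N_i,i},u_{0,i},\dots,u_{N_i-1,i}$ subject to $x_{0,i}=\bar x_i$ (multiplier $\lambda_{0,i}$), $x_{t+1,i}=A_{t,i}x_{t,i}+B_{t,i}u_{t,i}+a_{t,i}$ (multiplier $\lambda_{t+1,i}$), $x_{N_i,i}=\mathcal A_i\bar x_i+T_i\bar d_i+D_i\mathbf a_i$ (multiplier $\lambda_{tc,i}$). Subproblem $P_p(\bar x_p)$: same with $i=p$, objective additionally containing $\tfrac12x_{N_p,p}^TH_{N_p,p}x_{N_p,p}+f_{N_p,p}^Tx_{N_p,p}+c_{N_p,p}$,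 and no terminal constraint. $V_i$ denotes the optimal value of $P_i$ as a function of its parameter. *)

theory Defs
  imports Complex_Main "Jordan_Normal_Form.Matrix"
begin

(* Vectors/matrices are Jordan_Normal_Form 'real vec' / 'real mat' (dimensions carried
   by the objects, checked via carrier_vec / carrier_mat).  Trajectories are functions
   nat => real vec; only the indices t <= N (states), t < N (inputs) are meaningful. *)

definition sym_mat :: "real mat \<Rightarrow> bool" where
  "sym_mat M \<longleftrightarrow> transpose_mat M = M"

definition psd_mat :: "nat \<Rightarrow> real mat \<Rightarrow> bool" where
  "psd_mat n M \<longleftrightarrow> (\<forall>v \<in> carrier_vec n. 0 \<le> v \<bullet> (M *\<^sub>v v))"

definition pd_mat :: "nat \<Rightarrow> real mat \<Rightarrow> bool" where
  "pd_mat n M \<longleftrightarrow> (\<forall>v \<in> carrier_vec n. v \<noteq> 0\<^sub>v n \<longrightarrow> 0 < v \<bullet> (M *\<^sub>v v))"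

definition Hu_block :: "nat \<Rightarrow> nat \<Rightarrow> real mat \<Rightarrow> real mat" where
  "Hu_block nx m M = mat m m (\<lambda>(i,j). M $$ (nx + i, nx + j))"

definition mpc_std :: "nat \<Rightarrow> (nat \<Rightarrow> nat) \<Rightarrow> nat \<Rightarrow> (nat \<Rightarrow> real mat) \<Rightarrow> (nat \<Rightarrow> real vec)
   \<Rightarrow> (nat \<Rightarrow> real mat) \<Rightarrow> (nat \<Rightarrow> real mat) \<Rightarrow> (nat \<Rightarrow> real vec) \<Rightarrow> real vec \<Rightarrow> bool" where
  "mpc_std nx nu N H f A B a xbar \<longleftrightarrow>
     xbar \<in> carrier_vec nx \<and>
     (\<forall>t<N. A t \<in> carrier_mat nx nx \<and> B t \<in> carrier_mat nx (nu t) \<and> a t \<in> carrier_vec nx \<and>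
            H t \<in> carrier_mat (nx + nu t) (nx + nu t) \<and> f t \<in> carrier_vec (nx + nu t) \<and>
            sym_mat (H t) \<and> psd_mat (nx + nu t) (H t) \<and> pd_mat (nu t) (Hu_block nx (nu t) (H t))) \<and>
     H N \<in> carrier_mat nx nx \<and> f N \<in> carrier_vec nx \<and> sym_mat (H N) \<and> psd_mat nx (H N)"

definition quad :: "real mat \<Rightarrow> real vec \<Rightarrow> real \<Rightarrow> real vec \<Rightarrow> real" where
  "quad M g k z = 1/2 * (z \<bullet> (M *\<^sub>v z)) + g \<bullet> z + k"

definition stage_cost :: "real mat \<Rightarrow> real vec \<Rightarrow> real \<Rightarrow> real vec \<Rightarrow> real vec \<Rightarrow> real" where
  "stage_cost M g k x u = quad M g k (x @\<^sub>v u)"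

definition stages_obj :: "nat \<Rightarrow> (nat \<Rightarrow> real mat) \<Rightarrow> (nat \<Rightarrow> real vec) \<Rightarrow> (nat \<Rightarrow> real)
   \<Rightarrow> (nat \<Rightarrow> real vec) \<Rightarrow> (nat \<Rightarrow> real vec) \<Rightarrow> real" where
  "stages_obj N H f c x u = (\<Sum>t<N. stage_cost (H t) (f t) (c t) (x t) (u t))"

definition mpc_obj :: "nat \<Rightarrow> (nat \<Rightarrow> real mat) \<Rightarrow> (nat \<Rightarrow> real vec) \<Rightarrow> (nat \<Rightarrow> real)
   \<Rightarrow> (nat \<Rightarrow> real vec) \<Rightarrow> (nat \<Rightarrow> real vec) \<Rightarrow> real" where
  "mpc_obj N H f c x u = stages_obj N H f c x u + quad (H N) (f N) (c N) (x N)"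

definition mpc_feas :: "nat \<Rightarrow> (nat \<Rightarrow> nat) \<Rightarrow> nat \<Rightarrow> (nat \<Rightarrow> real mat) \<Rightarrow> (nat \<Rightarrow> real mat)
   \<Rightarrow> (nat \<Rightarrow> real vec) \<Rightarrow> real vec \<Rightarrow> (nat \<Rightarrow> real vec) \<Rightarrow> (nat \<Rightarrow> real vec) \<Rightarrow> bool" where
  "mpc_feas nx nu N A B a x0 x u \<longleftrightarrow>
     (\<forall>t\<le>N. x t \<in> carrier_vec nx) \<and> (\<forall>t<N. u t \<in> carrier_vec (nu t)) \<and>
     x 0 = x0 \<and> (\<forall>t<N. x (Suc t) = A t *\<^sub>v x t + B t *\<^sub>v u t + a t)"

definition mpc_opt :: "nat \<Rightarrow> (nat \<Rightarrow> nat) \<Rightarrow> nat \<Rightarrow> (nat \<Rightarrow> real mat) \<Rightarrow> (nat \<Rightarrow> real vec)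
   \<Rightarrow> (nat \<Rightarrow> real) \<Rightarrow> (nat \<Rightarrow> real mat) \<Rightarrow> (nat \<Rightarrow> real mat) \<Rightarrow> (nat \<Rightarrow> real vec) \<Rightarrow> real vec
   \<Rightarrow> (nat \<Rightarrow> real vec) \<Rightarrow> (nat \<Rightarrow> real vec) \<Rightarrow> bool" where
  "mpc_opt nx nu N H f c A B a x0 x u \<longleftrightarrow>
     mpc_feas nx nu N A B a x0 x u \<and>
     (\<forall>x' u'. mpc_feas nx nu N A B a x0 x' u' \<longrightarrow> mpc_obj N H f c x u \<le> mpc_obj N H f c x' u')"

definition mpc_val :: "nat \<Rightarrow> (nat \<Rightarrow> nat) \<Rightarrow> nat \<Rightarrow> (nat \<Rightarrow> real mat) \<Rightarrow> (nat \<Rightarrow> real vec)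
   \<Rightarrow> (nat \<Rightarrow> real) \<Rightarrow> (nat \<Rightarrow> real mat) \<Rightarrow> (nat \<Rightarrow> real mat) \<Rightarrow> (nat \<Rightarrow> real vec) \<Rightarrow> real vec \<Rightarrow> real" where
  "mpc_val nx nu N H f c A B a x0 =
     Inf {mpc_obj N H f c x u | x u. mpc_feas nx nu N A B a x0 x u}"

(* stationarity of the Lagrangian  obj + sum mu'(r - l)  w.r.t. x_t, u_t, t < N *)
definition stage_stat :: "nat \<Rightarrow> (nat \<Rightarrow> nat) \<Rightarrow> nat \<Rightarrow> (nat \<Rightarrow> real mat) \<Rightarrow> (nat \<Rightarrow> real vec)
   \<Rightarrow> (nat \<Rightarrow> real mat) \<Rightarrow> (nat \<Rightarrow> real mat) \<Rightarrow> (nat \<Rightarrow> real vec) \<Rightarrow> (nat \<Rightarrow> real vec)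
   \<Rightarrow> (nat \<Rightarrow> real vec) \<Rightarrow> bool" where
  "stage_stat nx nu N H f A B x u lam \<longleftrightarrow>
     (\<forall>t<N. vec_first (H t *\<^sub>v (x t @\<^sub>v u t) + f t) nx - lam t
              + transpose_mat (A t) *\<^sub>v lam (Suc t) = 0\<^sub>v nx \<and>
            vec_last (H t *\<^sub>v (x t @\<^sub>v u t) + f t) (nu t)
              + transpose_mat (B t) *\<^sub>v lam (Suc t) = 0\<^sub>v (nu t))"

(* KKT system of MPC_N: primal feasibility + stationarity (lam t <-> constraint defining x_t) *)
definition mpc_kkt :: "nat \<Rightarrow> (nat \<Rightarrow> nat) \<Rightarrow> nat \<Rightarrow> (nat \<Rightarrow> real mat) \<Rightarrow> (nat \<Rightarrow> real vec)
   \<Rightarrow> (nat \<Rightarrow> real mat) \<Rightarrow> (nat \<Rightarrow> real mat) \<Rightarrow> (nat \<Rightarrow> real vec) \<Rightarrow> real vec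
   \<Rightarrow> (nat \<Rightarrow> real vec) \<Rightarrow> (nat \<Rightarrow> real vec) \<Rightarrow> (nat \<Rightarrow> real vec) \<Rightarrow> bool" where
  "mpc_kkt nx nu N H f A B a x0 x u lam \<longleftrightarrow>
     mpc_feas nx nu N A B a x0 x u \<and> (\<forall>t\<le>N. lam t \<in> carrier_vec nx) \<and>
     stage_stat nx nu N H f A B x u lam \<and>
     H N *\<^sub>v x N + f N - lam N = 0\<^sub>v nx"

definition tau :: "(nat \<Rightarrow> nat) \<Rightarrow> nat \<Rightarrow> nat" where
  "tau Ns i = (\<Sum>j<i. Ns j)"

definition shift :: "nat \<Rightarrow> (nat \<Rightarrow> 'a) \<Rightarrow> nat \<Rightarrow> 'a" where
  "shift k g = (\<lambda>t. g (k + t))"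

fun prodA :: "nat \<Rightarrow> (nat \<Rightarrow> real mat) \<Rightarrow> nat \<Rightarrow> nat \<Rightarrow> real mat" where
  "prodA nx A j 0 = 1\<^sub>m nx"
| "prodA nx A j (Suc k) = (if j \<le> k then A k * prodA nx A j k else 1\<^sub>m nx)"

definition Acal :: "nat \<Rightarrow> (nat \<Rightarrow> real mat) \<Rightarrow> nat \<Rightarrow> real mat" where
  "Acal nx A Nb = prodA nx A 0 Nb"

definition Dmat :: "nat \<Rightarrow> (nat \<Rightarrow> real mat) \<Rightarrow> nat \<Rightarrow> nat \<Rightarrow> real mat" where
  "Dmat nx A Nb j = prodA nx A (Suc j) Nb"

definition Da :: "nat \<Rightarrow> (nat \<Rightarrow> real mat) \<Rightarrow> (nat \<Rightarrow> real vec) \<Rightarrow> nat \<Rightarrow> real vec" where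
  "Da nx A a Nb = foldr (+) (map (\<lambda>j. Dmat nx A Nb j *\<^sub>v a j) [0..<Nb]) (0\<^sub>v nx)"

(* range of S_i = [D_{0,i}B_{0,i} ... D_{Nb-1,i}B_{Nb-1,i}] : { S_i (w_0;...;w_{Nb-1}) } *)
definition ctrb_range :: "nat \<Rightarrow> (nat \<Rightarrow> nat) \<Rightarrow> (nat \<Rightarrow> real mat) \<Rightarrow> (nat \<Rightarrow> real mat) \<Rightarrow> nat \<Rightarrow> real vec set" where
  "ctrb_range nx nu A B Nb =
     {foldr (+) (map (\<lambda>j. Dmat nx A Nb j *\<^sub>v (B j *\<^sub>v w j)) [0..<Nb]) (0\<^sub>v nx) | w.
        \<forall>j<Nb. w j \<in> carrier_vec (nu j)}"

definition col_basis :: "nat \<Rightarrow> real mat \<Rightarrow> real vec set \<Rightarrow> bool" where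
  "col_basis nx T V \<longleftrightarrow> T \<in> carrier_mat nx (dim_col T) \<and>
     (\<forall>v \<in> carrier_vec (dim_col T). T *\<^sub>v v = 0\<^sub>v nx \<longrightarrow> v = 0\<^sub>v (dim_col T)) \<and>
     {T *\<^sub>v v | v. v \<in> carrier_vec (dim_col T)} = V"

definition blkAcal :: "nat \<Rightarrow> (nat \<Rightarrow> real mat) \<Rightarrow> (nat \<Rightarrow> nat) \<Rightarrow> nat \<Rightarrow> real mat" where
  "blkAcal nx A Ns i = Acal nx (shift (tau Ns i) A) (Ns i)"

definition blkDa :: "nat \<Rightarrow> (nat \<Rightarrow> real mat) \<Rightarrow> (nat \<Rightarrow> real vec) \<Rightarrow> (nat \<Rightarrow> nat) \<Rightarrow> nat \<Rightarrow> real vec" where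
  "blkDa nx A a Ns i = Da nx (shift (tau Ns i) A) (shift (tau Ns i) a) (Ns i)"

definition blkS_range :: "nat \<Rightarrow> (nat \<Rightarrow> nat) \<Rightarrow> (nat \<Rightarrow> real mat) \<Rightarrow> (nat \<Rightarrow> real mat) \<Rightarrow> (nat \<Rightarrow> nat) \<Rightarrow> nat \<Rightarrow> real vec set" where
  "blkS_range nx nu A B Ns i = ctrb_range nx (shift (tau Ns i) nu) (shift (tau Ns i) A) (shift (tau Ns i) B) (Ns i)"

definition P_feas :: "nat \<Rightarrow> (nat \<Rightarrow> nat) \<Rightarrow> (nat \<Rightarrow> real mat) \<Rightarrow> (nat \<Rightarrow> real mat) \<Rightarrow> (nat \<Rightarrow> real vec)
   \<Rightarrow> (nat \<Rightarrow> nat) \<Rightarrow> (nat \<Rightarrow> real mat) \<Rightarrow> nat \<Rightarrow> real vec \<Rightarrow> real vec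
   \<Rightarrow> (nat \<Rightarrow> real vec) \<Rightarrow> (nat \<Rightarrow> real vec) \<Rightarrow> bool" where
  "P_feas nx nu A B a Ns T i xb db x u \<longleftrightarrow>
     mpc_feas nx (shift (tau Ns i) nu) (Ns i) (shift (tau Ns i) A) (shift (tau Ns i) B) (shift (tau Ns i) a) xb x u \<and>
     x (Ns i) = blkAcal nx A Ns i *\<^sub>v xb + T i *\<^sub>v db + blkDa nx A a Ns i"

definition P_obj :: "(nat \<Rightarrow> real mat) \<Rightarrow> (nat \<Rightarrow> real vec) \<Rightarrow> (nat \<Rightarrow> real) \<Rightarrow> (nat \<Rightarrow> nat) \<Rightarrow> nat
   \<Rightarrow> (nat \<Rightarrow> real vec) \<Rightarrow> (nat \<Rightarrow> real vec) \<Rightarrow> real" where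
  "P_obj H f c Ns i x u = stages_obj (Ns i) (shift (tau Ns i) H) (shift (tau Ns i) f) (shift (tau Ns i) c) x u"

definition P_opt :: "nat \<Rightarrow> (nat \<Rightarrow> nat) \<Rightarrow> (nat \<Rightarrow> real mat) \<Rightarrow> (nat \<Rightarrow> real vec) \<Rightarrow> (nat \<Rightarrow> real)
   \<Rightarrow> (nat \<Rightarrow> real mat) \<Rightarrow> (nat \<Rightarrow> real mat) \<Rightarrow> (nat \<Rightarrow> real vec)
   \<Rightarrow> (nat \<Rightarrow> nat) \<Rightarrow> (nat \<Rightarrow> real mat) \<Rightarrow> nat \<Rightarrow> real vec \<Rightarrow> real vec
   \<Rightarrow> (nat \<Rightarrow> real vec) \<Rightarrow> (nat \<Rightarrow> real vec) \<Rightarrow> bool" where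
  "P_opt nx nu H f c A B a Ns T i xb db x u \<longleftrightarrow>
     P_feas nx nu A B a Ns T i xb db x u \<and>
     (\<forall>x' u'. P_feas nx nu A B a Ns T i xb db x' u' \<longrightarrow> P_obj H f c Ns i x u \<le> P_obj H f c Ns i x' u')"

definition P_val :: "nat \<Rightarrow> (nat \<Rightarrow> nat) \<Rightarrow> (nat \<Rightarrow> real mat) \<Rightarrow> (nat \<Rightarrow> real vec) \<Rightarrow> (nat \<Rightarrow> real)
   \<Rightarrow> (nat \<Rightarrow> real mat) \<Rightarrow> (nat \<Rightarrow> real mat) \<Rightarrow> (nat \<Rightarrow> real vec)
   \<Rightarrow> (nat \<Rightarrow> nat) \<Rightarrow> (nat \<Rightarrow> real mat) \<Rightarrow> nat \<Rightarrow> real vec \<Rightarrow> real vec \<Rightarrow> real" where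
  "P_val nx nu H f c A B a Ns T i xb db =
     Inf {P_obj H f c Ns i x u | x u. P_feas nx nu A B a Ns T i xb db x u}"

(* KKT system of P_i: lam t <-> constraint defining x_{t,i}, lamtc <-> terminal constraint *)
definition P_kkt :: "nat \<Rightarrow> (nat \<Rightarrow> nat) \<Rightarrow> (nat \<Rightarrow> real mat) \<Rightarrow> (nat \<Rightarrow> real vec)
   \<Rightarrow> (nat \<Rightarrow> real mat) \<Rightarrow> (nat \<Rightarrow> real mat) \<Rightarrow> (nat \<Rightarrow> real vec)
   \<Rightarrow> (nat \<Rightarrow> nat) \<Rightarrow> (nat \<Rightarrow> real mat) \<Rightarrow> nat \<Rightarrow> real vec \<Rightarrow> real vec
   \<Rightarrow> (nat \<Rightarrow> real vec) \<Rightarrow> (nat \<Rightarrow> real vec) \<Rightarrow> (nat \<Rightarrow> real vec) \<Rightarrow> real vec \<Rightarrow> bool" where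
  "P_kkt nx nu H f A B a Ns T i xb db x u lam lamtc \<longleftrightarrow>
     P_feas nx nu A B a Ns T i xb db x u \<and> (\<forall>t\<le>Ns i. lam t \<in> carrier_vec nx) \<and>
     lamtc \<in> carrier_vec nx \<and>
     stage_stat nx (shift (tau Ns i) nu) (Ns i) (shift (tau Ns i) H) (shift (tau Ns i) f)
       (shift (tau Ns i) A) (shift (tau Ns i) B) x u lam \<and>
     - lam (Ns i) - lamtc = 0\<^sub>v nx"

(* ---------- last subproblem P_p(xb): MPC on block i with terminal cost, no terminal constraint ---------- *)

definition Q_opt :: "nat \<Rightarrow> (nat \<Rightarrow> nat) \<Rightarrow> (nat \<Rightarrow> real mat) \<Rightarrow> (nat \<Rightarrow> real vec) \<Rightarrow> (nat \<Rightarrow> real)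
   \<Rightarrow> (nat \<Rightarrow> real mat) \<Rightarrow> (nat \<Rightarrow> real mat) \<Rightarrow> (nat \<Rightarrow> real vec)
   \<Rightarrow> (nat \<Rightarrow> nat) \<Rightarrow> nat \<Rightarrow> real vec \<Rightarrow> (nat \<Rightarrow> real vec) \<Rightarrow> (nat \<Rightarrow> real vec) \<Rightarrow> bool" where
  "Q_opt nx nu H f c A B a Ns i xb x u \<longleftrightarrow>
     mpc_opt nx (shift (tau Ns i) nu) (Ns i) (shift (tau Ns i) H) (shift (tau Ns i) f) (shift (tau Ns i) c)
       (shift (tau Ns i) A) (shift (tau Ns i) B) (shift (tau Ns i) a) xb x u"

definition Q_val :: "nat \<Rightarrow> (nat \<Rightarrow> nat) \<Rightarrow> (nat \<Rightarrow> real mat) \<Rightarrow> (nat \<Rightarrow> real vec) \<Rightarrow> (nat \<Rightarrow> real)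
   \<Rightarrow> (nat \<Rightarrow> real mat) \<Rightarrow> (nat \<Rightarrow> real mat) \<Rightarrow> (nat \<Rightarrow> real vec)
   \<Rightarrow> (nat \<Rightarrow> nat) \<Rightarrow> nat \<Rightarrow> real vec \<Rightarrow> real" where
  "Q_val nx nu H f c A B a Ns i xb =
     mpc_val nx (shift (tau Ns i) nu) (Ns i) (shift (tau Ns i) H) (shift (tau Ns i) f) (shift (tau Ns i) c)
       (shift (tau Ns i) A) (shift (tau Ns i) B) (shift (tau Ns i) a) xb"

definition Q_kkt :: "nat \<Rightarrow> (nat \<Rightarrow> nat) \<Rightarrow> (nat \<Rightarrow> real mat) \<Rightarrow> (nat \<Rightarrow> real vec)
   \<Rightarrow> (nat \<Rightarrow> real mat) \<Rightarrow> (nat \<Rightarrow> real mat) \<Rightarrow> (nat \<Rightarrow> real vec)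
   \<Rightarrow> (nat \<Rightarrow> nat) \<Rightarrow> nat \<Rightarrow> real vec \<Rightarrow> (nat \<Rightarrow> real vec) \<Rightarrow> (nat \<Rightarrow> real vec) \<Rightarrow> (nat \<Rightarrow> real vec) \<Rightarrow> bool" where
  "Q_kkt nx nu H f A B a Ns i xb x u lam \<longleftrightarrow>
     mpc_kkt nx (shift (tau Ns i) nu) (Ns i) (shift (tau Ns i) H) (shift (tau Ns i) f)
       (shift (tau Ns i) A) (shift (tau Ns i) B) (shift (tau Ns i) a) xb x u lam"

definition master_feas :: "nat \<Rightarrow> (nat \<Rightarrow> real mat) \<Rightarrow> (nat \<Rightarrow> real vec) \<Rightarrow> (nat \<Rightarrow> nat)
   \<Rightarrow> (nat \<Rightarrow> real mat) \<Rightarrow> nat \<Rightarrow> real vec \<Rightarrow> (nat \<Rightarrow> real vec) \<Rightarrow> (nat \<Rightarrow> real vec) \<Rightarrow> bool" where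
  "master_feas nx A a Ns T p xbar xh uh \<longleftrightarrow>
     mpc_feas nx (\<lambda>i. dim_col (T i)) p (blkAcal nx A Ns) T (blkDa nx A a Ns) xbar xh uh"

definition master_obj :: "nat \<Rightarrow> (nat \<Rightarrow> nat) \<Rightarrow> (nat \<Rightarrow> real mat) \<Rightarrow> (nat \<Rightarrow> real vec) \<Rightarrow> (nat \<Rightarrow> real)
   \<Rightarrow> (nat \<Rightarrow> real mat) \<Rightarrow> (nat \<Rightarrow> real mat) \<Rightarrow> (nat \<Rightarrow> real vec)
   \<Rightarrow> (nat \<Rightarrow> nat) \<Rightarrow> (nat \<Rightarrow> real mat) \<Rightarrow> nat \<Rightarrow> (nat \<Rightarrow> real vec) \<Rightarrow> (nat \<Rightarrow> real vec) \<Rightarrow> real" where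
  "master_obj nx nu H f c A B a Ns T p xh uh =
     (\<Sum>i<p. P_val nx nu H f c A B a Ns T i (xh i) (uh i)) + Q_val nx nu H f c A B a Ns p (xh p)"

definition master_opt :: "nat \<Rightarrow> (nat \<Rightarrow> nat) \<Rightarrow> (nat \<Rightarrow> real mat) \<Rightarrow> (nat \<Rightarrow> real vec) \<Rightarrow> (nat \<Rightarrow> real)
   \<Rightarrow> (nat \<Rightarrow> real mat) \<Rightarrow> (nat \<Rightarrow> real mat) \<Rightarrow> (nat \<Rightarrow> real vec)
   \<Rightarrow> (nat \<Rightarrow> nat) \<Rightarrow> (nat \<Rightarrow> real mat) \<Rightarrow> nat \<Rightarrow> real vec \<Rightarrow> (nat \<Rightarrow> real vec) \<Rightarrow> (nat \<Rightarrow> real vec) \<Rightarrow> bool" where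
  "master_opt nx nu H f c A B a Ns T p xbar xh uh \<longleftrightarrow>
     master_feas nx A a Ns T p xbar xh uh \<and>
     (\<forall>xh' uh'. master_feas nx A a Ns T p xbar xh' uh' \<longrightarrow>
        master_obj nx nu H f c A B a Ns T p xh uh \<le> master_obj nx nu H f c A B a Ns T p xh' uh')"

definition master_val :: "nat \<Rightarrow> (nat \<Rightarrow> nat) \<Rightarrow> (nat \<Rightarrow> real mat) \<Rightarrow> (nat \<Rightarrow> real vec) \<Rightarrow> (nat \<Rightarrow> real)
   \<Rightarrow> (nat \<Rightarrow> real mat) \<Rightarrow> (nat \<Rightarrow> real mat) \<Rightarrow> (nat \<Rightarrow> real vec)
   \<Rightarrow> (nat \<Rightarrow> nat) \<Rightarrow> (nat \<Rightarrow> real mat) \<Rightarrow> nat \<Rightarrow> real vec \<Rightarrow> real" where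
  "master_val nx nu H f c A B a Ns T p xbar =
     Inf {master_obj nx nu H f c A B a Ns T p xh uh | xh uh. master_feas nx A a Ns T p xbar xh uh}"

end

theory Submission
  imports Defs "Jordan_Normal_Form.Determinant"
begin

text \<open>
  On trajectories of the homogeneous dynamics starting at \<open>0\<close> the quadratic part of the objective is positive
  definite: a vanishing stage cost forces \<open>u\<^sub>t = 0\<close> as soon as \<open>x\<^sub>t = 0\<close>, and then \<open>x\<^sub>t\<^sub>+\<^sub>1 = 0\<close>. So optima are unique
  and characterised by a first-order condition that is affine in the solution and the parameters, which makes
  the solution affine and the value quadratic in the parameters. Existence without terminal constraint is the
  Riccati recursion; a prescribed terminal state is then reached by tuning a linear terminal cost.

  Master and full problem have the same value because cutting a trajectory into blocks and gluing optimal
  block trajectories are inverse to each other. For the multipliers, moving the parameters of a block along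
  a homogeneous trajectory keeps the block feasible, hence the value function and the objective have the same
  slope. Master stationarity evaluates this slope as \<open>\<lambda>\<^sub>i\<^sub>-\<^sub>1 \<bullet> dx\<^sub>0 - \<lambda>\<^sub>i \<bullet> dx\<^sub>N\<close>, and the costate obtained by
  backward recursion from \<open>\<lambda>\<^sub>i\<close> then satisfies the remaining stationarity conditions and ends in \<open>\<lambda>\<^sub>i\<^sub>-\<^sub>1\<close>.
\<close>

section \<open>Matrices and convex quadratics\<close>

text \<open>The \<open>H t\<close> are only semidefinite, so the objective need not be strictly
  convex in all directions; uniqueness rests on comparing trajectories with the same initial state.
  The controllability matrix of a block may be rank deficient. Its terminal constraint is then
  partly redundant with the dynamics, a block on its own does not determine its multipliers, and
  they cannot be matched with those of the full problem by uniqueness alone: the master problem has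
  to supply the terminal value. A basis \<open>T\<close> of the reachable directions makes the map
  from a linear terminal cost to the terminal displacement square, so injectivity yields
  surjectivity; the tuned cost acts as a multiplier of the terminal constraint in these coordinates.
  Instead of derivatives, exact expansions along lines are used, and slopes are compared through the
  sign of \<open>s * D + s\<^sup>2 / 2 * C\<close> for all real \<open>s\<close>. All subproblems
  share one format: inner blocks get zero terminal cost, the last block keeps the original
  one.\<close>

lemma append_vec_line:
  fixes x dx :: "real vec"
  assumes "x \<in> carrier_vec n" "dx \<in> carrier_vec n" "u \<in> carrier_vec m" "du \<in> carrier_vec m"
  shows "(x + s \<cdot>\<^sub>v dx) @\<^sub>v (u + s \<cdot>\<^sub>v du) = (x @\<^sub>v u) + s \<cdot>\<^sub>v (dx @\<^sub>v du)"
  by (rule eq_vecI) (use assms in auto)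

lemma mult_mat_vec_line:
  fixes M :: "real mat"
  assumes "M \<in> carrier_mat n m" "v \<in> carrier_vec m" "w \<in> carrier_vec m"
  shows "M *\<^sub>v (v + s \<cdot>\<^sub>v w) = M *\<^sub>v v + s \<cdot>\<^sub>v (M *\<^sub>v w)"
  using assms by (simp add: mult_add_distrib_mat_vec[of _ n m] mult_mat_vec[of _ n m])

lemma scalar_prod_line_right:
  fixes v :: "real vec"
  assumes "g \<in> carrier_vec n" "v \<in> carrier_vec n" "w \<in> carrier_vec n"
  shows "g \<bullet> (v + s \<cdot>\<^sub>v w) = g \<bullet> v + s * (g \<bullet> w)"
  using assms by (simp add: scalar_prod_add_distrib[of _ n])

lemma scalar_prod_line_left:
  fixes v :: "real vec"
  assumes "g \<in> carrier_vec n" "v \<in> carrier_vec n" "w \<in> carrier_vec n"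
  shows "(v + s \<cdot>\<^sub>v w) \<bullet> g = v \<bullet> g + s * (w \<bullet> g)"
  using assms by (simp add: add_scalar_prod_distrib[of _ n])

lemma transpose_scalar_prod:
  fixes M :: "real mat"
  assumes "M \<in> carrier_mat n m" "v \<in> carrier_vec m" "w \<in> carrier_vec n"
  shows "(transpose_mat M *\<^sub>v w) \<bullet> v = w \<bullet> (M *\<^sub>v v)"
    "v \<bullet> (transpose_mat M *\<^sub>v w) = w \<bullet> (M *\<^sub>v v)"
proof -
  show 1: "(transpose_mat M *\<^sub>v w) \<bullet> v = w \<bullet> (M *\<^sub>v v)"
    using assms by (metis transpose_vec_mult_scalar)
  have "transpose_mat M *\<^sub>v w \<in> carrier_vec m" using assms by auto
  thus "v \<bullet> (transpose_mat M *\<^sub>v w) = w \<bullet> (M *\<^sub>v v)"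
    using 1 assms by (metis comm_scalar_prod)
qed

lemma sym_mat_scalar_prod:
  assumes "M \<in> carrier_mat n n" "sym_mat M" "v \<in> carrier_vec n" "w \<in> carrier_vec n"
  shows "v \<bullet> (M *\<^sub>v w) = (M *\<^sub>v v) \<bullet> w"
  using transpose_scalar_prod(1)[OF assms(1,4,3)] assms(2) by (simp add: sym_mat_def)

text \<open>The second-order expansion along a line is exact, so slopes are read off as coefficients
  of \<open>s\<close>; symmetry merges the two mixed terms into one.\<close>

lemma quad_line:
  assumes M: "M \<in> carrier_mat n n" "sym_mat M" and g: "g \<in> carrier_vec n"
    and v: "v \<in> carrier_vec n" and w: "w \<in> carrier_vec n"
  shows "quad M g k (v + s \<cdot>\<^sub>v w) =
    quad M g k v + s * ((M *\<^sub>v v + g) \<bullet> w) + s\<^sup>2 / 2 * (w \<bullet> (M *\<^sub>v w))"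
proof -
  have Mv: "M *\<^sub>v v \<in> carrier_vec n" and Mw: "M *\<^sub>v w \<in> carrier_vec n" using M v w by auto
  have "(v + s \<cdot>\<^sub>v w) \<bullet> (M *\<^sub>v (v + s \<cdot>\<^sub>v w)) =
    v \<bullet> (M *\<^sub>v v) + s * (w \<bullet> (M *\<^sub>v v)) + s * (v \<bullet> (M *\<^sub>v w) + s * (w \<bullet> (M *\<^sub>v w)))"
    using v w Mv Mw
    by (simp add: mult_mat_vec_line[OF M(1)] scalar_prod_line_right[of _ n] scalar_prod_line_left[of _ n])
  moreover have "v \<bullet> (M *\<^sub>v w) = (M *\<^sub>v v) \<bullet> w" by (rule sym_mat_scalar_prod[OF M v w])
  moreover have "w \<bullet> (M *\<^sub>v v) = (M *\<^sub>v v) \<bullet> w" using w Mv by (rule comm_scalar_prod)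
  moreover have "g \<bullet> (v + s \<cdot>\<^sub>v w) = g \<bullet> v + s * (g \<bullet> w)"
    using g v w by (rule scalar_prod_line_right)
  moreover have "(M *\<^sub>v v + g) \<bullet> w = (M *\<^sub>v v) \<bullet> w + g \<bullet> w"
    using Mv g w by (rule add_scalar_prod_distrib)
  ultimately show ?thesis
    by (simp add: quad_def algebra_simps power2_eq_square)
qed

lemma congruence_scalar_prod:
  fixes M :: "real mat"
  assumes M: "M \<in> carrier_mat n n" and K: "K \<in> carrier_mat n m" and v: "v \<in> carrier_vec m"
  shows "v \<bullet> ((transpose_mat K * M * K) *\<^sub>v v) = (K *\<^sub>v v) \<bullet> (M *\<^sub>v (K *\<^sub>v v))"
proof -
  have Kv: "K *\<^sub>v v \<in> carrier_vec n" and MKv: "M *\<^sub>v (K *\<^sub>v v) \<in> carrier_vec n"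
    using K v M by auto
  have "(transpose_mat K * M * K) *\<^sub>v v = transpose_mat K *\<^sub>v (M *\<^sub>v (K *\<^sub>v v))"
    using K M v by (simp add: assoc_mult_mat_vec[of _ m n _ m] assoc_mult_mat_vec[of _ m n _ n] assoc_mult_mat[of _ m n _ n _ m])
  thus ?thesis using transpose_scalar_prod(2)[OF K v MKv] Kv MKv by (metis comm_scalar_prod)
qed

text \<open>Expand at \<open>b\<close> with step 1 in the direction \<open>K *\<^sub>v v\<close>.
  The new Hessian is a congruence of \<open>M\<close>, which preserves semidefiniteness.\<close>

lemma quad_affine:
  assumes M: "M \<in> carrier_mat n n" "sym_mat M" and g: "g \<in> carrier_vec n"
    and K: "K \<in> carrier_mat n m" and b: "b \<in> carrier_vec n" and v: "v \<in> carrier_vec m"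
  shows "quad M g k (K *\<^sub>v v + b) =
    quad (transpose_mat K * M * K) (transpose_mat K *\<^sub>v (M *\<^sub>v b + g)) (quad M g k b) v"
proof -
  have Kv: "K *\<^sub>v v \<in> carrier_vec n" and h: "M *\<^sub>v b + g \<in> carrier_vec n"
    and MKv: "M *\<^sub>v (K *\<^sub>v v) \<in> carrier_vec n"
    using K v M b g by auto
  have "quad M g k (b + 1 \<cdot>\<^sub>v (K *\<^sub>v v)) = quad M g k b + (M *\<^sub>v b + g) \<bullet> (K *\<^sub>v v)
     + 1 / 2 * ((K *\<^sub>v v) \<bullet> (M *\<^sub>v (K *\<^sub>v v)))"
    using quad_line[OF M g b Kv, of k 1] by simp
  moreover have "b + 1 \<cdot>\<^sub>v (K *\<^sub>v v) = K *\<^sub>v v + b" using b Kv by (simp add: comm_add_vec)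
  moreover have "(M *\<^sub>v b + g) \<bullet> (K *\<^sub>v v) = (transpose_mat K *\<^sub>v (M *\<^sub>v b + g)) \<bullet> v"
    using transpose_scalar_prod(1)[OF K v h] by simp
  moreover note congruence_scalar_prod[OF M(1) K v]
  ultimately show ?thesis by (simp add: quad_def)
qed

lemma congruence_sym_psd:
  assumes M: "M \<in> carrier_mat n n" "sym_mat M" "psd_mat n M" and K: "K \<in> carrier_mat n m"
  shows "transpose_mat K * M * K \<in> carrier_mat m m" "sym_mat (transpose_mat K * M * K)"
    "psd_mat m (transpose_mat K * M * K)"
proof -
  show "transpose_mat K * M * K \<in> carrier_mat m m" using M K by auto
  show "sym_mat (transpose_mat K * M * K)"
  proof -
    have "transpose_mat (transpose_mat K * M * K) = transpose_mat K * transpose_mat (transpose_mat K * M)"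
      using M K by (intro transpose_mult) auto
    also have "transpose_mat (transpose_mat K * M) = M * K"
      using M K transpose_mult[of "transpose_mat K" m n M n] by (simp add: sym_mat_def)
    finally show ?thesis
      using M K by (simp add: sym_mat_def assoc_mult_mat[of _ m n _ n _ m])
  qed
  show "psd_mat m (transpose_mat K * M * K)" unfolding psd_mat_def
  proof
    fix v :: "real vec" assume v: "v \<in> carrier_vec m"
    have "K *\<^sub>v v \<in> carrier_vec n" using K v by auto
    thus "0 \<le> v \<bullet> ((transpose_mat K * M * K) *\<^sub>v v)"
      using M(3) by (simp add: congruence_scalar_prod[OF M(1) K v] psd_mat_def)
  qed
qed

lemma quad_add:
  assumes "M \<in> carrier_mat n n" "g \<in> carrier_vec n" "M' \<in> carrier_mat n n" "g' \<in> carrier_vec n"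
    "v \<in> carrier_vec n"
  shows "quad M g k v + quad M' g' k' v = quad (M + M') (g + g') (k + k') v"
proof -
  have "M *\<^sub>v v \<in> carrier_vec n" "M' *\<^sub>v v \<in> carrier_vec n" using assms by auto
  thus ?thesis using assms
    by (simp add: quad_def add_mult_distrib_mat_vec[of _ n n] scalar_prod_add_distrib[of _ n]
        add_scalar_prod_distrib[of _ n])
qed

lemma sum_sym_psd:
  assumes "M \<in> carrier_mat n n" "sym_mat M" "psd_mat n M"
    "M' \<in> carrier_mat n n" "sym_mat M'" "psd_mat n M'"
  shows "sym_mat (M + M')" "psd_mat n (M + M')"
proof -
  show "sym_mat (M + M')" using assms by (simp add: sym_mat_def transpose_add[of _ n n])
  show "psd_mat n (M + M')" unfolding psd_mat_def
  proof
    fix v :: "real vec" assume v: "v \<in> carrier_vec n"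
    have "M *\<^sub>v v \<in> carrier_vec n" "M' *\<^sub>v v \<in> carrier_vec n" using assms v by auto
    thus "0 \<le> v \<bullet> ((M + M') *\<^sub>v v)" using assms v
      by (simp add: add_mult_distrib_mat_vec[of _ n n] scalar_prod_add_distrib[of _ n] psd_mat_def)
  qed
qed

section \<open>Functions that agree with a convex quadratic on vectors of one dimension\<close>

definition psd_quadratic :: "nat \<Rightarrow> (real vec \<Rightarrow> real) \<Rightarrow> bool" where
  "psd_quadratic n V \<longleftrightarrow> (\<exists>M g k. M \<in> carrier_mat n n \<and> g \<in> carrier_vec n \<and> sym_mat M \<and> psd_mat n M \<and>
     (\<forall>v \<in> carrier_vec n. V v = quad M g k v))"

lemma psd_quadratic_add:
  assumes "psd_quadratic n V" "psd_quadratic n W"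
  shows "psd_quadratic n (\<lambda>v. V v + W v)"
proof -
  obtain M g k M' g' k' where *: "M \<in> carrier_mat n n" "g \<in> carrier_vec n" "sym_mat M" "psd_mat n M"
     "\<forall>v \<in> carrier_vec n. V v = quad M g k v"
     "M' \<in> carrier_mat n n" "g' \<in> carrier_vec n" "sym_mat M'" "psd_mat n M'"
     "\<forall>v \<in> carrier_vec n. W v = quad M' g' k' v"
    using assms unfolding psd_quadratic_def by metis
  have "\<forall>v \<in> carrier_vec n. V v + W v = quad (M + M') (g + g') (k + k') v"
    using * quad_add[of M n g M' g' _ k k'] by simp
  thus ?thesis unfolding psd_quadratic_def
    using sum_sym_psd[OF *(1,3,4) *(6,8,9)] * by (meson add_carrier_mat add_carrier_vec)
qed

lemma psd_quadratic_zero: "psd_quadratic n (\<lambda>v. 0)"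
proof -
  have "0\<^sub>m n n *\<^sub>v v = 0\<^sub>v n" if "v \<in> carrier_vec n" for v :: "real vec"
    by (rule eq_vecI) (use that in auto)
  thus ?thesis unfolding psd_quadratic_def
    by (intro exI[of _ "0\<^sub>m n n"] exI[of _ "0\<^sub>v n"] exI[of _ 0])
      (auto simp: quad_def sym_mat_def psd_mat_def)
qed

lemma psd_quadratic_sum:
  "(\<And>t. t < n' \<Longrightarrow> psd_quadratic n (V t)) \<Longrightarrow> psd_quadratic n (\<lambda>v. \<Sum>t<(n'::nat). V t v)"
  by (induction n') (auto intro: psd_quadratic_zero psd_quadratic_add)

lemma psd_quadratic_cong:
  "(\<And>v. v \<in> carrier_vec n \<Longrightarrow> V v = W v) \<Longrightarrow> psd_quadratic n V \<longleftrightarrow> psd_quadratic n W"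
  by (auto simp: psd_quadratic_def)

lemma psd_quadratic_affine:
  assumes M: "M \<in> carrier_mat n n" "sym_mat M" "psd_mat n M" and g: "g \<in> carrier_vec n"
    and K: "K \<in> carrier_mat n m" and b: "b \<in> carrier_vec n"
  shows "psd_quadratic m (\<lambda>v. quad M g k (K *\<^sub>v v + b))"
proof -
  have "transpose_mat K *\<^sub>v (M *\<^sub>v b + g) \<in> carrier_vec m" using K M g b by auto
  thus ?thesis unfolding psd_quadratic_def
    using congruence_sym_psd[OF M K] quad_affine[OF M(1,2) g K b] by blast
qed

section \<open>Affine maps and their matrices\<close>

lemma add_swap_vec:
  fixes p :: "real vec"
  assumes "p \<in> carrier_vec n" "q \<in> carrier_vec n" "r \<in> carrier_vec n"
  shows "(p + r) + q = (p + q) + r"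
  by (rule eq_vecI) (use assms in auto)

text \<open>Affinity as one identity in \<open>v\<close>, \<open>w\<close>, \<open>s\<close> with
  base point 0. No matrix occurs, so the identity can be verified for a solution map that is known
  only through uniqueness.\<close>

definition affine_dep :: "nat \<Rightarrow> nat \<Rightarrow> (real vec \<Rightarrow> real vec) \<Rightarrow> bool" where
  "affine_dep n m F \<longleftrightarrow> (\<forall>v \<in> carrier_vec n. F v \<in> carrier_vec m) \<and>
     (\<forall>v \<in> carrier_vec n. \<forall>w \<in> carrier_vec n. \<forall>s. F (v + s \<cdot>\<^sub>v w) = F v + s \<cdot>\<^sub>v (F w - F (0\<^sub>v n)))"

text \<open>The columns of the matrix are the increments of \<open>F\<close> along the unit
  vectors.\<close>

lemma affine_dep_matrix:
  assumes F: "affine_dep n m F"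
  shows "\<exists>K \<in> carrier_mat m n. \<exists>k \<in> carrier_vec m. \<forall>v \<in> carrier_vec n. F v = K *\<^sub>v v + k"
proof -
  define K where "K = mat m n (\<lambda>(i,j). (F (unit_vec n j) - F (0\<^sub>v n)) $ i)"
  have Fc: "F v \<in> carrier_vec m" if "v \<in> carrier_vec n" for v
    using F that by (simp add: affine_dep_def)
  have Kc: "K \<in> carrier_mat m n" by (simp add: K_def)
  have Ku: "K *\<^sub>v unit_vec n j = F (unit_vec n j) - F (0\<^sub>v n)" if "j < n" for j
  proof (rule eq_vecI)
    show "dim_vec (K *\<^sub>v unit_vec n j) = dim_vec (F (unit_vec n j) - F (0\<^sub>v n))"
      using Fc[of "0\<^sub>v n"] Kc by auto
    fix i assume "i < dim_vec (F (unit_vec n j) - F (0\<^sub>v n))"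
    hence i: "i < m" using Fc[of "0\<^sub>v n"] by auto
    thus "(K *\<^sub>v unit_vec n j) $ i = (F (unit_vec n j) - F (0\<^sub>v n)) $ i"
      using that Kc by (simp add: K_def)
  qed
  \<comment> \<open>Switch on the coordinates of \<open>v\<close> one by one: each step adds a
    multiple of a unit vector, and these are the directions in which \<open>K\<close> is
    known.\<close>
  have *: "F (vec n (\<lambda>j. if j < l then v $ j else 0)) = K *\<^sub>v vec n (\<lambda>j. if j < l then v $ j else 0) + F (0\<^sub>v n)"
    if "l \<le> n" for l and v :: "real vec" using that
  proof (induction l)
    case 0
    have "vec n (\<lambda>j. if j < 0 then v $ j else 0) = 0\<^sub>v n" by auto
    moreover have "K *\<^sub>v 0\<^sub>v n = 0\<^sub>v m" using Kc by auto
    ultimately show ?case using Fc[of "0\<^sub>v n"] by simp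
  next
    case (Suc l)
    let ?w = "vec n (\<lambda>j. if j < l then v $ j else 0)"
    have w: "vec n (\<lambda>j. if j < Suc l then v $ j else 0) = ?w + (v $ l) \<cdot>\<^sub>v unit_vec n l"
      by (rule eq_vecI) (use Suc.prems in \<open>auto simp: unit_vec_def less_Suc_eq\<close>)
    have "F (?w + (v $ l) \<cdot>\<^sub>v unit_vec n l) = F ?w + (v $ l) \<cdot>\<^sub>v (F (unit_vec n l) - F (0\<^sub>v n))"
      using F by (simp add: affine_dep_def)
    also have "\<dots> = (K *\<^sub>v ?w + F (0\<^sub>v n)) + (v $ l) \<cdot>\<^sub>v (K *\<^sub>v unit_vec n l)"
      using Suc by (simp add: Ku)
    also have "\<dots> = K *\<^sub>v (?w + (v $ l) \<cdot>\<^sub>v unit_vec n l) + F (0\<^sub>v n)"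
    proof -
      have "K *\<^sub>v ?w \<in> carrier_vec m" "K *\<^sub>v unit_vec n l \<in> carrier_vec m" "F (0\<^sub>v n) \<in> carrier_vec m"
        using Kc Fc by auto
      thus ?thesis
        unfolding mult_mat_vec_line[OF Kc vec_carrier unit_vec_carrier]
        by - (rule add_swap_vec, simp_all)
    qed
    finally show ?case unfolding w .
  qed
  have "F v = K *\<^sub>v v + F (0\<^sub>v n)" if "v \<in> carrier_vec n" for v
  proof -
    have v: "vec n (\<lambda>j. if j < n then v $ j else 0) = v" using that by auto
    show ?thesis using *[OF order_refl, of v] unfolding v .
  qed
  moreover have "F (0\<^sub>v n) \<in> carrier_vec m" using Fc by simp
  ultimately show ?thesis using Kc by blast
qed

section \<open>Square systems and minimisers of definite quadratics\<close>

lemma injective_mat_solve: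
  fixes M :: "real mat"
  assumes M: "M \<in> carrier_mat n n" and inj: "\<And>v. v \<in> carrier_vec n \<Longrightarrow> M *\<^sub>v v = 0\<^sub>v n \<Longrightarrow> v = 0\<^sub>v n"
    and b: "b \<in> carrier_vec n"
  shows "\<exists>v \<in> carrier_vec n. M *\<^sub>v v = b"
proof -
  have "det M \<noteq> 0" using det_0_iff_vec_prod_zero[OF M] inj by auto
  then obtain B where B: "B \<in> carrier_mat n n" "M * B = 1\<^sub>m n"
    using det_non_zero_imp_unit[OF M] M unfolding Units_def ring_mat_def by auto
  have "M *\<^sub>v (B *\<^sub>v b) = b" using M B b by (metis assoc_mult_mat_vec one_mult_mat_vec)
  thus ?thesis using B b by (metis mult_mat_vec_carrier)
qed

text \<open>The minimiser solves \<open>M *\<^sub>v v = - g\<close>, which is possible because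
  definiteness makes \<open>M\<close> injective; there the linear term of the expansion
  vanishes.\<close>

lemma pd_quad_minimizer:
  assumes M: "M \<in> carrier_mat n n" "sym_mat M" "pd_mat n M" and g: "g \<in> carrier_vec n"
  shows "\<exists>v \<in> carrier_vec n. \<forall>w \<in> carrier_vec n. quad M g k v \<le> quad M g k w"
proof -
  have "v = 0\<^sub>v n" if "v \<in> carrier_vec n" "M *\<^sub>v v = 0\<^sub>v n" for v
  proof (rule ccontr)
    assume "v \<noteq> 0\<^sub>v n"
    hence "0 < v \<bullet> (M *\<^sub>v v)" using M(3) that(1) by (simp add: pd_mat_def)
    thus False using that by simp
  qed
  then obtain v where v: "v \<in> carrier_vec n" "M *\<^sub>v v = - g"
    using injective_mat_solve[OF M(1), of "- g"] g by auto
  have "quad M g k v \<le> quad M g k w" if w: "w \<in> carrier_vec n" for w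
  proof -
    have d: "w - v \<in> carrier_vec n" using v w by auto
    have "v + 1 \<cdot>\<^sub>v (w - v) = w" using v w by auto
    moreover have "M *\<^sub>v v + g = 0\<^sub>v n" using v g by auto
    moreover have "0 \<le> (w - v) \<bullet> (M *\<^sub>v (w - v))"
    proof (cases "w - v = 0\<^sub>v n")
      case True
      thus ?thesis using M(1) by simp
    next
      case False
      thus ?thesis using M(3) d by (auto simp: pd_mat_def less_imp_le)
    qed
    ultimately show ?thesis using quad_line[OF M(1,2) g v(1) d, of k 1] d by simp
  qed
  thus ?thesis using v by blast
qed

text \<open>A stage with state component 0 sees just the input block of the Hessian. This makes
  definiteness of that block usable although the whole Hessian is merely semidefinite.\<close>

lemma Hu_block_quad:
  assumes M: "M \<in> carrier_mat (n + m) (n + m)" and u: "u \<in> carrier_vec m"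
  shows "(0\<^sub>v n @\<^sub>v u) \<bullet> (M *\<^sub>v (0\<^sub>v n @\<^sub>v u)) = u \<bullet> (Hu_block n m M *\<^sub>v u)"
proof -
  let ?z = "0\<^sub>v n @\<^sub>v u"
  have z: "?z \<in> carrier_vec (n + m)" using u by auto
  have Mz: "M *\<^sub>v ?z \<in> carrier_vec (n + m)" using M z by auto
  have "Hu_block n m M *\<^sub>v u = vec_last (M *\<^sub>v ?z) m"
  proof (rule eq_vecI)
    fix i assume "i < dim_vec (vec_last (M *\<^sub>v ?z) m)"
    hence i: "i < m" by simp
    have r: "row M (n + i) = vec_first (row M (n + i)) n @\<^sub>v row (Hu_block n m M) i"
      by (rule eq_vecI) (use M i in \<open>auto simp: Hu_block_def vec_first_def\<close>)
    have "row M (n + i) \<bullet> ?z = vec_first (row M (n + i)) n \<bullet> 0\<^sub>v n + row (Hu_block n m M) i \<bullet> u"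
      by (subst r, rule scalar_prod_append[of _ n _ m]) (use u i in \<open>auto simp: Hu_block_def\<close>)
    thus "(Hu_block n m M *\<^sub>v u) $ i = vec_last (M *\<^sub>v ?z) m $ i"
      using M i by (simp add: vec_last_def Hu_block_def)
  qed (simp add: Hu_block_def)
  moreover have "M *\<^sub>v ?z = vec_first (M *\<^sub>v ?z) n @\<^sub>v vec_last (M *\<^sub>v ?z) m"
    using vec_first_last_append[OF Mz] by simp
  then have "?z \<bullet> (M *\<^sub>v ?z) = 0\<^sub>v n \<bullet> vec_first (M *\<^sub>v ?z) n + u \<bullet> vec_last (M *\<^sub>v ?z) m"
    by (metis scalar_prod_append u vec_first_carrier vec_last_carrier zero_carrier_vec)
  ultimately show ?thesis by simp
qed

section \<open>Optimality on a single horizon\<close>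

lemma add_line_vec:
  fixes p :: "real vec"
  assumes "p \<in> carrier_vec n" "dp \<in> carrier_vec n" "q \<in> carrier_vec n" "dq \<in> carrier_vec n" "r \<in> carrier_vec n"
  shows "(p + q + r) + s \<cdot>\<^sub>v (dp + dq) = (p + s \<cdot>\<^sub>v dp) + (q + s \<cdot>\<^sub>v dq) + r"
  by (rule eq_vecI) (use assms in \<open>auto simp: algebra_simps\<close>)

lemma diff_add_vec:
  fixes p :: "real vec"
  assumes "p \<in> carrier_vec n" "p' \<in> carrier_vec n" "q \<in> carrier_vec n" "q' \<in> carrier_vec n" "r \<in> carrier_vec n"
  shows "(p' + q' + r) - (p + q + r) = (p' - p) + (q' - q)"
  by (rule eq_vecI) (use assms in auto)

lemma mult_mat_vec_affine_combination:
  fixes p0 :: "real vec"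
  assumes "M \<in> carrier_mat m n" "p0 \<in> carrier_vec n" "p1 \<in> carrier_vec n" "p2 \<in> carrier_vec n"
  shows "M *\<^sub>v (p1 + s \<cdot>\<^sub>v (p2 - p0)) = M *\<^sub>v p1 + s \<cdot>\<^sub>v (M *\<^sub>v p2 - M *\<^sub>v p0)"
  using assms by (simp add: mult_mat_vec_line[of _ m n] mult_minus_distrib_mat_vec[of _ m n])

lemma vec_eq_add_diff:
  fixes v :: "real vec"
  assumes "v \<in> carrier_vec n" "w \<in> carrier_vec n"
  shows "w = v + 1 \<cdot>\<^sub>v (w - v)"
  by (rule eq_vecI) (use assms in auto)

text \<open>For small \<open>s\<close> the linear term dominates. No sign of \<open>C\<close> is
  assumed, because the lemma is also applied to a difference of two quadratics, whose curvature is
  not known beforehand.\<close>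

lemma linear_coeff_zero:
  fixes D C :: real
  assumes "\<And>s. 0 \<le> s * D + s\<^sup>2 / 2 * C"
  shows "D = 0"
proof (rule ccontr)
  assume D: "D \<noteq> 0"
  \<comment> \<open>The summand 1 keeps the divisor positive when \<open>C\<close> is 0. At
    \<open>s = - D / E\<close> the bound equals \<open>- (D\<^sup>2 / (2 * E))\<close>.\<close>
  define E where "E = \<bar>C\<bar> + 1"
  have E: "E > 0" "C \<le> E" by (auto simp: E_def)
  define s where "s = - D / E"
  have "s * D + s\<^sup>2 / 2 * C \<le> s * D + s\<^sup>2 / 2 * E"
    using E by (intro add_left_mono mult_left_mono) auto
  also have "\<dots> = - (D\<^sup>2 / (2 * E))"
    using E unfolding s_def by (simp add: field_simps power2_eq_square)
  also have "\<dots> < 0" using D E by simp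
  finally show False using assms[of s] by simp
qed

lemma affine_dep_value:
  "affine_dep n m F \<Longrightarrow> v \<in> carrier_vec n \<Longrightarrow> F v \<in> carrier_vec m"
  by (simp add: affine_dep_def)

lemma affine_dep_line:
  "affine_dep n m F \<Longrightarrow> v \<in> carrier_vec n \<Longrightarrow> w \<in> carrier_vec n \<Longrightarrow>
    F (v + s \<cdot>\<^sub>v w) = F v + s \<cdot>\<^sub>v (F w - F (0\<^sub>v n))"
  by (simp add: affine_dep_def)

lemma mpc_obj_cong:
  assumes "\<And>t. t \<le> N \<Longrightarrow> y t = x t" "\<And>t. t < N \<Longrightarrow> v t = u t"
  shows "mpc_obj N H f c y v = mpc_obj N H f c x u"
  using assms by (simp add: mpc_obj_def stages_obj_def)

lemma mpc_feas_cong: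
  assumes "\<And>t. t \<le> N \<Longrightarrow> y t = x t" "\<And>t. t < N \<Longrightarrow> v t = u t"
  shows "mpc_feas nx nu N A B a x0 y v \<longleftrightarrow> mpc_feas nx nu N A B a x0 x u"
  using assms by (simp add: mpc_feas_def Suc_le_eq)

text \<open>Stated for arbitrary data, since the same facts are needed for the full problem, for the
  tail left after one stage, for every block, and for a modified terminal cost.\<close>

locale mpc_data =
  fixes nx :: nat and nu :: "nat \<Rightarrow> nat" and N :: nat
    and H :: "nat \<Rightarrow> real mat" and f :: "nat \<Rightarrow> real vec" and c :: "nat \<Rightarrow> real"
    and A B :: "nat \<Rightarrow> real mat" and a :: "nat \<Rightarrow> real vec"
  assumes A_carrier: "t < N \<Longrightarrow> A t \<in> carrier_mat nx nx"
    and B_carrier: "t < N \<Longrightarrow> B t \<in> carrier_mat nx (nu t)"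
    and a_carrier: "t < N \<Longrightarrow> a t \<in> carrier_vec nx"
    and H_carrier: "t < N \<Longrightarrow> H t \<in> carrier_mat (nx + nu t) (nx + nu t)"
    and f_carrier: "t < N \<Longrightarrow> f t \<in> carrier_vec (nx + nu t)"
    and H_sym: "t < N \<Longrightarrow> sym_mat (H t)"
    and H_psd: "t < N \<Longrightarrow> psd_mat (nx + nu t) (H t)"
    and Hu_pd: "t < N \<Longrightarrow> pd_mat (nu t) (Hu_block nx (nu t) (H t))"
    and HN_carrier: "H N \<in> carrier_mat nx nx"
    and fN_carrier: "f N \<in> carrier_vec nx"
    and HN_sym: "sym_mat (H N)"
    and HN_psd: "psd_mat nx (H N)"
begin

definition traj :: "(nat \<Rightarrow> real vec) \<Rightarrow> (nat \<Rightarrow> real vec) \<Rightarrow> bool" where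
  "traj x u \<longleftrightarrow> (\<forall>t\<le>N. x t \<in> carrier_vec nx) \<and> (\<forall>t<N. u t \<in> carrier_vec (nu t))"

text \<open>The directions in which a feasible trajectory can move, its initial state
  included.\<close>

definition hom :: "(nat \<Rightarrow> real vec) \<Rightarrow> (nat \<Rightarrow> real vec) \<Rightarrow> bool" where
  "hom dx du \<longleftrightarrow> traj dx du \<and> (\<forall>t<N. dx (Suc t) = A t *\<^sub>v dx t + B t *\<^sub>v du t)"

text \<open>Directional derivative of the summed stage costs at \<open>(x, u)\<close>. It is kept
  apart from the terminal cost because the subproblems with terminal constraint have none.\<close>

definition stages_dobj where
  "stages_dobj x u dx du = (\<Sum>t<N. (H t *\<^sub>v (x t @\<^sub>v u t) + f t) \<bullet> (dx t @\<^sub>v du t))"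

definition dobj where
  "dobj x u dx du = stages_dobj x u dx du + (H N *\<^sub>v x N + f N) \<bullet> dx N"

definition curv where
  "curv dx du = (\<Sum>t<N. (dx t @\<^sub>v du t) \<bullet> (H t *\<^sub>v (dx t @\<^sub>v du t))) + dx N \<bullet> (H N *\<^sub>v dx N)"

abbreviation feas where "feas \<equiv> mpc_feas nx nu N A B a"
abbreviation obj where "obj \<equiv> mpc_obj N H f c"

(* e switches the terminal constraint x_N = xT on; g is an extra linear terminal cost. *)
definition efeas :: "bool \<Rightarrow> real vec \<Rightarrow> real vec \<Rightarrow> (nat \<Rightarrow> real vec) \<Rightarrow> (nat \<Rightarrow> real vec) \<Rightarrow> bool" where
  "efeas e x0 xT x u \<longleftrightarrow> feas x0 x u \<and> (e \<longrightarrow> x N = xT)"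

definition eopt :: "bool \<Rightarrow> real vec \<Rightarrow> real vec \<Rightarrow> real vec \<Rightarrow> (nat \<Rightarrow> real vec) \<Rightarrow> (nat \<Rightarrow> real vec) \<Rightarrow> bool" where
  "eopt e g x0 xT x u \<longleftrightarrow> efeas e x0 xT x u \<and>
     (\<forall>x' u'. efeas e x0 xT x' u' \<longrightarrow> obj x u + g \<bullet> x N \<le> obj x' u' + g \<bullet> x' N)"

lemma feas_traj: "feas x0 x u \<Longrightarrow> traj x u"
  by (simp add: mpc_feas_def traj_def)

lemma stage_carrier:
  "traj x u \<Longrightarrow> t < N \<Longrightarrow> x t @\<^sub>v u t \<in> carrier_vec (nx + nu t)"
  by (auto simp: traj_def)

lemma obj_line:
  assumes x: "traj x u" and d: "traj dx du"
    and y: "\<And>t. t \<le> N \<Longrightarrow> y t = x t + s \<cdot>\<^sub>v dx t" and v: "\<And>t. t < N \<Longrightarrow> v t = u t + s \<cdot>\<^sub>v du t"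
  shows "obj y v = obj x u + s * dobj x u dx du + s\<^sup>2 / 2 * curv dx du"
proof -
  have "stage_cost (H t) (f t) (c t) (y t) (v t) = stage_cost (H t) (f t) (c t) (x t) (u t)
     + s * ((H t *\<^sub>v (x t @\<^sub>v u t) + f t) \<bullet> (dx t @\<^sub>v du t))
     + s\<^sup>2 / 2 * ((dx t @\<^sub>v du t) \<bullet> (H t *\<^sub>v (dx t @\<^sub>v du t)))" if t: "t < N" for t
  proof -
    have "y t @\<^sub>v v t = (x t @\<^sub>v u t) + s \<cdot>\<^sub>v (dx t @\<^sub>v du t)"
      using x d t by (simp add: y v, intro append_vec_line[of _ nx _ _ "nu t"]) (auto simp: traj_def)
    thus ?thesis unfolding stage_cost_def
      using quad_line[OF H_carrier[OF t] H_sym[OF t] f_carrier[OF t] stage_carrier[OF x t] stage_carrier[OF d t]]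
      by simp
  qed
  moreover have "quad (H N) (f N) (c N) (y N) = quad (H N) (f N) (c N) (x N)
      + s * ((H N *\<^sub>v x N + f N) \<bullet> dx N) + s\<^sup>2 / 2 * (dx N \<bullet> (H N *\<^sub>v dx N))"
    using quad_line[OF HN_carrier HN_sym fN_carrier] x d by (simp add: y traj_def)
  ultimately show ?thesis
    by (simp add: mpc_obj_def stages_obj_def dobj_def stages_dobj_def curv_def sum.distrib
        sum_distrib_left algebra_simps)
qed

lemma curv_nonneg:
  assumes "traj dx du"
  shows "0 \<le> curv dx du"
  unfolding curv_def
  using assms HN_psd H_psd stage_carrier[OF assms]
  by (intro add_nonneg_nonneg sum_nonneg) (auto simp: psd_mat_def traj_def)

lemma curv_zero:
  assumes d: "hom dx du" and 0: "dx 0 = 0\<^sub>v nx" and C: "curv dx du \<le> 0"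
  shows "t \<le> N \<Longrightarrow> dx t = 0\<^sub>v nx" "t < N \<Longrightarrow> du t = 0\<^sub>v (nu t)"
proof -
  have tr: "traj dx du" using d by (simp add: hom_def)
  let ?g = "\<lambda>t. (dx t @\<^sub>v du t) \<bullet> (H t *\<^sub>v (dx t @\<^sub>v du t))"
  have g: "0 \<le> ?g t" if "t < N" for t
    using H_psd[OF that] stage_carrier[OF tr that] by (simp add: psd_mat_def)
  have "0 \<le> dx N \<bullet> (H N *\<^sub>v dx N)" using HN_psd tr by (simp add: psd_mat_def traj_def)
  hence "(\<Sum>t<N. ?g t) \<le> 0" using C by (simp add: curv_def)
  hence "(\<Sum>t<N. ?g t) = 0" using g by (intro antisym sum_nonneg) auto
  hence g0: "?g t = 0" if "t < N" for t
    using sum_nonneg_eq_0_iff[of "{..<N}" ?g] g that by auto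
  have du0: "du t = 0\<^sub>v (nu t)" if t: "t < N" and x: "dx t = 0\<^sub>v nx" for t
  proof (rule ccontr)
    have u: "du t \<in> carrier_vec (nu t)" using tr t by (simp add: traj_def)
    assume "du t \<noteq> 0\<^sub>v (nu t)"
    hence "0 < du t \<bullet> (Hu_block nx (nu t) (H t) *\<^sub>v du t)"
      using Hu_pd[OF t] u by (simp add: pd_mat_def)
    thus False using g0[OF t] Hu_block_quad[OF H_carrier[OF t] u] x by simp
  qed
  have dx0: "dx t = 0\<^sub>v nx" if "t \<le> N" for t using that
  proof (induction t)
    case (Suc t)
    hence "du t = 0\<^sub>v (nu t)" using du0 by simp
    hence "dx (Suc t) = A t *\<^sub>v 0\<^sub>v nx + B t *\<^sub>v 0\<^sub>v (nu t)" using d Suc by (simp add: hom_def)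
    thus ?case using A_carrier[of t] B_carrier[of t] Suc.prems by auto
  qed (simp add: 0)
  show "t \<le> N \<Longrightarrow> dx t = 0\<^sub>v nx" "t < N \<Longrightarrow> du t = 0\<^sub>v (nu t)" using dx0 du0 by auto
qed

lemma feas_line:
  assumes x: "feas x0 x u" and d: "hom dx du"
  shows "feas (x0 + s \<cdot>\<^sub>v dx 0) (\<lambda>t. x t + s \<cdot>\<^sub>v dx t) (\<lambda>t. u t + s \<cdot>\<^sub>v du t)"
proof -
  have "x (Suc t) + s \<cdot>\<^sub>v dx (Suc t) =
      A t *\<^sub>v (x t + s \<cdot>\<^sub>v dx t) + B t *\<^sub>v (u t + s \<cdot>\<^sub>v du t) + a t" if t: "t < N" for t
  proof -
    have c: "x t \<in> carrier_vec nx" "dx t \<in> carrier_vec nx" "u t \<in> carrier_vec (nu t)" "du t \<in> carrier_vec (nu t)"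
      using t x d by (auto simp: mpc_feas_def hom_def traj_def)
    have m: "A t *\<^sub>v x t \<in> carrier_vec nx" "A t *\<^sub>v dx t \<in> carrier_vec nx"
      "B t *\<^sub>v u t \<in> carrier_vec nx" "B t *\<^sub>v du t \<in> carrier_vec nx"
      using c A_carrier[OF t] B_carrier[OF t] by auto
    have "(A t *\<^sub>v x t + B t *\<^sub>v u t + a t) + s \<cdot>\<^sub>v (A t *\<^sub>v dx t + B t *\<^sub>v du t) =
      (A t *\<^sub>v x t + s \<cdot>\<^sub>v (A t *\<^sub>v dx t)) + (B t *\<^sub>v u t + s \<cdot>\<^sub>v (B t *\<^sub>v du t)) + a t"
      using m a_carrier[OF t] by (intro add_line_vec)
    thus ?thesis using x d t c
      by (simp add: mpc_feas_def hom_def mult_mat_vec_line[OF A_carrier[OF t]] mult_mat_vec_line[OF B_carrier[OF t]])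
  qed
  thus ?thesis using x d by (auto simp: mpc_feas_def hom_def traj_def)
qed

lemma feas_diff:
  assumes x: "feas x0 x u" and y: "feas y0 y v"
  shows "hom (\<lambda>t. y t - x t) (\<lambda>t. v t - u t)"
proof -
  have "y (Suc t) - x (Suc t) = A t *\<^sub>v (y t - x t) + B t *\<^sub>v (v t - u t)" if t: "t < N" for t
  proof -
    have c: "x t \<in> carrier_vec nx" "y t \<in> carrier_vec nx" "u t \<in> carrier_vec (nu t)" "v t \<in> carrier_vec (nu t)"
      using t x y by (auto simp: mpc_feas_def)
    have m: "A t *\<^sub>v x t \<in> carrier_vec nx" "A t *\<^sub>v y t \<in> carrier_vec nx"
      "B t *\<^sub>v u t \<in> carrier_vec nx" "B t *\<^sub>v v t \<in> carrier_vec nx"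
      using c A_carrier[OF t] B_carrier[OF t] by auto
    have "(A t *\<^sub>v y t + B t *\<^sub>v v t + a t) - (A t *\<^sub>v x t + B t *\<^sub>v u t + a t) =
      (A t *\<^sub>v y t - A t *\<^sub>v x t) + (B t *\<^sub>v v t - B t *\<^sub>v u t)"
      using m a_carrier[OF t] by (intro diff_add_vec)
    thus ?thesis using x y t c
      by (simp add: mpc_feas_def mult_minus_distrib_mat_vec[OF A_carrier[OF t]] mult_minus_distrib_mat_vec[OF B_carrier[OF t]])
  qed
  thus ?thesis using x y by (auto simp: mpc_feas_def hom_def traj_def)
qed

lemma obj_diff:
  assumes x: "feas x0 x u" and y: "feas y0 y v"
  shows "obj y v = obj x u + dobj x u (\<lambda>t. y t - x t) (\<lambda>t. v t - u t)
    + 1 / 2 * curv (\<lambda>t. y t - x t) (\<lambda>t. v t - u t)"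
proof -
  have t: "traj x u" "traj y v" using x y by (auto dest: feas_traj)
  have "obj y v = obj x u + 1 * dobj x u (\<lambda>t. y t - x t) (\<lambda>t. v t - u t)
    + 1\<^sup>2 / 2 * curv (\<lambda>t. y t - x t) (\<lambda>t. v t - u t)"
  proof (rule obj_line)
    show "traj (\<lambda>t. y t - x t) (\<lambda>t. v t - u t)" using feas_diff[OF x y] by (simp add: hom_def)
    show "y t = x t + 1 \<cdot>\<^sub>v (y t - x t)" if "t \<le> N" for t
      by (rule vec_eq_add_diff[of _ nx]) (use t that in \<open>auto simp: traj_def\<close>)
    show "v t = u t + 1 \<cdot>\<^sub>v (v t - u t)" if "t < N" for t
      by (rule vec_eq_add_diff[of _ "nu t"]) (use t that in \<open>auto simp: traj_def\<close>)
  qed (rule t)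
  thus ?thesis by simp
qed

text \<open>Necessity moves the optimum along a direction both ways; sufficiency holds since the
  expansion is exact and its quadratic part nonnegative.\<close>

lemma eopt_iff:
  assumes x: "efeas e x0 xT x u" and g: "g \<in> carrier_vec nx"
  shows "eopt e g x0 xT x u \<longleftrightarrow>
    (\<forall>dx du. hom dx du \<and> dx 0 = 0\<^sub>v nx \<and> (e \<longrightarrow> dx N = 0\<^sub>v nx) \<longrightarrow> dobj x u dx du + g \<bullet> dx N = 0)"
    (is "_ \<longleftrightarrow> ?stat")
proof
  have fx: "feas x0 x u" using x by (simp add: efeas_def)
  hence xN: "x N \<in> carrier_vec nx" and x0: "x0 \<in> carrier_vec nx" and x00: "x 0 = x0"
    by (auto simp: mpc_feas_def)
  {
    assume opt: "eopt e g x0 xT x u"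
    show ?stat
    proof (intro allI impI)
      fix dx du assume d: "hom dx du \<and> dx 0 = 0\<^sub>v nx \<and> (e \<longrightarrow> dx N = 0\<^sub>v nx)"
      have dc: "traj dx du" "dx N \<in> carrier_vec nx" using d by (auto simp: hom_def traj_def)
      have "0 \<le> s * (dobj x u dx du + g \<bullet> dx N) + s\<^sup>2 / 2 * curv dx du" for s
      proof -
        let ?y = "\<lambda>t. x t + s \<cdot>\<^sub>v dx t" and ?v = "\<lambda>t. u t + s \<cdot>\<^sub>v du t"
        have "s \<cdot>\<^sub>v 0\<^sub>v nx = (0\<^sub>v nx :: real vec)" by auto
        hence "efeas e x0 xT ?y ?v"
          using feas_line[OF fx, of dx du s] d x x0 xN by (auto simp: efeas_def)
        hence "obj x u + g \<bullet> x N \<le> obj ?y ?v + g \<bullet> ?y N" using opt unfolding eopt_def by blast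
        moreover have "obj ?y ?v = obj x u + s * dobj x u dx du + s\<^sup>2 / 2 * curv dx du"
          by (rule obj_line[OF feas_traj[OF fx] dc(1)]) auto
        moreover have "g \<bullet> ?y N = g \<bullet> x N + s * (g \<bullet> dx N)"
          using g xN dc(2) by (rule scalar_prod_line_right)
        ultimately show ?thesis by (simp add: algebra_simps)
      qed
      thus "dobj x u dx du + g \<bullet> dx N = 0" by (rule linear_coeff_zero)
    qed
  }
  assume st: ?stat
  have "obj x u + g \<bullet> x N \<le> obj x' u' + g \<bullet> x' N" if x': "efeas e x0 xT x' u'" for x' u'
  proof -
    have fx': "feas x0 x' u'" using x' by (simp add: efeas_def)
    let ?dx = "\<lambda>t. x' t - x t" and ?du = "\<lambda>t. u' t - u t"
    have h: "hom ?dx ?du" by (rule feas_diff[OF fx fx'])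
    have x'N: "x' N \<in> carrier_vec nx" and x'0: "x' 0 = x0" using fx' by (auto simp: mpc_feas_def)
    have "dobj x u ?dx ?du + g \<bullet> ?dx N = 0"
    proof (intro st[rule_format] conjI)
      show "?dx 0 = 0\<^sub>v nx" using x0 x'0 x00 by simp
      show "e \<longrightarrow> ?dx N = 0\<^sub>v nx" using x x' xN by (auto simp: efeas_def)
    qed (rule h)
    moreover have "g \<bullet> ?dx N = g \<bullet> x' N - g \<bullet> x N"
      using g xN x'N by (simp add: scalar_prod_minus_distrib[of _ nx])
    moreover have "0 \<le> curv ?dx ?du" using h by (intro curv_nonneg) (simp add: hom_def)
    ultimately show ?thesis using obj_diff[OF fx fx'] by simp
  qed
  thus "eopt e g x0 xT x u" using x by (simp add: eopt_def)
qed

text \<open>Stationarity at one optimum reduces the difference of the two objectives to half the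
  curvature of the difference trajectory. Optimality of the other makes this curvature nonpositive,
  and the difference starts at 0.\<close>

lemma eopt_unique:
  assumes x: "eopt e g x0 xT x u" and y: "eopt e g x0 xT y v" and g: "g \<in> carrier_vec nx"
  shows "t \<le> N \<Longrightarrow> y t = x t" "t < N \<Longrightarrow> v t = u t"
proof -
  have ex: "efeas e x0 xT x u" and ey: "efeas e x0 xT y v" using x y by (auto simp: eopt_def)
  have fx: "feas x0 x u" and fy: "feas x0 y v" using ex ey by (auto simp: efeas_def)
  have xN: "x N \<in> carrier_vec nx" "y N \<in> carrier_vec nx" and 0: "x 0 = x0" "y 0 = x0" "x0 \<in> carrier_vec nx"
    using fx fy by (auto simp: mpc_feas_def)
  let ?dx = "\<lambda>t. y t - x t" and ?du = "\<lambda>t. v t - u t"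
  have h: "hom ?dx ?du" by (rule feas_diff[OF fx fy])
  have "dobj x u ?dx ?du + g \<bullet> ?dx N = 0"
  proof (intro eopt_iff[OF ex g, THEN iffD1, OF x, rule_format] conjI)
    show "?dx 0 = 0\<^sub>v nx" using 0 by simp
    show "e \<longrightarrow> ?dx N = 0\<^sub>v nx" using ex ey xN by (auto simp: efeas_def)
  qed (rule h)
  moreover have "g \<bullet> ?dx N = g \<bullet> y N - g \<bullet> x N"
    using g xN by (simp add: scalar_prod_minus_distrib[of _ nx])
  moreover have "obj y v + g \<bullet> y N \<le> obj x u + g \<bullet> x N" using y ex by (auto simp: eopt_def)
  ultimately have "curv ?dx ?du \<le> 0" using obj_diff[OF fx fy] by simp
  from curv_zero[OF h _ this] have z: "t \<le> N \<Longrightarrow> y t - x t = 0\<^sub>v nx" "t < N \<Longrightarrow> v t - u t = 0\<^sub>v (nu t)" for t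
    using 0 by auto
  have eq: "p = q" if "p - q = 0\<^sub>v n" "p \<in> carrier_vec n" "q \<in> carrier_vec n" for p q :: "real vec" and n
    using vec_eq_add_diff[OF that(3,2)] that by simp
  have tr: "traj x u" "traj y v" using fx fy by (auto dest: feas_traj)
  show "y t = x t" if "t \<le> N"
    by (rule eq[OF z(1)[OF that]]) (use tr that in \<open>auto simp: traj_def\<close>)
  show "v t = u t" if "t < N"
    by (rule eq[OF z(2)[OF that]]) (use tr that in \<open>auto simp: traj_def\<close>)
qed

section \<open>Affine dependence of the optimum on the parameters\<close>

lemma eopt_cong:
  assumes "\<And>t. t \<le> N \<Longrightarrow> y t = x t" "\<And>t. t < N \<Longrightarrow> v t = u t"
  shows "eopt e g x0 xT y v \<longleftrightarrow> eopt e g x0 xT x u"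
  unfolding eopt_def efeas_def
  using mpc_obj_cong[of N y x v u H f c] mpc_feas_cong[of N y x v u nx nu A B a x0] assms by simp

text \<open>The gradient of a quadratic is affine in the point, so it respects combinations of three
  points with weights \<open>1\<close>, \<open>s\<close>, \<open>- s\<close>.\<close>

lemma dobj_affine_combination:
  assumes "traj x0 u0" "traj x1 u1" "traj x2 u2" "traj dx du"
  shows "dobj (\<lambda>t. x1 t + s \<cdot>\<^sub>v (x2 t - x0 t)) (\<lambda>t. u1 t + s \<cdot>\<^sub>v (u2 t - u0 t)) dx du =
    dobj x1 u1 dx du + s * (dobj x2 u2 dx du - dobj x0 u0 dx du)"
proof -
  have lin: "(M *\<^sub>v (p1 + s \<cdot>\<^sub>v (p2 - p0)) + g) \<bullet> w =
      (M *\<^sub>v p1 + g) \<bullet> w + s * ((M *\<^sub>v p2 + g) \<bullet> w - (M *\<^sub>v p0 + g) \<bullet> w)"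
    if "M \<in> carrier_mat n n" "p0 \<in> carrier_vec n" "p1 \<in> carrier_vec n" "p2 \<in> carrier_vec n"
      "g \<in> carrier_vec n" "w \<in> carrier_vec n" for M g w and p0 p1 p2 :: "real vec" and n
  proof -
    have "M *\<^sub>v p0 \<in> carrier_vec n" "M *\<^sub>v p1 \<in> carrier_vec n" "M *\<^sub>v p2 \<in> carrier_vec n"
      using that by auto
    thus ?thesis using that
      by (simp add: mult_mat_vec_affine_combination[of _ n n] add_scalar_prod_distrib[of _ n]
          minus_scalar_prod_distrib[of _ n])
  qed
  have st: "(H t *\<^sub>v ((x1 t + s \<cdot>\<^sub>v (x2 t - x0 t)) @\<^sub>v (u1 t + s \<cdot>\<^sub>v (u2 t - u0 t))) + f t) \<bullet> (dx t @\<^sub>v du t)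
    = (H t *\<^sub>v (x1 t @\<^sub>v u1 t) + f t) \<bullet> (dx t @\<^sub>v du t)
      + s * ((H t *\<^sub>v (x2 t @\<^sub>v u2 t) + f t) \<bullet> (dx t @\<^sub>v du t) - (H t *\<^sub>v (x0 t @\<^sub>v u0 t) + f t) \<bullet> (dx t @\<^sub>v du t))"
    if t: "t < N" for t
  proof -
    have c: "x0 t \<in> carrier_vec nx" "x1 t \<in> carrier_vec nx" "x2 t \<in> carrier_vec nx"
      "u0 t \<in> carrier_vec (nu t)" "u1 t \<in> carrier_vec (nu t)" "u2 t \<in> carrier_vec (nu t)"
      using assms t by (auto simp: traj_def)
    have "(x1 t + s \<cdot>\<^sub>v (x2 t - x0 t)) @\<^sub>v (u1 t + s \<cdot>\<^sub>v (u2 t - u0 t)) =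
      (x1 t @\<^sub>v u1 t) + s \<cdot>\<^sub>v ((x2 t @\<^sub>v u2 t) - (x0 t @\<^sub>v u0 t))"
      by (rule eq_vecI) (use c in auto)
    thus ?thesis
      using lin[OF H_carrier[OF t] _ _ _ f_carrier[OF t]] assms stage_carrier[OF _ t] by simp
  qed
  have "stages_dobj (\<lambda>t. x1 t + s \<cdot>\<^sub>v (x2 t - x0 t)) (\<lambda>t. u1 t + s \<cdot>\<^sub>v (u2 t - u0 t)) dx du =
    stages_dobj x1 u1 dx du + s * (stages_dobj x2 u2 dx du - stages_dobj x0 u0 dx du)"
    unfolding stages_dobj_def sum_subtractf[symmetric] sum_distrib_left sum.distrib[symmetric]
    by (intro sum.cong refl st) simp
  moreover have "(H N *\<^sub>v (x1 N + s \<cdot>\<^sub>v (x2 N - x0 N)) + f N) \<bullet> dx N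
    = (H N *\<^sub>v x1 N + f N) \<bullet> dx N
      + s * ((H N *\<^sub>v x2 N + f N) \<bullet> dx N - (H N *\<^sub>v x0 N + f N) \<bullet> dx N)"
    using assms by (intro lin[OF HN_carrier _ _ _ fN_carrier]) (auto simp: traj_def)
  ultimately show ?thesis
    by (simp add: dobj_def algebra_simps)
qed

lemma feas_affine_combination:
  assumes "feas p0 x0 u0" "feas p1 x1 u1" "feas p2 x2 u2"
  shows "feas (p1 + s \<cdot>\<^sub>v (p2 - p0)) (\<lambda>t. x1 t + s \<cdot>\<^sub>v (x2 t - x0 t)) (\<lambda>t. u1 t + s \<cdot>\<^sub>v (u2 t - u0 t))"
proof -
  have "hom (\<lambda>t. x2 t - x0 t) (\<lambda>t. u2 t - u0 t)" using assms by (intro feas_diff)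
  from feas_line[OF assms(2) this, of s] show ?thesis using assms by (simp add: mpc_feas_def)
qed

text \<open>Feasibility and stationarity are affine jointly in trajectory, initial state, terminal
  state and linear cost. The weights \<open>1\<close>, \<open>s\<close>, \<open>- s\<close> sum to
  1, as the constant vectors \<open>a t\<close> and \<open>f t\<close> require.\<close>

lemma eopt_affine_combination:
  assumes 0: "eopt e g0 p0 q0 x0 u0" and 1: "eopt e g1 p1 q1 x1 u1" and 2: "eopt e g2 p2 q2 x2 u2"
    and g: "g0 \<in> carrier_vec nx" "g1 \<in> carrier_vec nx" "g2 \<in> carrier_vec nx"
  shows "eopt e (g1 + s \<cdot>\<^sub>v (g2 - g0)) (p1 + s \<cdot>\<^sub>v (p2 - p0)) (q1 + s \<cdot>\<^sub>v (q2 - q0))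
    (\<lambda>t. x1 t + s \<cdot>\<^sub>v (x2 t - x0 t)) (\<lambda>t. u1 t + s \<cdot>\<^sub>v (u2 t - u0 t))"
proof -
  have e: "efeas e p0 q0 x0 u0" "efeas e p1 q1 x1 u1" "efeas e p2 q2 x2 u2"
    using assms by (auto simp: eopt_def)
  hence fe: "feas p0 x0 u0" "feas p1 x1 u1" "feas p2 x2 u2" by (auto simp: efeas_def)
  have ef: "efeas e (p1 + s \<cdot>\<^sub>v (p2 - p0)) (q1 + s \<cdot>\<^sub>v (q2 - q0))
    (\<lambda>t. x1 t + s \<cdot>\<^sub>v (x2 t - x0 t)) (\<lambda>t. u1 t + s \<cdot>\<^sub>v (u2 t - u0 t))"
    using feas_affine_combination[OF fe] e by (simp add: efeas_def)
  have gc: "g1 + s \<cdot>\<^sub>v (g2 - g0) \<in> carrier_vec nx" using g by simp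
  have "dobj (\<lambda>t. x1 t + s \<cdot>\<^sub>v (x2 t - x0 t)) (\<lambda>t. u1 t + s \<cdot>\<^sub>v (u2 t - u0 t)) dx du
     + (g1 + s \<cdot>\<^sub>v (g2 - g0)) \<bullet> dx N = 0"
    if d: "hom dx du \<and> dx 0 = 0\<^sub>v nx \<and> (e \<longrightarrow> dx N = 0\<^sub>v nx)" for dx du
  proof -
    have "dobj x0 u0 dx du + g0 \<bullet> dx N = 0" "dobj x1 u1 dx du + g1 \<bullet> dx N = 0"
      "dobj x2 u2 dx du + g2 \<bullet> dx N = 0"
      using eopt_iff[OF e(1) g(1)] eopt_iff[OF e(2) g(2)] eopt_iff[OF e(3) g(3)] 0 1 2 d by auto
    hence z: "dobj x0 u0 dx du = - (g0 \<bullet> dx N)" "dobj x1 u1 dx du = - (g1 \<bullet> dx N)"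
      "dobj x2 u2 dx du = - (g2 \<bullet> dx N)" by linarith+
    have dN: "dx N \<in> carrier_vec nx" and t: "traj dx du" using d by (auto simp: hom_def traj_def)
    have "(g1 + s \<cdot>\<^sub>v (g2 - g0)) \<bullet> dx N = g1 \<bullet> dx N + s * (g2 \<bullet> dx N - g0 \<bullet> dx N)"
      using g dN by (simp add: add_scalar_prod_distrib[of _ nx] minus_scalar_prod_distrib[of _ nx])
    thus ?thesis
      unfolding dobj_affine_combination[OF feas_traj[OF fe(1)] feas_traj[OF fe(2)] feas_traj[OF fe(3)] t] z
      by (simp add: algebra_simps)
  qed
  thus ?thesis unfolding eopt_iff[OF ef gc] by blast
qed

text \<open>Combining the optima for \<open>v\<close>, \<open>w\<close> and 0 gives an optimum for
  \<open>v + s \<cdot>\<^sub>v w\<close>; uniqueness turns this into the identity of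
  \<open>affine_dep\<close>, and matrices follow time by time.\<close>

lemma eopt_affine_solution:
  assumes G: "affine_dep n nx G" and P: "affine_dep n nx P" and Q: "affine_dep n nx Q"
    and ex: "\<And>v. v \<in> carrier_vec n \<Longrightarrow> \<exists>x u. eopt e (G v) (P v) (Q v) x u"
  shows "\<exists>Kx kx Ku ku. (\<forall>t\<le>N. Kx t \<in> carrier_mat nx n \<and> kx t \<in> carrier_vec nx) \<and>
     (\<forall>t<N. Ku t \<in> carrier_mat (nu t) n \<and> ku t \<in> carrier_vec (nu t)) \<and>
     (\<forall>v \<in> carrier_vec n. \<forall>x u. eopt e (G v) (P v) (Q v) x u \<longleftrightarrow>
        (\<forall>t\<le>N. x t = Kx t *\<^sub>v v + kx t) \<and> (\<forall>t<N. u t = Ku t *\<^sub>v v + ku t))"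
proof -
  obtain X U where XU: "\<And>v. v \<in> carrier_vec n \<Longrightarrow> eopt e (G v) (P v) (Q v) (X v) (U v)"
    using ex by metis
  have Gc: "\<And>v. v \<in> carrier_vec n \<Longrightarrow> G v \<in> carrier_vec nx" using G by (rule affine_dep_value)
  have tr: "traj (X v) (U v)" if "v \<in> carrier_vec n" for v
    using XU[OF that] feas_traj by (auto simp: eopt_def efeas_def)
  have comb: "(t \<le> N \<longrightarrow> X (v + s \<cdot>\<^sub>v w) t = X v t + s \<cdot>\<^sub>v (X w t - X (0\<^sub>v n) t)) \<and>
     (t < N \<longrightarrow> U (v + s \<cdot>\<^sub>v w) t = U v t + s \<cdot>\<^sub>v (U w t - U (0\<^sub>v n) t))"
    if v: "v \<in> carrier_vec n" and w: "w \<in> carrier_vec n" for v w s t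
  proof -
    have vw: "v + s \<cdot>\<^sub>v w \<in> carrier_vec n" using v w by simp
    have "eopt e (G (v + s \<cdot>\<^sub>v w)) (P (v + s \<cdot>\<^sub>v w)) (Q (v + s \<cdot>\<^sub>v w))
      (\<lambda>t. X v t + s \<cdot>\<^sub>v (X w t - X (0\<^sub>v n) t)) (\<lambda>t. U v t + s \<cdot>\<^sub>v (U w t - U (0\<^sub>v n) t))"
      unfolding affine_dep_line[OF G v w] affine_dep_line[OF P v w] affine_dep_line[OF Q v w]
      using v w by (intro eopt_affine_combination XU Gc) auto
    from eopt_unique[OF this XU[OF vw] Gc[OF vw]] show ?thesis by blast
  qed
  \<comment> \<open>The bound on \<open>t\<close> stands inside the existential, so that choice
    functions total in \<open>t\<close> can be extracted.\<close>
  have "\<exists>K k. t \<le> N \<longrightarrow> K \<in> carrier_mat nx n \<and> k \<in> carrier_vec nx \<and> (\<forall>v \<in> carrier_vec n. X v t = K *\<^sub>v v + k)" for t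
    using affine_dep_matrix[of n nx "\<lambda>v. X v t"] comb[of _ _ t] tr unfolding affine_dep_def traj_def by metis
  then obtain Kx kx where Kx: "\<And>t. t \<le> N \<Longrightarrow> Kx t \<in> carrier_mat nx n \<and> kx t \<in> carrier_vec nx \<and>
      (\<forall>v \<in> carrier_vec n. X v t = Kx t *\<^sub>v v + kx t)" by metis
  have "\<exists>K k. t < N \<longrightarrow> K \<in> carrier_mat (nu t) n \<and> k \<in> carrier_vec (nu t) \<and> (\<forall>v \<in> carrier_vec n. U v t = K *\<^sub>v v + k)" for t
    using affine_dep_matrix[of n "nu t" "\<lambda>v. U v t"] comb[of _ _ t] tr unfolding affine_dep_def traj_def by metis
  then obtain Ku ku where Ku: "\<And>t. t < N \<Longrightarrow> Ku t \<in> carrier_mat (nu t) n \<and> ku t \<in> carrier_vec (nu t) \<and>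
      (\<forall>v \<in> carrier_vec n. U v t = Ku t *\<^sub>v v + ku t)" by metis
  have "eopt e (G v) (P v) (Q v) x u \<longleftrightarrow>
        (\<forall>t\<le>N. x t = Kx t *\<^sub>v v + kx t) \<and> (\<forall>t<N. u t = Ku t *\<^sub>v v + ku t)" (is "?l \<longleftrightarrow> ?r")
    if v: "v \<in> carrier_vec n" for v x u
  proof
    assume ?l
    from eopt_unique[OF XU[OF v] this Gc[OF v]] show ?r using Kx Ku v by simp
  next
    assume ?r
    hence "\<And>t. t \<le> N \<Longrightarrow> x t = X v t" "\<And>t. t < N \<Longrightarrow> u t = U v t" using Kx Ku v by auto
    from eopt_cong[OF this] XU[OF v] show ?l by simp
  qed
  hence "\<forall>v \<in> carrier_vec n. \<forall>x u. eopt e (G v) (P v) (Q v) x u \<longleftrightarrow>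
        (\<forall>t\<le>N. x t = Kx t *\<^sub>v v + kx t) \<and> (\<forall>t<N. u t = Ku t *\<^sub>v v + ku t)" by simp
  moreover have "\<forall>t\<le>N. Kx t \<in> carrier_mat nx n \<and> kx t \<in> carrier_vec nx" using Kx by simp
  moreover have "\<forall>t<N. Ku t \<in> carrier_mat (nu t) n \<and> ku t \<in> carrier_vec (nu t)" using Ku by simp
  ultimately show ?thesis by (intro exI conjI)
qed

lemma obj_affine_psd_quadratic:
  assumes Kx: "\<forall>t\<le>N. Kx t \<in> carrier_mat nx n \<and> kx t \<in> carrier_vec nx"
    and Ku: "\<forall>t<N. Ku t \<in> carrier_mat (nu t) n \<and> ku t \<in> carrier_vec (nu t)"
  shows "psd_quadratic n (\<lambda>v. obj (\<lambda>t. Kx t *\<^sub>v v + kx t) (\<lambda>t. Ku t *\<^sub>v v + ku t))"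
  unfolding mpc_obj_def stages_obj_def
proof (intro psd_quadratic_add psd_quadratic_sum)
  show "psd_quadratic n (\<lambda>v. quad (H N) (f N) (c N) (Kx N *\<^sub>v v + kx N))"
    using Kx by (intro psd_quadratic_affine[OF HN_carrier HN_sym HN_psd fN_carrier]) auto
  fix t assume t: "t < N"
  \<comment> \<open>Stacking the rows of the state and input maps turns the stage argument into one
    affine map of the parameter.\<close>
  have "(Kx t *\<^sub>v v + kx t) @\<^sub>v (Ku t *\<^sub>v v + ku t) = (Kx t @\<^sub>r Ku t) *\<^sub>v v + (kx t @\<^sub>v ku t)"
    if "v \<in> carrier_vec n" for v
  proof -
    have *: "Kx t \<in> carrier_mat nx n" "kx t \<in> carrier_vec nx" "Ku t \<in> carrier_mat (nu t) n" "ku t \<in> carrier_vec (nu t)"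
      using Kx Ku t by auto
    show ?thesis
      unfolding mat_mult_append[OF *(1,3) that]
      by (rule append_vec_add[symmetric, of _ nx _ _ "nu t"]) (use * that in auto)
  qed
  thus "psd_quadratic n (\<lambda>v. stage_cost (H t) (f t) (c t) (Kx t *\<^sub>v v + kx t) (Ku t *\<^sub>v v + ku t))"
    unfolding stage_cost_def
    using psd_quadratic_affine[OF H_carrier[OF t] H_sym[OF t] H_psd[OF t] f_carrier[OF t],
        of "Kx t @\<^sub>r Ku t" n "kx t @\<^sub>v ku t" "c t"] Kx Ku t
    by (subst psd_quadratic_cong[where W = "\<lambda>v. quad (H t) (f t) (c t) ((Kx t @\<^sub>r Ku t) *\<^sub>v v + (kx t @\<^sub>v ku t))"])
      (auto intro: carrier_append_rows)
qed

end

lemma vec_eq_of_diff_zero: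
  fixes v :: "real vec"
  assumes "v - w = 0\<^sub>v n" "v \<in> carrier_vec n" "w \<in> carrier_vec n"
  shows "v = w"
  using vec_eq_add_diff[OF assms(3,2)] assms by simp

lemma scalar_prod_self_zero:
  fixes v :: "real vec"
  assumes "v \<in> carrier_vec n" "v \<bullet> v = 0"
  shows "v = 0\<^sub>v n"
proof (rule eq_vecI)
  fix i assume "i < dim_vec (0\<^sub>v n :: real vec)"
  hence i: "i < n" by simp
  have "(\<Sum>i<n. v $ i * v $ i) = 0"
    using assms by (simp add: scalar_prod_def atLeast0LessThan)
  hence "v $ i * v $ i = 0"
    using sum_nonneg_eq_0_iff[of "{..<n}" "\<lambda>i. v $ i * v $ i"] i by auto
  thus "v $ i = 0\<^sub>v n $ i" using i by simp
qed (use assms in auto)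

section \<open>Existence with a free terminal state\<close>

lemma mpc_obj_Suc:
  "mpc_obj (Suc N) H f c x u = stage_cost (H 0) (f 0) (c 0) (x 0) (u 0) +
     mpc_obj N (shift 1 H) (shift 1 f) (shift 1 c) (shift 1 x) (shift 1 u)"
  by (simp add: mpc_obj_def stages_obj_def sum.lessThan_Suc_shift shift_def del: sum.lessThan_Suc)

text \<open>Removing the first stage leaves a problem of the same format, started at the successor
  state: the basis of dynamic programming.\<close>

lemma mpc_feas_Suc:
  "mpc_feas nx nu (Suc N) A B a x0 x u \<longleftrightarrow> x 0 = x0 \<and> x0 \<in> carrier_vec nx \<and> u 0 \<in> carrier_vec (nu 0) \<and>
     mpc_feas nx (shift 1 nu) N (shift 1 A) (shift 1 B) (shift 1 a) (A 0 *\<^sub>v x0 + B 0 *\<^sub>v u 0 + a 0)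
       (shift 1 x) (shift 1 u)"
  unfolding mpc_feas_def shift_def less_Suc_eq_le[symmetric] less_Suc_eq_0_disj
  by (auto simp: less_Suc_eq_0_disj)

lemma mpc_data_tail:
  "mpc_data nx nu (Suc N) H f A B a \<Longrightarrow>
    mpc_data nx (shift 1 nu) N (shift 1 H) (shift 1 f) (shift 1 A) (shift 1 B) (shift 1 a)"
  by (auto simp: mpc_data_def shift_def)

lemma (in mpc_data) eopt_free:
  "mpc_opt nx nu N H f c A B a x0 x u \<longleftrightarrow> eopt False (0\<^sub>v nx) x0 xT x u"
proof -
  have "0\<^sub>v nx \<bullet> x N = 0" if "feas x0 x u" for x u using that by (simp add: mpc_feas_def)
  thus ?thesis by (auto simp: mpc_opt_def eopt_def efeas_def)
qed

lemma affine_dep_const: "k \<in> carrier_vec m \<Longrightarrow> affine_dep n m (\<lambda>_. k)"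
  by (auto simp: affine_dep_def)

lemma affine_dep_mult_add:
  assumes K: "K \<in> carrier_mat m n" and k: "k \<in> carrier_vec m"
  shows "affine_dep n m (\<lambda>v. K *\<^sub>v v + k)"
proof -
  have "K *\<^sub>v (v + s \<cdot>\<^sub>v w) + k = (K *\<^sub>v v + k) + s \<cdot>\<^sub>v ((K *\<^sub>v w + k) - (K *\<^sub>v 0\<^sub>v n + k))"
    if v: "v \<in> carrier_vec n" and w: "w \<in> carrier_vec n" for v w s
  proof -
    have c: "K *\<^sub>v v \<in> carrier_vec m" "K *\<^sub>v w \<in> carrier_vec m" using K v w by auto
    have z: "K *\<^sub>v 0\<^sub>v n = 0\<^sub>v m" using K by auto
    have "(p + s \<cdot>\<^sub>v q) + k = (p + k) + s \<cdot>\<^sub>v ((q + k) - (0\<^sub>v m + k))"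
      if "p \<in> carrier_vec m" "q \<in> carrier_vec m" for p q :: "real vec"
      by (rule eq_vecI) (use that k in auto)
    from this[OF c] show ?thesis unfolding mult_mat_vec_line[OF K v w] z .
  qed
  thus ?thesis using K k by (auto simp: affine_dep_def)
qed

lemma affine_dep_id: "affine_dep n n (\<lambda>v. v)"
  using affine_dep_mult_add[of "1\<^sub>m n" n n "0\<^sub>v n"]
  by (auto simp: affine_dep_def)

text \<open>Induction on the horizon for arbitrary data. The tail has an optimum for each initial
  state; as that optimum is affine in the state, its cost is a convex quadratic
  \<open>quad P q r\<close> of the state. What remains is to minimise a definite quadratic in the
  first input.\<close>

lemma mpc_opt_exists:
  assumes "mpc_data nx nu N H f A B a" "xb \<in> carrier_vec nx"
  shows "\<exists>x u. mpc_opt nx nu N H f c A B a xb x u"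
  using assms
proof (induction N arbitrary: nu H f c A B a xb)
  case 0
  hence "mpc_opt nx nu 0 H f c A B a xb (\<lambda>_. xb) (\<lambda>_. xb)"
    by (simp add: mpc_opt_def mpc_feas_def mpc_obj_def stages_obj_def)
  thus ?case by blast
next
  case (Suc N)
  interpret D: mpc_data nx nu "Suc N" H f c A B a by (rule Suc.prems)
  note tail = mpc_data_tail[OF Suc.prems(1)]
  interpret S: mpc_data nx "shift 1 nu" N "shift 1 H" "shift 1 f" "shift 1 c" "shift 1 A" "shift 1 B" "shift 1 a"
    by (rule tail)
  let ?m = "nu 0"
  have c0: "A 0 \<in> carrier_mat nx nx" "B 0 \<in> carrier_mat nx ?m" "a 0 \<in> carrier_vec nx"
    "H 0 \<in> carrier_mat (nx + ?m) (nx + ?m)" "f 0 \<in> carrier_vec (nx + ?m)"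
    "sym_mat (H 0)" "psd_mat (nx + ?m) (H 0)" "pd_mat ?m (Hu_block nx ?m (H 0))"
    using D.A_carrier D.B_carrier D.a_carrier D.H_carrier D.f_carrier D.H_sym D.H_psd D.Hu_pd by auto
  have ex: "\<exists>x u. S.eopt False (0\<^sub>v nx) y (0\<^sub>v nx) x u" if "y \<in> carrier_vec nx" for y
    using Suc.IH[OF tail that] S.eopt_free by blast
  obtain Kx kx Ku ku where K: "\<forall>t\<le>N. Kx t \<in> carrier_mat nx nx \<and> kx t \<in> carrier_vec nx"
     "\<forall>t<N. Ku t \<in> carrier_mat (shift 1 nu t) nx \<and> ku t \<in> carrier_vec (shift 1 nu t)"
     "\<forall>y \<in> carrier_vec nx. \<forall>x u. S.eopt False (0\<^sub>v nx) y (0\<^sub>v nx) x u \<longleftrightarrow>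
        (\<forall>t\<le>N. x t = Kx t *\<^sub>v y + kx t) \<and> (\<forall>t<N. u t = Ku t *\<^sub>v y + ku t)"
    using S.eopt_affine_solution[OF affine_dep_const[OF zero_carrier_vec] affine_dep_id
        affine_dep_const[OF zero_carrier_vec] ex] by blast
  define X where "X y t = Kx t *\<^sub>v y + kx t" for y t
  define U where "U y t = Ku t *\<^sub>v y + ku t" for y t
  have opt: "S.eopt False (0\<^sub>v nx) y (0\<^sub>v nx) (X y) (U y)" if "y \<in> carrier_vec nx" for y
    using K(3) that by (simp add: X_def U_def)
  obtain P q r where P: "P \<in> carrier_mat nx nx" "q \<in> carrier_vec nx" "sym_mat P" "psd_mat nx P"
    "\<forall>y \<in> carrier_vec nx. S.obj (X y) (U y) = quad P q r y"
    using S.obj_affine_psd_quadratic[OF K(1,2)] unfolding psd_quadratic_def X_def U_def by blast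
  have le: "quad P q r y \<le> S.obj x u" if "S.feas y x u" for x u y
  proof -
    have y: "y \<in> carrier_vec nx" using that by (auto simp: mpc_feas_def)
    hence "mpc_opt nx (shift 1 nu) N (shift 1 H) (shift 1 f) (shift 1 c) (shift 1 A) (shift 1 B) (shift 1 a) y (X y) (U y)"
      using opt S.eopt_free by blast
    thus ?thesis using P(5) y that unfolding mpc_opt_def by auto
  qed
  \<comment> \<open>\<open>?E\<close> embeds an input as \<open>(0, u)\<close>, \<open>?e\<close> is
    the fixed state part, and \<open>?b\<close> the successor under zero input. Stage argument and
    successor become the affine maps \<open>?E *\<^sub>v u + ?e\<close> and
    \<open>B 0 *\<^sub>v u + ?b\<close>.\<close>
  let ?E = "0\<^sub>m nx ?m @\<^sub>r 1\<^sub>m ?m :: real mat"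
  let ?e = "xb @\<^sub>v 0\<^sub>v ?m :: real vec"
  let ?b = "A 0 *\<^sub>v xb + a 0"
  have Ec: "?E \<in> carrier_mat (nx + ?m) ?m" by (rule carrier_append_rows) auto
  have ec: "?e \<in> carrier_vec (nx + ?m)" using Suc.prems by auto
  have bc: "?b \<in> carrier_vec nx" using c0 Suc.prems by auto
  have Eu: "?E *\<^sub>v u = 0\<^sub>v nx @\<^sub>v u" if u: "u \<in> carrier_vec ?m" for u :: "real vec"
  proof -
    have "0\<^sub>m nx ?m *\<^sub>v u = 0\<^sub>v nx" by (rule eq_vecI) (use u in auto)
    thus ?thesis using mat_mult_append[of "0\<^sub>m nx ?m" nx ?m "1\<^sub>m ?m" ?m u] u by simp
  qed
  \<comment> \<open>\<open>?M1\<close> is the input block of \<open>H 0\<close>, so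
    \<open>?M1 + ?M2\<close> is the matrix \<open>H_u + B^T P B\<close> of the Riccati recursion; it
    is definite because its first summand is.\<close>
  let ?M1 = "transpose_mat ?E * H 0 * ?E" and ?M2 = "transpose_mat (B 0) * P * B 0"
  let ?g1 = "transpose_mat ?E *\<^sub>v (H 0 *\<^sub>v ?e + f 0)" and ?g2 = "transpose_mat (B 0) *\<^sub>v (P *\<^sub>v ?b + q)"
  let ?k = "quad (H 0) (f 0) (c 0) ?e + quad P q r ?b"
  have g: "?g1 \<in> carrier_vec ?m" "?g2 \<in> carrier_vec ?m"
    using Ec c0 P ec bc by (intro mult_mat_vec_carrier[of _ _ "nx + ?m"] mult_mat_vec_carrier[of _ _ nx]; auto)+
  note M1 = congruence_sym_psd[OF c0(4,6,7) Ec] and M2 = congruence_sym_psd[OF P(1,3,4) c0(2)]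
  have pd: "pd_mat ?m (?M1 + ?M2)" unfolding pd_mat_def
  proof (intro ballI impI)
    fix u :: "real vec" assume u: "u \<in> carrier_vec ?m" and "u \<noteq> 0\<^sub>v ?m"
    hence "0 < u \<bullet> (?M1 *\<^sub>v u)"
      using c0(8) by (simp add: congruence_scalar_prod[OF c0(4) Ec u] Eu[OF u] Hu_block_quad[OF c0(4) u] pd_mat_def)
    moreover have "0 \<le> u \<bullet> (?M2 *\<^sub>v u)" using M2(3) u by (simp add: psd_mat_def)
    moreover have "u \<bullet> ((?M1 + ?M2) *\<^sub>v u) = u \<bullet> (?M1 *\<^sub>v u) + u \<bullet> (?M2 *\<^sub>v u)"
      unfolding add_mult_distrib_mat_vec[OF M1(1) M2(1) u]
      by (rule scalar_prod_add_distrib[of _ ?m]) (use u M1 M2 in auto)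
    ultimately show "0 < u \<bullet> ((?M1 + ?M2) *\<^sub>v u)" by linarith
  qed
  have M12: "?M1 + ?M2 \<in> carrier_mat ?m ?m" "?g1 + ?g2 \<in> carrier_vec ?m" using M1 M2 g by auto
  obtain us where us: "us \<in> carrier_vec ?m"
    "\<And>u. u \<in> carrier_vec ?m \<Longrightarrow> quad (?M1 + ?M2) (?g1 + ?g2) ?k us \<le> quad (?M1 + ?M2) (?g1 + ?g2) ?k u"
    using pd_quad_minimizer[OF M12(1) sum_sym_psd(1)[OF M1 M2] pd M12(2)] by blast
  have W: "stage_cost (H 0) (f 0) (c 0) xb u + quad P q r (A 0 *\<^sub>v xb + B 0 *\<^sub>v u + a 0)
      = quad (?M1 + ?M2) (?g1 + ?g2) ?k u" if u: "u \<in> carrier_vec ?m" for u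
  proof -
    have "?E *\<^sub>v u + ?e = xb @\<^sub>v u"
      unfolding Eu[OF u] by (subst append_vec_add[of _ nx _ _ ?m]) (use u Suc.prems in auto)
    moreover have "A 0 *\<^sub>v xb + B 0 *\<^sub>v u + a 0 = B 0 *\<^sub>v u + ?b"
    proof -
      have "p + s + l = s + (p + l)" if "p \<in> carrier_vec nx" "s \<in> carrier_vec nx" "l \<in> carrier_vec nx"
        for p s l :: "real vec"
        by (rule eq_vecI) (use that in auto)
      from this[of "A 0 *\<^sub>v xb" "B 0 *\<^sub>v u" "a 0"] show ?thesis
        using c0 u Suc.prems(2) by (auto intro: mult_mat_vec_carrier)
    qed
    ultimately show ?thesis
      using quad_affine[OF c0(4,6,5) Ec ec u] quad_affine[OF P(1,3,2) c0(2) bc u]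
        quad_add[OF M1(1) g(1) M2(1) g(2) u]
      by (simp add: stage_cost_def)
  qed
  define ys where "ys = A 0 *\<^sub>v xb + B 0 *\<^sub>v us + a 0"
  have ys: "ys \<in> carrier_vec nx" using c0 us Suc.prems by (auto simp: ys_def)
  define x where "x t = (case t of 0 \<Rightarrow> xb | Suc t \<Rightarrow> X ys t)" for t
  define u where "u t = (case t of 0 \<Rightarrow> us | Suc t \<Rightarrow> U ys t)" for t
  have sh: "shift 1 x = X ys" "shift 1 u = U ys" and z: "x 0 = xb" "u 0 = us"
    by (auto simp: shift_def x_def u_def)
  have "mpc_opt nx nu (Suc N) H f c A B a xb x u" unfolding mpc_opt_def
  proof (intro conjI allI impI)
    show "mpc_feas nx nu (Suc N) A B a xb x u"
      unfolding mpc_feas_Suc sh z ys_def[symmetric]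
      using us(1) Suc.prems(2) opt[OF ys] unfolding S.eopt_def S.efeas_def by blast
    fix x' u' assume "mpc_feas nx nu (Suc N) A B a xb x' u'"
    hence f': "x' 0 = xb" "u' 0 \<in> carrier_vec ?m"
      "S.feas (A 0 *\<^sub>v xb + B 0 *\<^sub>v u' 0 + a 0) (shift 1 x') (shift 1 u')"
      unfolding mpc_feas_Suc by auto
    have "mpc_obj (Suc N) H f c x u = quad (?M1 + ?M2) (?g1 + ?g2) ?k us"
      unfolding mpc_obj_Suc sh z using W[OF us(1)] P(5) ys by (simp add: ys_def)
    also have "\<dots> \<le> quad (?M1 + ?M2) (?g1 + ?g2) ?k (u' 0)" by (rule us(2)[OF f'(2)])
    also have "\<dots> \<le> mpc_obj (Suc N) H f c x' u'"
      unfolding mpc_obj_Suc f'(1) W[OF f'(2), symmetric] using le[OF f'(3)] by simp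
    finally show "mpc_obj (Suc N) H f c x u \<le> mpc_obj (Suc N) H f c x' u'" .
  qed
  thus ?case by blast
qed

section \<open>Existence with a prescribed terminal state\<close>

text \<open>The sum format of \<open>Da\<close> and \<open>ctrb_range\<close>, so that both unfold
  to it directly. The start value gives the empty sum a dimension.\<close>

abbreviation vsum :: "nat \<Rightarrow> nat \<Rightarrow> (nat \<Rightarrow> real vec) \<Rightarrow> real vec" where
  "vsum n k g \<equiv> foldr (+) (map g [0..<k]) (0\<^sub>v n)"

lemma vsum_carrier: "(\<And>j. j < k \<Longrightarrow> g j \<in> carrier_vec n) \<Longrightarrow> vsum n k g \<in> carrier_vec n"
proof -
  have "foldr (+) (map g js) (0\<^sub>v n) \<in> carrier_vec n" if "\<forall>j \<in> set js. g j \<in> carrier_vec n" for js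
    using that by (induction js) auto
  thus "(\<And>j. j < k \<Longrightarrow> g j \<in> carrier_vec n) \<Longrightarrow> vsum n k g \<in> carrier_vec n" by simp
qed

lemma vsum_Suc:
  assumes "\<And>j. j \<le> k \<Longrightarrow> g j \<in> carrier_vec n"
  shows "vsum n (Suc k) g = vsum n k g + g k"
proof -
  \<comment> \<open>The last summand ends up in the start value of \<open>foldr\<close>, hence the
    general \<open>v\<close>; the carrier claim is carried along because reassociating sums needs
    it.\<close>
  have "foldr (+) (map g js) v = foldr (+) (map g js) (0\<^sub>v n) + v \<and> foldr (+) (map g js) (0\<^sub>v n) \<in> carrier_vec n"
    if "\<forall>j \<in> set js. g j \<in> carrier_vec n" "v \<in> carrier_vec n" for js v
    using that by (induction js) auto
  from this[of "[0..<k]" "g k"] show ?thesis using assms by simp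
qed

lemma vsum_cong: "(\<And>j. j < k \<Longrightarrow> g j = h j) \<Longrightarrow> vsum n k g = vsum n k h"
proof -
  assume "\<And>j. j < k \<Longrightarrow> g j = h j"
  hence "map g [0..<k] = map h [0..<k]" by simp
  thus "vsum n k g = vsum n k h" by (rule arg_cong)
qed

lemma mult_mat_vec_vsum:
  fixes M :: "real mat"
  assumes M: "M \<in> carrier_mat n n" and g: "\<And>j. j < k \<Longrightarrow> g j \<in> carrier_vec n"
  shows "M *\<^sub>v vsum n k g = vsum n k (\<lambda>j. M *\<^sub>v g j)"
  using g
proof (induction k)
  case (Suc k)
  have "vsum n k g \<in> carrier_vec n" using Suc.prems by (intro vsum_carrier) simp
  thus ?case using Suc M
    by (simp add: vsum_Suc mult_add_distrib_mat_vec[OF M] del: upt_Suc)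
qed (use M in auto)

section \<open>Variation of constants\<close>

lemma prodA_carrier:
  "(\<And>t. t < k \<Longrightarrow> A t \<in> carrier_mat n n) \<Longrightarrow> prodA n A j k \<in> carrier_mat n n"
  by (induction k) (auto intro: mult_carrier_mat)

text \<open>The variation of constants formula, with the contributions of initial state, inputs and
  offsets kept apart.\<close>

lemma mpc_feas_state:
  assumes A: "\<And>t. t < N \<Longrightarrow> A t \<in> carrier_mat nx nx" and B: "\<And>t. t < N \<Longrightarrow> B t \<in> carrier_mat nx (nu t)"
    and a: "\<And>t. t < N \<Longrightarrow> a t \<in> carrier_vec nx"
    and x: "mpc_feas nx nu N A B a x0 x u" and k: "k \<le> N"
  shows "x k = prodA nx A 0 k *\<^sub>v x0 + vsum nx k (\<lambda>j. prodA nx A (Suc j) k *\<^sub>v (B j *\<^sub>v u j))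
    + vsum nx k (\<lambda>j. prodA nx A (Suc j) k *\<^sub>v a j)"
  using k
proof (induction k)
  case 0
  thus ?case using x by (auto simp: mpc_feas_def)
next
  case (Suc k)
  have kN: "k < N" using Suc by simp
  have x0: "x0 \<in> carrier_vec nx" and u: "\<And>j. j < N \<Longrightarrow> u j \<in> carrier_vec (nu j)"
    using x by (auto simp: mpc_feas_def)
  have Bu: "B j *\<^sub>v u j \<in> carrier_vec nx" if "j < N" for j using B[OF that] u[OF that] by auto
  have P: "prodA nx A j k \<in> carrier_mat nx nx" for j using A kN by (intro prodA_carrier) simp
  have P': "prodA nx A j (Suc k) \<in> carrier_mat nx nx" for j
    by (rule prodA_carrier) (use A kN in simp)
  \<comment> \<open>One recursion for inputs and offsets alike: \<open>A k\<close> extends every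
    transition product by one factor, and the new summand \<open>j = k\<close> carries the empty
    product, which is the identity.\<close>
  have step: "A k *\<^sub>v vsum nx k (\<lambda>j. prodA nx A (Suc j) k *\<^sub>v g j) + g k =
     vsum nx (Suc k) (\<lambda>j. prodA nx A (Suc j) (Suc k) *\<^sub>v g j)"
    if g: "\<And>j. j < N \<Longrightarrow> g j \<in> carrier_vec nx" for g
  proof -
    have gc: "g j \<in> carrier_vec nx" if "j \<le> k" for j using g that kN by simp
    have "A k *\<^sub>v vsum nx k (\<lambda>j. prodA nx A (Suc j) k *\<^sub>v g j) =
      vsum nx k (\<lambda>j. A k *\<^sub>v (prodA nx A (Suc j) k *\<^sub>v g j))"
      by (intro mult_mat_vec_vsum[OF A[OF kN]] mult_mat_vec_carrier[OF P] gc) simp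
    also have "\<dots> = vsum nx k (\<lambda>j. prodA nx A (Suc j) (Suc k) *\<^sub>v g j)"
    proof (rule vsum_cong)
      fix j assume "j < k"
      thus "A k *\<^sub>v (prodA nx A (Suc j) k *\<^sub>v g j) = prodA nx A (Suc j) (Suc k) *\<^sub>v g j"
        using assoc_mult_mat_vec[OF A[OF kN] P gc, of j "Suc j"] by simp
    qed
    finally have 1: "A k *\<^sub>v vsum nx k (\<lambda>j. prodA nx A (Suc j) k *\<^sub>v g j) =
      vsum nx k (\<lambda>j. prodA nx A (Suc j) (Suc k) *\<^sub>v g j)" .
    have 2: "prodA nx A (Suc k) (Suc k) *\<^sub>v g k = g k" using gc by simp
    have 3: "vsum nx (Suc k) (\<lambda>j. prodA nx A (Suc j) (Suc k) *\<^sub>v g j) =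
      vsum nx k (\<lambda>j. prodA nx A (Suc j) (Suc k) *\<^sub>v g j) + prodA nx A (Suc k) (Suc k) *\<^sub>v g k"
      by (intro vsum_Suc mult_mat_vec_carrier[OF P'] gc)
    show ?thesis unfolding 1 3 2 ..
  qed
  let ?S = "vsum nx k (\<lambda>j. prodA nx A (Suc j) k *\<^sub>v (B j *\<^sub>v u j))"
  let ?D = "vsum nx k (\<lambda>j. prodA nx A (Suc j) k *\<^sub>v a j)"
  have S: "?S \<in> carrier_vec nx" using kN by (intro vsum_carrier mult_mat_vec_carrier[OF P] Bu) simp
  have D: "?D \<in> carrier_vec nx" using kN by (intro vsum_carrier mult_mat_vec_carrier[OF P] a) simp
  have Px: "prodA nx A 0 k *\<^sub>v x0 \<in> carrier_vec nx" using P x0 by (rule mult_mat_vec_carrier)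
  have "x (Suc k) = A k *\<^sub>v x k + B k *\<^sub>v u k + a k" using x kN by (simp add: mpc_feas_def)
  also have "x k = prodA nx A 0 k *\<^sub>v x0 + ?S + ?D" using Suc by simp
  also have "A k *\<^sub>v (prodA nx A 0 k *\<^sub>v x0 + ?S + ?D) = A k *\<^sub>v (prodA nx A 0 k *\<^sub>v x0) + A k *\<^sub>v ?S + A k *\<^sub>v ?D"
    unfolding mult_add_distrib_mat_vec[OF A[OF kN] add_carrier_vec[OF Px S] D]
      mult_add_distrib_mat_vec[OF A[OF kN] Px S] ..
  also have "A k *\<^sub>v (prodA nx A 0 k *\<^sub>v x0) = prodA nx A 0 (Suc k) *\<^sub>v x0"
    using assoc_mult_mat_vec[OF A[OF kN] P x0, of 0] by simp
  also have "prodA nx A 0 (Suc k) *\<^sub>v x0 + A k *\<^sub>v ?S + A k *\<^sub>v ?D + B k *\<^sub>v u k + a k =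
    prodA nx A 0 (Suc k) *\<^sub>v x0 + (A k *\<^sub>v ?S + B k *\<^sub>v u k) + (A k *\<^sub>v ?D + a k)"
  proof -
    have "p + q + r + s + l = p + (q + s) + (r + l)"
      if "p \<in> carrier_vec nx" "q \<in> carrier_vec nx" "r \<in> carrier_vec nx" "s \<in> carrier_vec nx" "l \<in> carrier_vec nx"
      for p q r s l :: "real vec"
      by (rule eq_vecI) (use that in auto)
    from this[OF mult_mat_vec_carrier[OF P' x0] mult_mat_vec_carrier[OF A[OF kN] S]
        mult_mat_vec_carrier[OF A[OF kN] D] Bu[OF kN] a[OF kN]] show ?thesis .
  qed
  also have "A k *\<^sub>v ?S + B k *\<^sub>v u k = vsum nx (Suc k) (\<lambda>j. prodA nx A (Suc j) (Suc k) *\<^sub>v (B j *\<^sub>v u j))"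
    by (rule step[OF Bu])
  also have "A k *\<^sub>v ?D + a k = vsum nx (Suc k) (\<lambda>j. prodA nx A (Suc j) (Suc k) *\<^sub>v a j)"
    by (rule step[OF a])
  finally show ?case .
qed

fun rollout :: "(nat \<Rightarrow> real mat) \<Rightarrow> (nat \<Rightarrow> real mat) \<Rightarrow> (nat \<Rightarrow> real vec) \<Rightarrow> real vec \<Rightarrow> (nat \<Rightarrow> real vec) \<Rightarrow> nat \<Rightarrow> real vec" where
  "rollout A B a x0 u 0 = x0"
| "rollout A B a x0 u (Suc t) = A t *\<^sub>v rollout A B a x0 u t + B t *\<^sub>v u t + a t"

lemma rollout_feas:
  assumes "\<And>t. t < N \<Longrightarrow> A t \<in> carrier_mat nx nx" "\<And>t. t < N \<Longrightarrow> B t \<in> carrier_mat nx (nu t)"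
    "\<And>t. t < N \<Longrightarrow> a t \<in> carrier_vec nx" "x0 \<in> carrier_vec nx" "\<And>t. t < N \<Longrightarrow> u t \<in> carrier_vec (nu t)"
  shows "mpc_feas nx nu N A B a x0 (rollout A B a x0 u) u"
proof -
  have "rollout A B a x0 u t \<in> carrier_vec nx" if "t \<le> N" for t
    using that
    by (induction t) (auto simp: Suc_le_eq intro!: add_carrier_vec mult_mat_vec_carrier[OF assms(1)]
        mult_mat_vec_carrier[OF assms(2)] assms(3-5))
  thus ?thesis using assms by (simp add: mpc_feas_def)
qed

context mpc_data
begin

section \<open>Reachable terminal states\<close>

lemma Acal_carrier: "Acal nx A N \<in> carrier_mat nx nx"
  unfolding Acal_def using A_carrier by (rule prodA_carrier)

lemma Dmat_carrier: "Dmat nx A N j \<in> carrier_mat nx nx"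
  unfolding Dmat_def using A_carrier by (rule prodA_carrier)

lemma Da_carrier: "Da nx A a N \<in> carrier_vec nx"
  unfolding Da_def by (intro vsum_carrier mult_mat_vec_carrier[OF Dmat_carrier] a_carrier)

lemma feas_terminal:
  assumes "feas x0 x u"
  shows "x N = Acal nx A N *\<^sub>v x0 + vsum nx N (\<lambda>j. Dmat nx A N j *\<^sub>v (B j *\<^sub>v u j)) + Da nx A a N"
  using mpc_feas_state[OF A_carrier B_carrier a_carrier assms order_refl]
  by (simp add: Acal_def Dmat_def Da_def)

lemma hom_terminal:
  assumes "hom dx du"
  shows "dx N = Acal nx A N *\<^sub>v dx 0 + vsum nx N (\<lambda>j. Dmat nx A N j *\<^sub>v (B j *\<^sub>v du j))"
proof -
  have "mpc_feas nx nu N A B (\<lambda>_. 0\<^sub>v nx) (dx 0) dx du"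
    unfolding mpc_feas_def
  proof (intro conjI allI impI)
    fix t assume t: "t < N"
    have "A t *\<^sub>v dx t + B t *\<^sub>v du t \<in> carrier_vec nx"
      using assms t unfolding hom_def traj_def by (metis Suc_leI)
    thus "dx (Suc t) = A t *\<^sub>v dx t + B t *\<^sub>v du t + 0\<^sub>v nx" using assms t by (simp add: hom_def)
  qed (use assms in \<open>auto simp: hom_def traj_def\<close>)
  from mpc_feas_state[OF A_carrier B_carrier zero_carrier_vec this order_refl]
  have "dx N = Acal nx A N *\<^sub>v dx 0 + vsum nx N (\<lambda>j. Dmat nx A N j *\<^sub>v (B j *\<^sub>v du j))
     + vsum nx N (\<lambda>j. Dmat nx A N j *\<^sub>v 0\<^sub>v nx)"
    by (simp add: Acal_def Dmat_def)
  moreover have "vsum nx k (\<lambda>j. Dmat nx A N j *\<^sub>v 0\<^sub>v nx) = 0\<^sub>v nx" for k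
  proof (induction k)
    case (Suc k)
    have "Dmat nx A N j *\<^sub>v 0\<^sub>v nx = 0\<^sub>v nx" for j using Dmat_carrier[of j] by auto
    thus ?case using Suc by simp
  qed simp
  moreover have "Acal nx A N *\<^sub>v dx 0 \<in> carrier_vec nx"
    using assms by (intro mult_mat_vec_carrier[OF Acal_carrier]) (simp add: hom_def traj_def)
  moreover have "vsum nx N (\<lambda>j. Dmat nx A N j *\<^sub>v (B j *\<^sub>v du j)) \<in> carrier_vec nx"
    using assms by (intro vsum_carrier mult_mat_vec_carrier[OF Dmat_carrier] mult_mat_vec_carrier[OF B_carrier])
      (auto simp: hom_def traj_def)
  ultimately show ?thesis by simp
qed

lemma hom_exists:
  assumes x: "x0 \<in> carrier_vec nx" and u: "\<And>t. t < N \<Longrightarrow> du t \<in> carrier_vec (nu t)"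
  shows "\<exists>dx. hom dx du \<and> dx 0 = x0"
proof -
  have f: "mpc_feas nx nu N A B (\<lambda>_. 0\<^sub>v nx) x0 (rollout A B (\<lambda>_. 0\<^sub>v nx) x0 du) du"
    by (rule rollout_feas) (use A_carrier B_carrier x u in auto)
  have "A t *\<^sub>v rollout A B (\<lambda>_. 0\<^sub>v nx) x0 du t + B t *\<^sub>v du t \<in> carrier_vec nx" if t: "t < N" for t
    using f t u
    by (intro add_carrier_vec mult_mat_vec_carrier[OF A_carrier] mult_mat_vec_carrier[OF B_carrier])
      (auto simp: mpc_feas_def)
  thus ?thesis using f
    by (intro exI[of _ "rollout A B (\<lambda>_. 0\<^sub>v nx) x0 du"]) (auto simp: hom_def traj_def mpc_feas_def)
qed

text \<open>Identifies the range of the controllability matrix with the end states of homogeneous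
  trajectories from 0, which are the test directions of the first-order condition with free terminal
  state.\<close>

lemma ctrb_range_iff:
  "r \<in> ctrb_range nx nu A B N \<longleftrightarrow> (\<exists>dx du. hom dx du \<and> dx 0 = 0\<^sub>v nx \<and> dx N = r)"
proof -
  have tm: "dx N = vsum nx N (\<lambda>j. Dmat nx A N j *\<^sub>v (B j *\<^sub>v du j))" if "hom dx du" "dx 0 = 0\<^sub>v nx" for dx du
  proof -
    have "Acal nx A N *\<^sub>v 0\<^sub>v nx = 0\<^sub>v nx" using Acal_carrier by auto
    moreover have "vsum nx N (\<lambda>j. Dmat nx A N j *\<^sub>v (B j *\<^sub>v du j)) \<in> carrier_vec nx"
      using that by (intro vsum_carrier mult_mat_vec_carrier[OF Dmat_carrier] mult_mat_vec_carrier[OF B_carrier])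
        (auto simp: hom_def traj_def)
    ultimately show ?thesis using hom_terminal[OF that(1)] that(2) by simp
  qed
  show ?thesis
  proof
    assume "r \<in> ctrb_range nx nu A B N"
    then obtain w where w: "\<And>j. j < N \<Longrightarrow> w j \<in> carrier_vec (nu j)"
      "r = vsum nx N (\<lambda>j. Dmat nx A N j *\<^sub>v (B j *\<^sub>v w j))"
      unfolding ctrb_range_def by blast
    obtain dx where "hom dx w" "dx 0 = 0\<^sub>v nx" using hom_exists[OF zero_carrier_vec w(1)] by blast
    thus "\<exists>dx du. hom dx du \<and> dx 0 = 0\<^sub>v nx \<and> dx N = r" using tm w(2) by blast
  next
    assume "\<exists>dx du. hom dx du \<and> dx 0 = 0\<^sub>v nx \<and> dx N = r"
    then obtain dx du where d: "hom dx du" "dx 0 = 0\<^sub>v nx" "dx N = r" by blast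
    have "\<forall>j<N. du j \<in> carrier_vec (nu j)" using d(1) by (simp add: hom_def traj_def)
    thus "r \<in> ctrb_range nx nu A B N" unfolding ctrb_range_def using tm[OF d(1,2)] d(3) by blast
  qed
qed

lemma feas_terminal_ctrb:
  assumes "feas x0 x u" "feas x0 y v"
  shows "y N - x N \<in> ctrb_range nx nu A B N"
  unfolding ctrb_range_iff
  using feas_diff[OF assms] assms
  by (intro exI[of _ "\<lambda>t. y t - x t"] exI[of _ "\<lambda>t. v t - u t"]) (auto simp: mpc_feas_def)

lemma feas_reach:
  assumes x0: "x0 \<in> carrier_vec nx" and r: "r \<in> ctrb_range nx nu A B N"
  shows "\<exists>x u. feas x0 x u \<and> x N = Acal nx A N *\<^sub>v x0 + r + Da nx A a N"
proof -
  obtain w where w: "\<And>j. j < N \<Longrightarrow> w j \<in> carrier_vec (nu j)"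
    "r = vsum nx N (\<lambda>j. Dmat nx A N j *\<^sub>v (B j *\<^sub>v w j))"
    using r unfolding ctrb_range_def by blast
  have "feas x0 (rollout A B a x0 w) w"
    by (rule rollout_feas) (use A_carrier B_carrier a_carrier x0 w in auto)
  thus ?thesis using feas_terminal w(2) by blast
qed

text \<open>A linear terminal cost is absorbed into \<open>f N\<close>, so existence for free
  terminal states covers it.\<close>

lemma linear_terminal_cost:
  assumes g: "g \<in> carrier_vec nx"
  shows "mpc_data nx nu N H (f(N := f N + g)) A B a"
    "x N \<in> carrier_vec nx \<Longrightarrow> mpc_obj N H (f(N := f N + g)) c x u = obj x u + g \<bullet> x N"
proof -
  show "mpc_data nx nu N H (f(N := f N + g)) A B a"
    using A_carrier B_carrier a_carrier H_carrier f_carrier H_sym H_psd Hu_pd HN_carrier fN_carrier HN_sym HN_psd g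
    by unfold_locales auto
  show "x N \<in> carrier_vec nx \<Longrightarrow> mpc_obj N H (f(N := f N + g)) c x u = obj x u + g \<bullet> x N"
    using fN_carrier g
    by (simp add: mpc_obj_def stages_obj_def quad_def add_scalar_prod_distrib[of _ nx])
qed

lemma eopt_free_exists:
  assumes g: "g \<in> carrier_vec nx" and x0: "x0 \<in> carrier_vec nx"
  shows "\<exists>x u. eopt False g x0 xT x u"
proof -
  obtain x u where o: "mpc_opt nx nu N H (f(N := f N + g)) c A B a x0 x u"
    using mpc_opt_exists[OF linear_terminal_cost(1)[OF g] x0] by blast
  have "x' N \<in> carrier_vec nx" if "feas x0 x' u'" for x' u' using that by (simp add: mpc_feas_def)
  moreover have "x N \<in> carrier_vec nx" using o by (simp add: mpc_opt_def mpc_feas_def)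
  ultimately have "eopt False g x0 xT x u"
    using o unfolding mpc_opt_def eopt_def efeas_def by (simp add: linear_terminal_cost(2)[OF g])
  thus ?thesis by blast
qed

(* The optimal terminal state of the problem with extra terminal cost (T mu)' x_N moves by T (Phi mu)
   from its value at mu = 0; Phi is square and injective, so every reachable terminal state is attained. *)
lemma eopt_terminal_exists:
  assumes T: "col_basis nx T (ctrb_range nx nu A B N)" and x': "feas x0 x' u'"
  shows "\<exists>x u. eopt True (0\<^sub>v nx) x0 (x' N) x u"
proof -
  define m where "m = dim_col T"
  have Tc: "T \<in> carrier_mat nx m" and Tinj: "\<And>v. v \<in> carrier_vec m \<Longrightarrow> T *\<^sub>v v = 0\<^sub>v nx \<Longrightarrow> v = 0\<^sub>v m"
    and Tr: "\<And>r. r \<in> ctrb_range nx nu A B N \<Longrightarrow> \<exists>v \<in> carrier_vec m. T *\<^sub>v v = r"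
    and Tr': "\<And>v. v \<in> carrier_vec m \<Longrightarrow> T *\<^sub>v v \<in> ctrb_range nx nu A B N"
  proof -
    have R: "{T *\<^sub>v v | v. v \<in> carrier_vec m} = ctrb_range nx nu A B N"
      using T by (simp add: col_basis_def m_def)
    show "\<And>r. r \<in> ctrb_range nx nu A B N \<Longrightarrow> \<exists>v \<in> carrier_vec m. T *\<^sub>v v = r"
      "\<And>v. v \<in> carrier_vec m \<Longrightarrow> T *\<^sub>v v \<in> ctrb_range nx nu A B N"
      unfolding R[symmetric] by blast+
  qed (use T in \<open>auto simp: col_basis_def m_def\<close>)
  have Tv: "T *\<^sub>v v \<in> carrier_vec nx" if "v \<in> carrier_vec m" for v using Tc that by auto
  have x0: "x0 \<in> carrier_vec nx" using x' by (auto simp: mpc_feas_def)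
  have "affine_dep m nx (\<lambda>v. T *\<^sub>v v + 0\<^sub>v nx)" using Tc by (intro affine_dep_mult_add) auto
  hence Taff: "affine_dep m nx ((*\<^sub>v) T)" using Tv by (auto simp: affine_dep_def)
  obtain Kx kx Ku ku where K: "\<forall>t\<le>N. Kx t \<in> carrier_mat nx m \<and> kx t \<in> carrier_vec nx"
     "\<forall>t<N. Ku t \<in> carrier_mat (nu t) m \<and> ku t \<in> carrier_vec (nu t)"
     "\<forall>v \<in> carrier_vec m. \<forall>x u. eopt False (T *\<^sub>v v) x0 x0 x u \<longleftrightarrow>
        (\<forall>t\<le>N. x t = Kx t *\<^sub>v v + kx t) \<and> (\<forall>t<N. u t = Ku t *\<^sub>v v + ku t)"
    using eopt_affine_solution[OF Taff affine_dep_const[OF x0] affine_dep_const[OF x0] eopt_free_exists[OF Tv x0]]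
    by blast
  define X where "X v t = Kx t *\<^sub>v v + kx t" for v t
  define U where "U v t = Ku t *\<^sub>v v + ku t" for v t
  have opt: "eopt False (T *\<^sub>v v) x0 x0 (X v) (U v)" if "v \<in> carrier_vec m" for v
    using K(3) that by (simp add: X_def U_def)
  have fe: "feas x0 (X v) (U v)" if "v \<in> carrier_vec m" for v
    using opt[OF that] by (simp add: eopt_def efeas_def)
  have XN: "X v N \<in> carrier_vec nx" if "v \<in> carrier_vec m" for v
    using fe[OF that] by (simp add: mpc_feas_def)
  have T0: "T *\<^sub>v 0\<^sub>v m = 0\<^sub>v nx" using Tc by auto
  have "\<exists>w \<in> carrier_vec m. T *\<^sub>v w = X v N - X (0\<^sub>v m) N" if "v \<in> carrier_vec m" for v
    using Tr feas_terminal_ctrb[OF fe fe[OF that], of "0\<^sub>v m"] by simp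
  \<comment> \<open>\<open>\<phi> v\<close> holds the coordinates, in the basis \<open>T\<close>, of
    the shift of the optimal terminal state caused by the cost \<open>T *\<^sub>v v\<close>.
    Coordinates are unique, so \<open>\<phi>\<close> inherits affinity from the solution
    map.\<close>
  then obtain \<phi> where \<phi>: "\<And>v. v \<in> carrier_vec m \<Longrightarrow> \<phi> v \<in> carrier_vec m"
    "\<And>v. v \<in> carrier_vec m \<Longrightarrow> T *\<^sub>v \<phi> v = X v N - X (0\<^sub>v m) N" by metis
  have Tuniq: "v = w" if "T *\<^sub>v v = T *\<^sub>v w" "v \<in> carrier_vec m" "w \<in> carrier_vec m" for v w
  proof -
    have "T *\<^sub>v (v - w) = 0\<^sub>v nx"
      using that Tv[OF that(3)] by (simp add: mult_minus_distrib_mat_vec[OF Tc])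
    hence "v - w = 0\<^sub>v m" using that(2,3) by (intro Tinj) simp_all
    thus ?thesis using that(2,3) by (rule vec_eq_of_diff_zero)
  qed
  have "T *\<^sub>v \<phi> (0\<^sub>v m) = 0\<^sub>v nx" using \<phi>(2)[of "0\<^sub>v m"] XN[of "0\<^sub>v m"] by simp
  hence \<phi>0: "\<phi> (0\<^sub>v m) = 0\<^sub>v m" by (intro Tinj \<phi>(1)) simp_all
  have "affine_dep m m \<phi>"
    unfolding affine_dep_def
  proof (intro conjI ballI allI)
    fix v w :: "real vec" and s assume v: "v \<in> carrier_vec m" and w: "w \<in> carrier_vec m"
    have vw: "v + s \<cdot>\<^sub>v w \<in> carrier_vec m" using v w by simp
    have "affine_dep m nx (\<lambda>v. X v N)" unfolding X_def using K(1) by (intro affine_dep_mult_add) auto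
    hence X: "X (v + s \<cdot>\<^sub>v w) N = X v N + s \<cdot>\<^sub>v (X w N - X (0\<^sub>v m) N)" using v w by (rule affine_dep_line)
    have swap: "(p + s \<cdot>\<^sub>v (q - r)) - r = (p - r) + s \<cdot>\<^sub>v (q - r)"
      if "p \<in> carrier_vec nx" "q \<in> carrier_vec nx" "r \<in> carrier_vec nx" for p q r :: "real vec"
      by (rule eq_vecI) (use that in auto)
    have "T *\<^sub>v \<phi> (v + s \<cdot>\<^sub>v w) = T *\<^sub>v (\<phi> v + s \<cdot>\<^sub>v \<phi> w)"
      unfolding \<phi>(2)[OF vw] X mult_mat_vec_line[OF Tc \<phi>(1)[OF v] \<phi>(1)[OF w]] \<phi>(2)[OF v] \<phi>(2)[OF w]
      by (rule swap[OF XN[OF v] XN[OF w] XN[OF zero_carrier_vec]])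
    moreover have "\<phi> w - \<phi> (0\<^sub>v m) = \<phi> w" unfolding \<phi>0 using \<phi>(1)[OF w] by simp
    ultimately show "\<phi> (v + s \<cdot>\<^sub>v w) = \<phi> v + s \<cdot>\<^sub>v (\<phi> w - \<phi> (0\<^sub>v m))"
      using \<phi>(1)[OF v] \<phi>(1)[OF w] \<phi>(1)[OF vw] by - (rule Tuniq, simp_all)
  qed (rule \<phi>(1))
  then obtain \<Phi> k where \<Phi>: "\<Phi> \<in> carrier_mat m m" "k \<in> carrier_vec m" "\<And>v. v \<in> carrier_vec m \<Longrightarrow> \<phi> v = \<Phi> *\<^sub>v v + k"
    using affine_dep_matrix by blast
  have "\<Phi> *\<^sub>v 0\<^sub>v m = 0\<^sub>v m" using \<Phi>(1) by auto
  hence "k = 0\<^sub>v m" using \<Phi>(3)[of "0\<^sub>v m"] \<Phi>(2) \<phi>0 by simp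
  hence \<phi>\<Phi>: "\<phi> v = \<Phi> *\<^sub>v v" if "v \<in> carrier_vec m" for v
    using \<Phi>(3)[OF that] mult_mat_vec_carrier[OF \<Phi>(1) that] by simp
  \<comment> \<open>If the cost \<open>T *\<^sub>v v\<close> does not move the terminal state, the
    optimum for zero cost is optimal for it as well. Subtracting the two first-order conditions
    along a direction ending in \<open>T *\<^sub>v v\<close> shows that this vector has norm
    0.\<close>
  have "v = 0\<^sub>v m" if v: "v \<in> carrier_vec m" and z: "\<Phi> *\<^sub>v v = 0\<^sub>v m" for v
  proof -
    have "X v N - X (0\<^sub>v m) N = 0\<^sub>v nx" using \<phi>(2)[OF v] \<phi>\<Phi>[OF v] z T0 by simp
    hence XN_eq: "X v N = X (0\<^sub>v m) N" using XN[OF v] XN[OF zero_carrier_vec] by (rule vec_eq_of_diff_zero)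
    let ?x = "X (0\<^sub>v m)" and ?u = "U (0\<^sub>v m)"
    have o0: "eopt False (0\<^sub>v nx) x0 x0 ?x ?u" using opt[of "0\<^sub>v m"] T0 by simp
    have ef: "efeas False x0 x0 ?x ?u" using o0 by (simp add: eopt_def)
    have "obj ?x ?u + 0\<^sub>v nx \<bullet> ?x N \<le> obj (X v) (U v) + 0\<^sub>v nx \<bullet> X v N"
      using o0 fe[OF v] unfolding eopt_def efeas_def by blast
    hence "obj ?x ?u \<le> obj (X v) (U v)" using XN[OF v] XN[of "0\<^sub>v m"] by simp
    hence ov: "eopt False (T *\<^sub>v v) x0 x0 ?x ?u"
      using opt[OF v] ef unfolding eopt_def XN_eq by (meson add_right_mono order_trans)
    obtain dx du where d: "hom dx du" "dx 0 = 0\<^sub>v nx" "dx N = T *\<^sub>v v"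
      using Tr'[OF v] unfolding ctrb_range_iff by blast
    have "dobj ?x ?u dx du + 0\<^sub>v nx \<bullet> dx N = 0" "dobj ?x ?u dx du + (T *\<^sub>v v) \<bullet> dx N = 0"
      using eopt_iff[OF ef zero_carrier_vec, THEN iffD1, OF o0, rule_format, of dx du]
        eopt_iff[OF ef Tv[OF v], THEN iffD1, OF ov, rule_format, of dx du] d(1,2) by simp_all
    hence "(T *\<^sub>v v) \<bullet> (T *\<^sub>v v) = 0" using Tv[OF v] d(3) by simp
    thus ?thesis using scalar_prod_self_zero[OF Tv[OF v]] Tinj[OF v] by simp
  qed
  moreover obtain e where e: "e \<in> carrier_vec m" "T *\<^sub>v e = x' N - X (0\<^sub>v m) N"
    using Tr feas_terminal_ctrb[OF fe x', of "0\<^sub>v m"] by auto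
  ultimately obtain v where v: "v \<in> carrier_vec m" "\<Phi> *\<^sub>v v = e"
    using injective_mat_solve[OF \<Phi>(1)] by blast
  have x'N: "x' N \<in> carrier_vec nx" using x' by (simp add: mpc_feas_def)
  have "X v N - X (0\<^sub>v m) N = x' N - X (0\<^sub>v m) N" using \<phi>(2)[OF v(1)] \<phi>\<Phi>[OF v(1)] v(2) e(2) by simp
  moreover have "p = q" if "p - r = q - r" "p \<in> carrier_vec nx" "q \<in> carrier_vec nx" "r \<in> carrier_vec nx"
    for p q r :: "real vec"
  proof (rule eq_vecI)
    fix i assume "i < dim_vec q"
    thus "p $ i = q $ i" using arg_cong[OF that(1), of "\<lambda>v. v $ i"] that(2-4) by auto
  qed (use that in auto)
  ultimately have XvN: "X v N = x' N" using XN[OF v(1)] XN[of "0\<^sub>v m"] x'N by auto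
  have "0\<^sub>v nx \<bullet> y N = 0" if "feas x0 y w" for y w using that by (simp add: mpc_feas_def)
  \<comment> \<open>Among trajectories with terminal state \<open>x' N\<close> the tuned linear cost
    is constant, so the free optimum that ends there also solves the constrained problem.\<close>
  hence "eopt True (0\<^sub>v nx) x0 (x' N) (X v) (U v)"
    using opt[OF v(1)] fe[OF v(1)] XvN unfolding eopt_def efeas_def by fastforce
  thus ?thesis by blast
qed

end

section \<open>Multipliers of a single horizon\<close>

lemma affine_dep_mult:
  assumes F: "affine_dep n m F" and K: "K \<in> carrier_mat l m"
  shows "affine_dep n l (\<lambda>v. K *\<^sub>v F v)"
  unfolding affine_dep_def
proof (intro conjI ballI allI)
  fix v w :: "real vec" and s assume v: "v \<in> carrier_vec n" and w: "w \<in> carrier_vec n"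
  note c = affine_dep_value[OF F zero_carrier_vec] affine_dep_value[OF F v] affine_dep_value[OF F w]
  show "K *\<^sub>v F (v + s \<cdot>\<^sub>v w) = K *\<^sub>v F v + s \<cdot>\<^sub>v (K *\<^sub>v F w - K *\<^sub>v F (0\<^sub>v n))"
    unfolding affine_dep_line[OF F v w] by (rule mult_mat_vec_affine_combination[OF K c])
next
  fix v :: "real vec" assume "v \<in> carrier_vec n"
  thus "K *\<^sub>v F v \<in> carrier_vec l" by (intro mult_mat_vec_carrier[OF K] affine_dep_value[OF F])
qed

lemma affine_dep_add:
  assumes F: "affine_dep n m F" and G: "affine_dep n m G"
  shows "affine_dep n m (\<lambda>v. F v + G v)"
  unfolding affine_dep_def
proof (intro conjI ballI allI)
  fix v w :: "real vec" and s assume v: "v \<in> carrier_vec n" and w: "w \<in> carrier_vec n"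
  have eq: "(p + s \<cdot>\<^sub>v (q - r)) + (p' + s \<cdot>\<^sub>v (q' - r')) = (p + p') + s \<cdot>\<^sub>v ((q + q') - (r + r'))"
    if "p \<in> carrier_vec m" "q \<in> carrier_vec m" "r \<in> carrier_vec m" "p' \<in> carrier_vec m"
      "q' \<in> carrier_vec m" "r' \<in> carrier_vec m" for p q r p' q' r' :: "real vec"
    by (rule eq_vecI) (use that in \<open>auto simp: algebra_simps\<close>)
  show "F (v + s \<cdot>\<^sub>v w) + G (v + s \<cdot>\<^sub>v w) = F v + G v + s \<cdot>\<^sub>v (F w + G w - (F (0\<^sub>v n) + G (0\<^sub>v n)))"
    unfolding affine_dep_line[OF F v w] affine_dep_line[OF G v w]
    by (rule eq; intro affine_dep_value[OF F] affine_dep_value[OF G] v w zero_carrier_vec)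
next
  fix v :: "real vec" assume "v \<in> carrier_vec n"
  thus "F v + G v \<in> carrier_vec m"
    by (intro add_carrier_vec affine_dep_value[OF F] affine_dep_value[OF G])
qed

lemma affine_dep_first_last:
  "affine_dep (n + m) n (\<lambda>v. vec_first v n)" "affine_dep (n + m) m (\<lambda>v. vec_last v m)"
  by (auto simp: affine_dep_def vec_first_def vec_last_def intro!: eq_vecI)

lemma vec_first_last_append_eq:
  assumes "v \<in> carrier_vec n" "w \<in> carrier_vec m"
  shows "vec_first (v @\<^sub>v w) n = v" "vec_last (v @\<^sub>v w) m = w"
  using assms by (auto simp: vec_first_def vec_last_def intro!: eq_vecI)

lemma scalar_prod_first_last:
  fixes g :: "real vec"
  assumes "g \<in> carrier_vec (n + m)" "v \<in> carrier_vec n" "w \<in> carrier_vec m"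
  shows "g \<bullet> (v @\<^sub>v w) = vec_first g n \<bullet> v + vec_last g m \<bullet> w"
  using scalar_prod_append[OF vec_first_carrier vec_last_carrier assms(2,3), of g g]
    vec_first_last_append[OF assms(1)] by simp

text \<open>One step of summation by parts: the costate equation trades the gradient in the state
  for a telescoping difference. It serves for a single stage and for a master stage, with
  \<open>Acal\<close> and \<open>T\<close> in place of \<open>A\<close> and
  \<open>B\<close>.\<close>

lemma adjoint_pairing:
  fixes l :: "real vec"
  assumes A: "A \<in> carrier_mat n n" and B: "B \<in> carrier_mat n m" and g: "g \<in> carrier_vec (n + m)"
    and l: "l \<in> carrier_vec n" "l' \<in> carrier_vec n" and v: "v \<in> carrier_vec n" and w: "w \<in> carrier_vec m"
    and x: "vec_first g n - l + transpose_mat A *\<^sub>v l' = 0\<^sub>v n"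
  shows "g \<bullet> (v @\<^sub>v w) = l \<bullet> v - l' \<bullet> (A *\<^sub>v v + B *\<^sub>v w) + (vec_last g m + transpose_mat B *\<^sub>v l') \<bullet> w"
proof -
  have Al: "transpose_mat A *\<^sub>v l' \<in> carrier_vec n" and Bl: "transpose_mat B *\<^sub>v l' \<in> carrier_vec m"
    and Av: "A *\<^sub>v v \<in> carrier_vec n" and Bw: "B *\<^sub>v w \<in> carrier_vec n"
    using A B l v w by auto
  have "0 = (vec_first g n - l + transpose_mat A *\<^sub>v l') \<bullet> v" unfolding x using v by simp
  also have "\<dots> = vec_first g n \<bullet> v - l \<bullet> v + l' \<bullet> (A *\<^sub>v v)"
    using Al l v transpose_scalar_prod(1)[OF A v l(2)]
    by (simp add: add_scalar_prod_distrib[of _ n] minus_scalar_prod_distrib[of _ n])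
  finally have 1: "vec_first g n \<bullet> v = l \<bullet> v - l' \<bullet> (A *\<^sub>v v)" by simp
  have 2: "(vec_last g m + transpose_mat B *\<^sub>v l') \<bullet> w = vec_last g m \<bullet> w + l' \<bullet> (B *\<^sub>v w)"
    using Bl w transpose_scalar_prod(1)[OF B w l(2)] by (simp add: add_scalar_prod_distrib[of _ m])
  have 3: "l' \<bullet> (A *\<^sub>v v + B *\<^sub>v w) = l' \<bullet> (A *\<^sub>v v) + l' \<bullet> (B *\<^sub>v w)"
    by (rule scalar_prod_add_distrib[OF l(2) Av Bw])
  show ?thesis unfolding scalar_prod_first_last[OF g v w] 1 2 3 by simp
qed

lemma backward_recursion:
  "\<exists>lam. lam (N::nat) = l \<and> (\<forall>t<N. lam t = F t (lam (Suc t)))"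
proof -
  \<comment> \<open>Recursion in reversed time: \<open>L k\<close> is the value at time
    \<open>N - k\<close>.\<close>
  define L where "L = rec_nat l (\<lambda>k. F (N - Suc k))"
  have "L (N - t) = F t (L (N - Suc t))" if "t < N" for t
  proof -
    have "N - t = Suc (N - Suc t)" and "N - Suc (N - Suc t) = t" using that by auto
    thus ?thesis by (simp add: L_def)
  qed
  thus ?thesis by (intro exI[of _ "\<lambda>t. L (N - t)"]) (simp add: L_def)
qed

text \<open>Stationarity in the state expresses \<open>lam t\<close> through
  \<open>lam (Suc t)\<close>, so a costate is determined by its terminal value.\<close>

lemma costate_unique:
  assumes st: "stage_stat nx nu N H f A B x u lam" "stage_stat nx nu N H f A B x u lam'"
    and c: "\<And>t. t \<le> N \<Longrightarrow> lam t \<in> carrier_vec nx" "\<And>t. t \<le> N \<Longrightarrow> lam' t \<in> carrier_vec nx"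
    and A: "\<And>t. t < N \<Longrightarrow> A t \<in> carrier_mat nx nx"
    and N: "lam N = lam' N" and t: "t \<le> N"
  shows "lam t = lam' t"
  using t
proof (induction t rule: inc_induct)
  case (step t)
  let ?g = "vec_first (H t *\<^sub>v (x t @\<^sub>v u t) + f t) nx"
  have eq: "p = q" if "g - p + r = 0\<^sub>v nx" "g - q + r = 0\<^sub>v nx" "g \<in> carrier_vec nx" "p \<in> carrier_vec nx"
    "q \<in> carrier_vec nx" "r \<in> carrier_vec nx" for g p q r :: "real vec"
  proof (rule eq_vecI)
    fix i assume "i < dim_vec q"
    thus "p $ i = q $ i"
      using arg_cong[OF that(1), of "\<lambda>v. v $ i"] arg_cong[OF that(2), of "\<lambda>v. v $ i"] that(3-6) by auto
  qed (use that in auto)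
  have "transpose_mat (A t) *\<^sub>v lam' (Suc t) \<in> carrier_vec nx"
    using A[OF step.hyps(2)] c(2)[of "Suc t"] step.hyps by auto
  moreover have "?g - lam t + transpose_mat (A t) *\<^sub>v lam' (Suc t) = 0\<^sub>v nx"
    "?g - lam' t + transpose_mat (A t) *\<^sub>v lam' (Suc t) = 0\<^sub>v nx"
    using st(1)[unfolded stage_stat_def, rule_format, OF step.hyps(2)]
      st(2)[unfolded stage_stat_def, rule_format, OF step.hyps(2)]
    unfolding step.IH by blast+
  moreover have "lam t \<in> carrier_vec nx" "lam' t \<in> carrier_vec nx" using c[of t] step.hyps by auto
  ultimately show ?case by - (rule eq[of ?g _ "transpose_mat (A t) *\<^sub>v lam' (Suc t)"], simp_all)
qed (rule N)

context mpc_data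
begin

section \<open>Value functions, their slopes and costates\<close>

lemma eopt_Inf:
  assumes "eopt e (0\<^sub>v nx) x0 xT x u"
  shows "Inf {obj x u | x u. efeas e x0 xT x u} = obj x u"
proof (rule cInf_eq_minimum)
  show "obj x u \<in> {obj x u | x u. efeas e x0 xT x u}" using assms by (auto simp: eopt_def)
  have z: "0\<^sub>v nx \<bullet> y N = 0" if "efeas e x0 xT y v" for y v using that by (simp add: efeas_def mpc_feas_def)
  fix r assume "r \<in> {obj x u | x u. efeas e x0 xT x u}"
  then obtain y v where y: "r = obj y v" "efeas e x0 xT y v" by blast
  have "efeas e x0 xT x u" "obj x u + 0\<^sub>v nx \<bullet> x N \<le> obj y v + 0\<^sub>v nx \<bullet> y N"
    using assms y(2) unfolding eopt_def by blast+
  thus "obj x u \<le> r" using z[of x u] z[of y v] y by simp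
qed

lemma value_psd_quadratic:
  assumes P: "affine_dep n nx P" and Q: "affine_dep n nx Q"
    and ex: "\<And>v. v \<in> carrier_vec n \<Longrightarrow> \<exists>x u. eopt e (0\<^sub>v nx) (P v) (Q v) x u"
  shows "psd_quadratic n (\<lambda>v. Inf {obj x u | x u. efeas e (P v) (Q v) x u})"
proof -
  obtain Kx kx Ku ku where K: "\<forall>t\<le>N. Kx t \<in> carrier_mat nx n \<and> kx t \<in> carrier_vec nx"
     "\<forall>t<N. Ku t \<in> carrier_mat (nu t) n \<and> ku t \<in> carrier_vec (nu t)"
     "\<forall>v \<in> carrier_vec n. \<forall>x u. eopt e (0\<^sub>v nx) (P v) (Q v) x u \<longleftrightarrow>
        (\<forall>t\<le>N. x t = Kx t *\<^sub>v v + kx t) \<and> (\<forall>t<N. u t = Ku t *\<^sub>v v + ku t)"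
    using eopt_affine_solution[OF affine_dep_const[OF zero_carrier_vec] P Q ex] by blast
  have "Inf {obj x u | x u. efeas e (P v) (Q v) x u} = obj (\<lambda>t. Kx t *\<^sub>v v + kx t) (\<lambda>t. Ku t *\<^sub>v v + ku t)"
    if "v \<in> carrier_vec n" for v
    using K(3) that by (intro eopt_Inf) simp
  thus ?thesis using obj_affine_psd_quadratic[OF K(1,2)] by (subst psd_quadratic_cong) auto
qed

text \<open>An envelope argument: objective minus value is nonnegative along the line and 0 at
  \<open>s = 0\<close>, so its slope vanishes there. The moved trajectory need not be optimal for
  the moved parameter.\<close>

lemma value_gradient:
  assumes x: "feas x0 x u" and d: "hom dx du"
    and M: "M \<in> carrier_mat n n" "sym_mat M" and g: "g \<in> carrier_vec n"
    and v: "v \<in> carrier_vec n" and w: "w \<in> carrier_vec n"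
    and le: "\<And>s. quad M g k (v + s \<cdot>\<^sub>v w) \<le> obj (\<lambda>t. x t + s \<cdot>\<^sub>v dx t) (\<lambda>t. u t + s \<cdot>\<^sub>v du t)"
    and eq: "quad M g k v = obj x u"
  shows "(M *\<^sub>v v + g) \<bullet> w = dobj x u dx du"
proof -
  have d': "traj dx du" using d by (simp add: hom_def)
  have "0 \<le> s * (dobj x u dx du - (M *\<^sub>v v + g) \<bullet> w) + s\<^sup>2 / 2 * (curv dx du - w \<bullet> (M *\<^sub>v w))" for s
    using le[of s] quad_line[OF M g v w, of k s]
      obj_line[OF feas_traj[OF x] d', of "\<lambda>t. x t + s \<cdot>\<^sub>v dx t" s "\<lambda>t. u t + s \<cdot>\<^sub>v du t"] eq
    by (simp add: algebra_simps)
  from linear_coeff_zero[OF this] show ?thesis by simp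
qed

text \<open>Inputs and initial state of a homogeneous trajectory can be chosen freely. If the slope
  of the stage costs depends on the end states alone, suitable test trajectories show that the input
  residuals vanish and identify the initial costate.\<close>

lemma costate_exists:
  assumes x: "traj x u" and l0: "l0 \<in> carrier_vec nx" and lN: "lN \<in> carrier_vec nx"
    and grad: "\<And>dx du. hom dx du \<Longrightarrow> stages_dobj x u dx du = l0 \<bullet> dx 0 - lN \<bullet> dx N"
  shows "\<exists>lam. (\<forall>t\<le>N. lam t \<in> carrier_vec nx) \<and> stage_stat nx nu N H f A B x u lam \<and> lam N = lN \<and> lam 0 = l0"
proof -
  define g where "g t = H t *\<^sub>v (x t @\<^sub>v u t) + f t" for t
  have g: "g t \<in> carrier_vec (nx + nu t)" if "t < N" for t
    unfolding g_def by (intro add_carrier_vec mult_mat_vec_carrier[OF H_carrier] stage_carrier[OF x] f_carrier that)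
  obtain lam where lam: "lam N = lN"
    "\<And>t. t < N \<Longrightarrow> lam t = vec_first (g t) nx + transpose_mat (A t) *\<^sub>v lam (Suc t)"
    using backward_recursion[of N lN "\<lambda>t l. vec_first (g t) nx + transpose_mat (A t) *\<^sub>v l"] by blast
  have At: "transpose_mat (A t) \<in> carrier_mat nx nx" and Bt: "transpose_mat (B t) \<in> carrier_mat (nu t) nx"
    if "t < N" for t using A_carrier[OF that] B_carrier[OF that] by auto
  have lc: "lam t \<in> carrier_vec nx" if "t \<le> N" for t
    using that
  proof (induction t rule: inc_induct)
    case (step t)
    show ?case unfolding lam(2)[OF step.hyps(2)]
      by (intro add_carrier_vec vec_first_carrier mult_mat_vec_carrier[OF At] step)
  qed (simp add: lam(1) lN)
  have st1: "vec_first (g t) nx - lam t + transpose_mat (A t) *\<^sub>v lam (Suc t) = 0\<^sub>v nx" if t: "t < N" for t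
  proof -
    have "p - (p + q) + q = 0\<^sub>v nx" if "p \<in> carrier_vec nx" "q \<in> carrier_vec nx" for p q :: "real vec"
      by (rule eq_vecI) (use that in auto)
    thus ?thesis unfolding lam(2)[OF t]
      using t by (simp add: lc mult_mat_vec_carrier[OF At[OF t]])
  qed
  define r where "r t = vec_last (g t) (nu t) + transpose_mat (B t) *\<^sub>v lam (Suc t)" for t
  have rc: "r t \<in> carrier_vec (nu t)" if "t < N" for t
    unfolding r_def using that by (intro add_carrier_vec vec_last_carrier mult_mat_vec_carrier[OF Bt] lc) auto
  \<comment> \<open>Telescoping leaves the initial costate and the input residuals
    \<open>r t\<close>; the terminal terms cancel because the recursion starts from
    \<open>lN\<close>.\<close>
  have id: "lam 0 \<bullet> dx 0 + (\<Sum>t<N. r t \<bullet> du t) = l0 \<bullet> dx 0" if d: "hom dx du" for dx du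
  proof -
    have "stages_dobj x u dx du = (\<Sum>t<N. (lam t \<bullet> dx t - lam (Suc t) \<bullet> dx (Suc t)) + r t \<bullet> du t)"
      unfolding stages_dobj_def g_def[symmetric]
    proof (intro sum.cong refl)
      fix t assume "t \<in> {..<N}"
      hence t: "t < N" by simp
      have dc: "dx t \<in> carrier_vec nx" "du t \<in> carrier_vec (nu t)" "dx (Suc t) = A t *\<^sub>v dx t + B t *\<^sub>v du t"
        using d t by (auto simp: hom_def traj_def)
      have "lam t \<in> carrier_vec nx" "lam (Suc t) \<in> carrier_vec nx" using t by (auto intro: lc)
      from adjoint_pairing[OF A_carrier[OF t] B_carrier[OF t] g[OF t] this dc(1,2) st1[OF t]]
      show "g t \<bullet> (dx t @\<^sub>v du t) = (lam t \<bullet> dx t - lam (Suc t) \<bullet> dx (Suc t)) + r t \<bullet> du t"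
        unfolding dc(3) r_def .
    qed
    also have "\<dots> = lam 0 \<bullet> dx 0 - lN \<bullet> dx N + (\<Sum>t<N. r t \<bullet> du t)"
      by (simp add: sum.distrib sum_lessThan_telescope'[of "\<lambda>t. lam t \<bullet> dx t"] lam(1))
    finally show ?thesis using grad[OF d] by simp
  qed
  have r0: "r t = 0\<^sub>v (nu t)" if t: "t < N" for t
  proof -
    \<comment> \<open>The residual itself is the test input, at stage \<open>t\<close> alone and
      with initial state 0, so that its own square remains.\<close>
    define du where "du s = (if s = t then r t else 0\<^sub>v (nu s))" for s
    have "du s \<in> carrier_vec (nu s)" if "s < N" for s using rc that by (simp add: du_def)
    from hom_exists[OF zero_carrier_vec this] obtain dx where dx: "hom dx du" "dx 0 = 0\<^sub>v nx" by blast
    have "(\<Sum>s<N. r s \<bullet> du s) = (\<Sum>s<N. if s = t then r t \<bullet> r t else 0)"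
      using rc by (intro sum.cong) (auto simp: du_def)
    also have "\<dots> = r t \<bullet> r t" using t by simp
    finally have "r t \<bullet> r t = 0" using id[OF dx(1)] lc[of 0] l0 by (simp add: dx(2))
    thus ?thesis by (rule scalar_prod_self_zero[OF rc[OF t]])
  qed
  have "lam 0 = l0"
  proof -
    have dc: "lam 0 - l0 \<in> carrier_vec nx" using lc[of 0] l0 by simp
    \<comment> \<open>Zero inputs and the initial state \<open>lam 0 - l0\<close> isolate the
      initial costate.\<close>
    obtain dx where dx: "hom dx (\<lambda>t. 0\<^sub>v (nu t))" "dx 0 = lam 0 - l0"
      using hom_exists[OF dc, of "\<lambda>t. 0\<^sub>v (nu t)"] by auto
    have "(\<Sum>t<N. r t \<bullet> 0\<^sub>v (nu t)) = 0" using rc by (intro sum.neutral) auto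
    hence "lam 0 \<bullet> (lam 0 - l0) = l0 \<bullet> (lam 0 - l0)" using id[OF dx(1)] by (simp add: dx(2))
    hence "(lam 0 - l0) \<bullet> (lam 0 - l0) = 0"
      unfolding minus_scalar_prod_distrib[OF lc[OF le0] l0 dc] by simp
    hence "lam 0 - l0 = 0\<^sub>v nx" by (rule scalar_prod_self_zero[OF dc])
    thus ?thesis using lc[OF le0] l0 by (rule vec_eq_of_diff_zero)
  qed
  moreover have "stage_stat nx nu N H f A B x u lam"
    using st1 r0 unfolding stage_stat_def g_def r_def by blast
  ultimately show ?thesis using lc lam(1) by blast
qed

end

section \<open>A block with prescribed terminal state\<close>

locale terminal_block = mpc_data nx nu N H f c A B a
  for nx nu N H f c A B a +
  fixes T :: "real mat"
  assumes T_basis: "col_basis nx T (ctrb_range nx nu A B N)"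
begin

definition target :: "real vec \<Rightarrow> real vec \<Rightarrow> real vec" where
  "target xb db = Acal nx A N *\<^sub>v xb + T *\<^sub>v db + Da nx A a N"

lemma T_carrier: "T \<in> carrier_mat nx (dim_col T)"
  using T_basis unfolding col_basis_def by blast

lemma ctrb_range_T: "r \<in> ctrb_range nx nu A B N \<longleftrightarrow> (\<exists>v \<in> carrier_vec (dim_col T). r = T *\<^sub>v v)"
proof -
  have "{T *\<^sub>v v | v. v \<in> carrier_vec (dim_col T)} = ctrb_range nx nu A B N"
    using T_basis unfolding col_basis_def by blast
  thus ?thesis by blast
qed

lemma target_feasible:
  assumes "xb \<in> carrier_vec nx" "db \<in> carrier_vec (dim_col T)"
  shows "\<exists>x u. efeas True xb (target xb db) x u"
proof -
  have "T *\<^sub>v db \<in> ctrb_range nx nu A B N" using ctrb_range_T assms(2) by blast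
  from feas_reach[OF assms(1) this] show ?thesis by (simp add: efeas_def target_def)
qed

lemma target_eopt_exists:
  assumes "xb \<in> carrier_vec nx" "db \<in> carrier_vec (dim_col T)"
  shows "\<exists>x u. eopt True (0\<^sub>v nx) xb (target xb db) x u"
proof -
  obtain x' u' where "feas xb x' u'" "x' N = target xb db"
    using target_feasible[OF assms] by (auto simp: efeas_def)
  thus ?thesis using eopt_terminal_exists[OF T_basis] by metis
qed

text \<open>The input part of the terminal state lies in the range spanned by \<open>T\<close>, so
  prescribing the terminal state through a parameter excludes no trajectory of the block.\<close>

lemma feas_target:
  assumes "feas xb x u"
  shows "\<exists>db \<in> carrier_vec (dim_col T). x N = target xb db"
proof -
  have "\<forall>j<N. u j \<in> carrier_vec (nu j)" using assms by (simp add: mpc_feas_def)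
  hence "vsum nx N (\<lambda>j. Dmat nx A N j *\<^sub>v (B j *\<^sub>v u j)) \<in> ctrb_range nx nu A B N"
    unfolding ctrb_range_def by blast
  then obtain db where "db \<in> carrier_vec (dim_col T)" "vsum nx N (\<lambda>j. Dmat nx A N j *\<^sub>v (B j *\<^sub>v u j)) = T *\<^sub>v db"
    unfolding ctrb_range_T by blast
  thus ?thesis using feas_terminal[OF assms] by (intro bexI[of _ db]) (simp_all add: target_def)
qed

text \<open>Supplies the parameter direction \<open>dd\<close> that accompanies a homogeneous
  trajectory.\<close>

lemma hom_terminal_T:
  assumes "hom dx du"
  shows "\<exists>dd \<in> carrier_vec (dim_col T). dx N = Acal nx A N *\<^sub>v dx 0 + T *\<^sub>v dd"
proof -
  have "\<forall>j<N. du j \<in> carrier_vec (nu j)" using assms by (simp add: hom_def traj_def)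
  hence "vsum nx N (\<lambda>j. Dmat nx A N j *\<^sub>v (B j *\<^sub>v du j)) \<in> ctrb_range nx nu A B N"
    unfolding ctrb_range_def by blast
  then obtain dd where "dd \<in> carrier_vec (dim_col T)" "vsum nx N (\<lambda>j. Dmat nx A N j *\<^sub>v (B j *\<^sub>v du j)) = T *\<^sub>v dd"
    unfolding ctrb_range_T by blast
  thus ?thesis using hom_terminal[OF assms] by (intro bexI[of _ dd]) simp_all
qed

lemma target_affine:
  "affine_dep (nx + dim_col T) nx (\<lambda>v. target (vec_first v nx) (vec_last v (dim_col T)))"
  unfolding target_def
  by (intro affine_dep_add affine_dep_mult[OF _ Acal_carrier] affine_dep_mult[OF _ T_carrier]
      affine_dep_first_last affine_dep_const Da_carrier)

lemma target_line:
  assumes x: "xb \<in> carrier_vec nx" "dx \<in> carrier_vec nx"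
    and d: "db \<in> carrier_vec (dim_col T)" "dd \<in> carrier_vec (dim_col T)"
  shows "target (xb + s \<cdot>\<^sub>v dx) (db + s \<cdot>\<^sub>v dd) = target xb db + s \<cdot>\<^sub>v (Acal nx A N *\<^sub>v dx + T *\<^sub>v dd)"
  unfolding target_def mult_mat_vec_line[OF Acal_carrier x] mult_mat_vec_line[OF T_carrier d]
  by (rule add_line_vec[symmetric, of _ nx])
    (intro mult_mat_vec_carrier[OF Acal_carrier] mult_mat_vec_carrier[OF T_carrier] x d Da_carrier)+

lemma target_affine_solution:
  "\<exists>Kx kx Ku ku.
     (\<forall>t\<le>N. Kx t \<in> carrier_mat nx (nx + dim_col T) \<and> kx t \<in> carrier_vec nx) \<and>
     (\<forall>t<N. Ku t \<in> carrier_mat (nu t) (nx + dim_col T) \<and> ku t \<in> carrier_vec (nu t)) \<and>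
     (\<forall>xb \<in> carrier_vec nx. \<forall>db \<in> carrier_vec (dim_col T). \<forall>x u. eopt True (0\<^sub>v nx) xb (target xb db) x u \<longleftrightarrow>
        (\<forall>t\<le>N. x t = Kx t *\<^sub>v (xb @\<^sub>v db) + kx t) \<and> (\<forall>t<N. u t = Ku t *\<^sub>v (xb @\<^sub>v db) + ku t))"
proof -
  have "\<exists>x u. eopt True (0\<^sub>v nx) (vec_first v nx) (target (vec_first v nx) (vec_last v (dim_col T))) x u"
    for v by (intro target_eopt_exists) auto
  from eopt_affine_solution[OF affine_dep_const[OF zero_carrier_vec] affine_dep_first_last(1) target_affine this]
  obtain Kx kx Ku ku where K: "\<forall>t\<le>N. Kx t \<in> carrier_mat nx (nx + dim_col T) \<and> kx t \<in> carrier_vec nx"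
     "\<forall>t<N. Ku t \<in> carrier_mat (nu t) (nx + dim_col T) \<and> ku t \<in> carrier_vec (nu t)"
     "\<forall>v \<in> carrier_vec (nx + dim_col T). \<forall>x u.
        eopt True (0\<^sub>v nx) (vec_first v nx) (target (vec_first v nx) (vec_last v (dim_col T))) x u \<longleftrightarrow>
        (\<forall>t\<le>N. x t = Kx t *\<^sub>v v + kx t) \<and> (\<forall>t<N. u t = Ku t *\<^sub>v v + ku t)"
    by blast
  have "eopt True (0\<^sub>v nx) xb (target xb db) x u \<longleftrightarrow>
        (\<forall>t\<le>N. x t = Kx t *\<^sub>v (xb @\<^sub>v db) + kx t) \<and> (\<forall>t<N. u t = Ku t *\<^sub>v (xb @\<^sub>v db) + ku t)"
    if "xb \<in> carrier_vec nx" "db \<in> carrier_vec (dim_col T)" for xb db x u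
    using K(3)[rule_format, of "xb @\<^sub>v db" x u] that unfolding vec_first_last_append_eq[OF that] by simp
  hence "\<forall>xb \<in> carrier_vec nx. \<forall>db \<in> carrier_vec (dim_col T). \<forall>x u. eopt True (0\<^sub>v nx) xb (target xb db) x u \<longleftrightarrow>
        (\<forall>t\<le>N. x t = Kx t *\<^sub>v (xb @\<^sub>v db) + kx t) \<and> (\<forall>t<N. u t = Ku t *\<^sub>v (xb @\<^sub>v db) + ku t)"
    by simp
  with K(1,2) show ?thesis by (intro exI conjI)
qed

lemma target_value_psd_quadratic:
  "\<exists>M g k. M \<in> carrier_mat (nx + dim_col T) (nx + dim_col T) \<and> g \<in> carrier_vec (nx + dim_col T) \<and>
     sym_mat M \<and> psd_mat (nx + dim_col T) M \<and>
     (\<forall>xb \<in> carrier_vec nx. \<forall>db \<in> carrier_vec (dim_col T).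
        Inf {obj x u | x u. efeas True xb (target xb db) x u} = quad M g k (xb @\<^sub>v db))"
proof -
  have "\<exists>x u. eopt True (0\<^sub>v nx) (vec_first v nx) (target (vec_first v nx) (vec_last v (dim_col T))) x u"
    for v by (intro target_eopt_exists) auto
  from value_psd_quadratic[OF affine_dep_first_last(1) target_affine this]
  obtain M g k where M: "M \<in> carrier_mat (nx + dim_col T) (nx + dim_col T)" "g \<in> carrier_vec (nx + dim_col T)"
     "sym_mat M" "psd_mat (nx + dim_col T) M"
     "\<forall>v \<in> carrier_vec (nx + dim_col T).
        Inf {obj x u | x u. efeas True (vec_first v nx) (target (vec_first v nx) (vec_last v (dim_col T))) x u} = quad M g k v"
    unfolding psd_quadratic_def by blast
  have "Inf {obj x u | x u. efeas True xb (target xb db) x u} = quad M g k (xb @\<^sub>v db)"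
    if "xb \<in> carrier_vec nx" "db \<in> carrier_vec (dim_col T)" for xb db
    using M(5)[rule_format, of "xb @\<^sub>v db"] that unfolding vec_first_last_append_eq[OF that] by simp
  hence "\<forall>xb \<in> carrier_vec nx. \<forall>db \<in> carrier_vec (dim_col T).
      Inf {obj x u | x u. efeas True xb (target xb db) x u} = quad M g k (xb @\<^sub>v db)" by simp
  with M(1-4) show ?thesis by (intro exI conjI)
qed

(* Moving the parameter along (dx 0, dd) keeps x + s dx feasible, so the value function and the objective
   along that line have the same slope at s = 0; stationarity of the master problem evaluates the slope. *)
lemma target_costate_exists:
  assumes opt: "eopt True (0\<^sub>v nx) xb (target xb db) x u"
    and db: "db \<in> carrier_vec (dim_col T)"
    and M: "M \<in> carrier_mat (nx + dim_col T) (nx + dim_col T)" "sym_mat M"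
    and g: "g \<in> carrier_vec (nx + dim_col T)"
    and V: "\<And>xb db. xb \<in> carrier_vec nx \<Longrightarrow> db \<in> carrier_vec (dim_col T) \<Longrightarrow>
        Inf {obj x u | x u. efeas True xb (target xb db) x u} = quad M g k (xb @\<^sub>v db)"
    and term0: "H N = 0\<^sub>m nx nx" "f N = 0\<^sub>v nx"
    and l: "l \<in> carrier_vec nx" "l' \<in> carrier_vec nx"
    and stat: "vec_first (M *\<^sub>v (xb @\<^sub>v db) + g) nx - l + transpose_mat (Acal nx A N) *\<^sub>v l' = 0\<^sub>v nx"
      "vec_last (M *\<^sub>v (xb @\<^sub>v db) + g) (dim_col T) + transpose_mat T *\<^sub>v l' = 0\<^sub>v (dim_col T)"
  shows "\<exists>lam. (\<forall>t\<le>N. lam t \<in> carrier_vec nx) \<and> stage_stat nx nu N H f A B x u lam \<and> lam N = l' \<and> lam 0 = l"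
proof (rule costate_exists)
  have ef: "efeas True xb (target xb db) x u" using opt by (simp add: eopt_def)
  hence fe: "feas xb x u" and xN: "x N = target xb db" by (auto simp: efeas_def)
  have xb: "xb \<in> carrier_vec nx" using fe by (auto simp: mpc_feas_def)
  show "traj x u" by (rule feas_traj[OF fe])
  \<comment> \<open>A real infimum is a lower bound only for sets that are bounded below; attainment
    by an optimum settles this.\<close>
  have V_le: "quad M g k (xb' @\<^sub>v db') \<le> obj x' u'"
    if e: "efeas True xb' (target xb' db') x' u'" and db': "db' \<in> carrier_vec (dim_col T)" for xb' db' x' u'
  proof -
    have xb': "xb' \<in> carrier_vec nx" using e by (auto simp: efeas_def mpc_feas_def)
    obtain y v where y: "eopt True (0\<^sub>v nx) xb' (target xb' db') y v"
      using target_eopt_exists[OF xb' db'] by blast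
    have "y N = x' N" using y e by (simp add: eopt_def efeas_def)
    moreover have "obj y v + 0\<^sub>v nx \<bullet> y N \<le> obj x' u' + 0\<^sub>v nx \<bullet> x' N"
      using y e unfolding eopt_def by blast
    ultimately show ?thesis using V[OF xb' db'] eopt_Inf[OF y] by simp
  qed
  fix dx du assume d: "hom dx du"
  have dc: "dx 0 \<in> carrier_vec nx" "dx N \<in> carrier_vec nx" using d by (auto simp: hom_def traj_def)
  obtain dd where dd: "dd \<in> carrier_vec (dim_col T)" "dx N = Acal nx A N *\<^sub>v dx 0 + T *\<^sub>v dd"
    using hom_terminal_T[OF d] by blast
  have "(M *\<^sub>v (xb @\<^sub>v db) + g) \<bullet> (dx 0 @\<^sub>v dd) = dobj x u dx du"
  proof (rule value_gradient[OF fe d M g, where k = k])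
    show "quad M g k (xb @\<^sub>v db) = obj x u" using V[OF xb db] eopt_Inf[OF opt] by simp
    fix s
    have "efeas True (xb + s \<cdot>\<^sub>v dx 0) (target (xb + s \<cdot>\<^sub>v dx 0) (db + s \<cdot>\<^sub>v dd)) (\<lambda>t. x t + s \<cdot>\<^sub>v dx t) (\<lambda>t. u t + s \<cdot>\<^sub>v du t)"
      using feas_line[OF fe d, of s] unfolding efeas_def target_line[OF xb dc(1) db dd(1)] xN dd(2) by simp
    from V_le[OF this] show "quad M g k ((xb @\<^sub>v db) + s \<cdot>\<^sub>v (dx 0 @\<^sub>v dd)) \<le> obj (\<lambda>t. x t + s \<cdot>\<^sub>v dx t) (\<lambda>t. u t + s \<cdot>\<^sub>v du t)"
      unfolding append_vec_line[OF xb dc(1) db dd(1)] using db dd(1) by simp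
  qed (use xb db dc dd in auto)
  moreover have "M *\<^sub>v (xb @\<^sub>v db) + g \<in> carrier_vec (nx + dim_col T)"
    using M g xb db by (intro add_carrier_vec mult_mat_vec_carrier[OF M(1)]) auto
  \<comment> \<open>The master stage has dynamics \<open>Acal\<close> and \<open>T\<close>, whose
    increment along \<open>(dx 0, dd)\<close> is \<open>dx N\<close>; its input stationarity
    \<open>stat(2)\<close> removes the remaining term.\<close>
  from adjoint_pairing[OF Acal_carrier T_carrier this l dc(1) dd(1) stat(1)]
  have "(M *\<^sub>v (xb @\<^sub>v db) + g) \<bullet> (dx 0 @\<^sub>v dd) = l \<bullet> dx 0 - l' \<bullet> dx N"
    unfolding stat(2) dd(2) using dd(1) by simp
  moreover have "dobj x u dx du = stages_dobj x u dx du"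
  proof -
    have "x N \<in> carrier_vec nx" using fe by (simp add: mpc_feas_def)
    hence "0\<^sub>m nx nx *\<^sub>v x N + 0\<^sub>v nx = 0\<^sub>v nx" by (intro eq_vecI) auto
    thus ?thesis using dc(2) by (simp add: dobj_def term0)
  qed
  ultimately show "stages_dobj x u dx du = l \<bullet> dx 0 - l' \<bullet> dx N" by simp
qed (rule l)+

end

text \<open>With free terminal state the slope of the value depends on the initial state alone. The
  slope of the terminal cost moves to the other side and becomes the terminal costate.\<close>

lemma (in mpc_data) free_costate_exists:
  assumes opt: "eopt False (0\<^sub>v nx) xb xT x u"
    and M: "M \<in> carrier_mat nx nx" "sym_mat M" and g: "g \<in> carrier_vec nx"
    and V: "\<And>xb. xb \<in> carrier_vec nx \<Longrightarrow> Inf {obj x u | x u. feas xb x u} = quad M g k xb"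
  shows "\<exists>lam. (\<forall>t\<le>N. lam t \<in> carrier_vec nx) \<and> stage_stat nx nu N H f A B x u lam \<and>
    lam N = H N *\<^sub>v x N + f N \<and> lam 0 = M *\<^sub>v xb + g"
proof (rule costate_exists)
  have fe: "feas xb x u" using opt by (auto simp: eopt_def efeas_def)
  have xb: "xb \<in> carrier_vec nx" and xN: "x N \<in> carrier_vec nx" using fe by (auto simp: mpc_feas_def)
  show "traj x u" by (rule feas_traj[OF fe])
  show "H N *\<^sub>v x N + f N \<in> carrier_vec nx"
    by (intro add_carrier_vec mult_mat_vec_carrier[OF HN_carrier] xN fN_carrier)
  show "M *\<^sub>v xb + g \<in> carrier_vec nx"
    by (intro add_carrier_vec mult_mat_vec_carrier[OF M(1)] xb g)
  have Inf_eopt: "quad M g k xb' = obj y v" if "eopt False (0\<^sub>v nx) xb' xT y v" for xb' y v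
    using that V[of xb'] eopt_Inf[OF that] by (auto simp: eopt_def efeas_def mpc_feas_def)
  have V_le: "quad M g k xb' \<le> obj x' u'" if f': "feas xb' x' u'" for xb' x' u'
  proof -
    have xb': "xb' \<in> carrier_vec nx" using f' by (auto simp: mpc_feas_def)
    obtain y v where y: "eopt False (0\<^sub>v nx) xb' xT y v"
      using eopt_free_exists[OF zero_carrier_vec xb'] by blast
    have "y N \<in> carrier_vec nx" "x' N \<in> carrier_vec nx" using y f' by (auto simp: eopt_def efeas_def mpc_feas_def)
    moreover have "obj y v + 0\<^sub>v nx \<bullet> y N \<le> obj x' u' + 0\<^sub>v nx \<bullet> x' N"
      using y f' unfolding eopt_def efeas_def by blast
    ultimately show ?thesis using Inf_eopt[OF y] by simp
  qed
  fix dx du assume d: "hom dx du"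
  have dc: "dx 0 \<in> carrier_vec nx" "dx N \<in> carrier_vec nx" using d by (auto simp: hom_def traj_def)
  have "(M *\<^sub>v xb + g) \<bullet> dx 0 = dobj x u dx du"
    by (rule value_gradient[OF fe d M g xb dc(1) V_le[OF feas_line[OF fe d]] Inf_eopt[OF opt]])
  thus "stages_dobj x u dx du = (M *\<^sub>v xb + g) \<bullet> dx 0 - (H N *\<^sub>v x N + f N) \<bullet> dx N"
    by (simp add: dobj_def)
qed

section \<open>Splitting the horizon\<close>

lemma tau_Suc: "tau Ns (Suc i) = tau Ns i + Ns i"
  by (simp add: tau_def)

lemma tau_mono: "i \<le> j \<Longrightarrow> tau Ns i \<le> tau Ns j"
  unfolding tau_def by (intro sum_mono2) auto

lemma sum_blocks: "(\<Sum>t<tau Ns k. g t) = (\<Sum>i<k. \<Sum>s<Ns i. g (tau Ns i + s))"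
proof (induction k)
  case (Suc k)
  have "(\<Sum>t<a + b. g t) = (\<Sum>t<a. g t) + (\<Sum>s<b. g (a + s))" for a b :: nat
    by (induction b) (simp_all add: add.assoc)
  thus ?case using Suc by (simp add: tau_Suc)
qed (simp add: tau_def)

lemma all_blocks: "(\<forall>t<tau Ns k. Q t) \<longleftrightarrow> (\<forall>i<k. \<forall>s<Ns i. Q (tau Ns i + s))"
proof (induction k)
  case (Suc k)
  have "(\<forall>t<a + b. Q t) \<longleftrightarrow> (\<forall>t<a. Q t) \<and> (\<forall>s<b. Q (a + s))" for a b :: nat
    by (induction b) (auto simp: less_Suc_eq)
  thus ?case using Suc by (auto simp: tau_Suc less_Suc_eq)
qed (simp add: tau_def)

text \<open>Neighbouring blocks share one time index, hence the compatibility condition. Besides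
  states, the lemma glues costates.\<close>

lemma glue_states:
  "(\<And>i. i < k \<Longrightarrow> xs i (Ns i) = xs (Suc i) 0) \<Longrightarrow> \<exists>x. \<forall>i\<le>k. \<forall>t\<le>Ns i. x (tau Ns i + t) = xs i t"
proof (induction k)
  case 0
  thus ?case by (intro exI[of _ "xs 0"]) (simp add: tau_def)
next
  case (Suc k)
  then obtain x where x: "\<forall>i\<le>k. \<forall>t\<le>Ns i. x (tau Ns i + t) = xs i t" by auto
  define y where "y t = (if t \<le> tau Ns (Suc k) then x t else xs (Suc k) (t - tau Ns (Suc k)))" for t
  have "y (tau Ns i + t) = xs i t" if "i \<le> Suc k" "t \<le> Ns i" for i t
  proof (cases "i \<le> k")
    case True
    hence "tau Ns i + t \<le> tau Ns (Suc k)" using that tau_mono[of "Suc i" "Suc k" Ns] by (simp add: tau_Suc)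
    thus ?thesis using x True that by (simp add: y_def)
  next
    case False
    hence i: "i = Suc k" using that by simp
    have "x (tau Ns (Suc k)) = xs (Suc k) 0" using x Suc.prems[of k] by (simp add: tau_Suc)
    thus ?thesis by (cases "t = 0") (auto simp: i y_def)
  qed
  thus ?case by blast
qed

text \<open>Inputs of different blocks occupy disjoint indices, so nothing has to match.\<close>

lemma glue_inputs: "\<exists>u. \<forall>i\<le>k. \<forall>t<Ns i. u (tau Ns i + t) = us i t"
proof (induction k)
  case 0
  thus ?case by (intro exI[of _ "us 0"]) (simp add: tau_def)
next
  case (Suc k)
  then obtain u where u: "\<forall>i\<le>k. \<forall>t<Ns i. u (tau Ns i + t) = us i t" by auto
  define v where "v t = (if t < tau Ns (Suc k) then u t else us (Suc k) (t - tau Ns (Suc k)))" for t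
  have "v (tau Ns i + t) = us i t" if "i \<le> Suc k" "t < Ns i" for i t
  proof (cases "i \<le> k")
    case True
    hence "tau Ns i + t < tau Ns (Suc k)" using that tau_mono[of "Suc i" "Suc k" Ns] by (simp add: tau_Suc)
    thus ?thesis using u True that by (simp add: v_def)
  next
    case False
    hence "i = Suc k" using that by simp
    thus ?thesis by (simp add: v_def)
  qed
  thus ?case by blast
qed

text \<open>The stage conditions are grouped under one quantifier \<open>t < N\<close>, the form in
  which the horizon splits into blocks.\<close>

lemma mpc_feas_alt:
  "mpc_feas nx nu N A B a x0 x u \<longleftrightarrow> x 0 = x0 \<and> x N \<in> carrier_vec nx \<and>
     (\<forall>t<N. x t \<in> carrier_vec nx \<and> u t \<in> carrier_vec (nu t) \<and> x (Suc t) = A t *\<^sub>v x t + B t *\<^sub>v u t + a t)"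
  by (auto simp: mpc_feas_def le_less)

lemma stages_obj_zero_terminal:
  assumes "x N \<in> carrier_vec nx"
  shows "mpc_obj N (H(N := 0\<^sub>m nx nx)) (f(N := 0\<^sub>v nx)) (c(N := 0)) x u = stages_obj N H f c x u"
proof -
  have "0\<^sub>m nx nx *\<^sub>v x N = 0\<^sub>v nx" by (rule eq_vecI) (use assms in auto)
  thus ?thesis using assms by (simp add: mpc_obj_def stages_obj_def quad_def)
qed

locale mpc_split = mpc_data nx nu N H f c A B a
  for nx nu N H f c A B a +
  fixes p :: nat and Ns :: "nat \<Rightarrow> nat" and T :: "nat \<Rightarrow> real mat" and xbar :: "real vec"
  assumes xbar_carrier: "xbar \<in> carrier_vec nx"
    and Ns_sum: "(\<Sum>i\<le>p. Ns i) = N"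
    and blocks_basis: "i < p \<Longrightarrow> col_basis nx (T i) (blkS_range nx nu A B Ns i)"
begin

lemma tau_last: "tau Ns (Suc p) = N" "tau Ns p + Ns p = N"
  using Ns_sum by (simp_all add: tau_def lessThan_Suc_atMost[symmetric])

lemma tau_le: "i \<le> p \<Longrightarrow> tau Ns i + Ns i \<le> N"
  using tau_mono[of "Suc i" "Suc p" Ns] by (simp add: tau_Suc tau_last)

text \<open>At index \<open>Ns p\<close> the shift hits \<open>H N\<close> and \<open>f N\<close>,
  so the last block inherits the terminal cost unchanged.\<close>

lemma last_block:
  "mpc_data nx (shift (tau Ns p) nu) (Ns p) (shift (tau Ns p) H) (shift (tau Ns p) f)
    (shift (tau Ns p) A) (shift (tau Ns p) B) (shift (tau Ns p) a)"
  using A_carrier B_carrier a_carrier H_carrier f_carrier H_sym H_psd Hu_pd HN_carrier fN_carrier HN_sym HN_psd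
    tau_last(2)
  by unfold_locales (simp_all add: shift_def)

text \<open>At index \<open>Ns i\<close> the shifted sequences hold the first stage of the next
  block, in general of another dimension. Overwriting it by 0 yields a problem without terminal cost
  in the common format.\<close>

lemma inner_block:
  assumes i: "i < p"
  shows "terminal_block nx (shift (tau Ns i) nu) (Ns i) ((shift (tau Ns i) H)(Ns i := 0\<^sub>m nx nx))
    ((shift (tau Ns i) f)(Ns i := 0\<^sub>v nx)) (shift (tau Ns i) A) (shift (tau Ns i) B) (shift (tau Ns i) a) (T i)"
proof -
  have *: "tau Ns i + t < N" if "t < Ns i" for t using tau_le[of i] i that by simp
  have z: "0\<^sub>m nx nx *\<^sub>v v = 0\<^sub>v nx" if "v \<in> carrier_vec nx" for v :: "real vec"
    by (rule eq_vecI) (use that in auto)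
  show ?thesis
    using A_carrier B_carrier a_carrier H_carrier f_carrier H_sym H_psd Hu_pd * blocks_basis[OF i]
    by unfold_locales (auto simp: shift_def sym_mat_def psd_mat_def z blkS_range_def)
qed

end

section \<open>The inner subproblems\<close>

locale split_block = mpc_split nx nu N H f c A B a p Ns T xbar
  for nx nu N H f c A B a p Ns T xbar +
  fixes i :: nat
  assumes i_less: "i < p"
begin

sublocale P: terminal_block nx "shift (tau Ns i) nu" "Ns i" "(shift (tau Ns i) H)(Ns i := 0\<^sub>m nx nx)"
    "(shift (tau Ns i) f)(Ns i := 0\<^sub>v nx)" "(shift (tau Ns i) c)(Ns i := 0)"
    "shift (tau Ns i) A" "shift (tau Ns i) B" "shift (tau Ns i) a" "T i"
  by (rule inner_block[OF i_less])

lemma P_feas_iff: "P_feas nx nu A B a Ns T i xb db x u \<longleftrightarrow> P.efeas True xb (P.target xb db) x u"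
  by (simp add: P_feas_def P.efeas_def P.target_def blkAcal_def blkDa_def)

lemma P_obj_eq: "P.efeas e xb xT x u \<Longrightarrow> P.obj x u = P_obj H f c Ns i x u"
  unfolding P_obj_def P.efeas_def by (rule stages_obj_zero_terminal) (simp add: mpc_feas_def)

lemma P_opt_iff:
  "P_opt nx nu H f c A B a Ns T i xb db x u \<longleftrightarrow> P.eopt True (0\<^sub>v nx) xb (P.target xb db) x u"
proof -
  have *: "P.obj y v + 0\<^sub>v nx \<bullet> y (Ns i) = P_obj H f c Ns i y v" if "P.efeas True xb (P.target xb db) y v" for y v
  proof -
    have "P.feas xb y v" using that by (simp add: P.efeas_def)
    hence "y (Ns i) \<in> carrier_vec nx" by (simp add: mpc_feas_def)
    thus ?thesis using P_obj_eq[OF that] by simp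
  qed
  show ?thesis unfolding P_opt_def P.eopt_def P_feas_iff using * by auto
qed

lemma P_val_eq:
  "P_val nx nu H f c A B a Ns T i xb db = Inf {P.obj x u | x u. P.efeas True xb (P.target xb db) x u}"
proof -
  have "{P_obj H f c Ns i x u | x u. P.efeas True xb (P.target xb db) x u} =
    {P.obj x u | x u. P.efeas True xb (P.target xb db) x u}"
    using P_obj_eq by (metis (no_types, lifting))
  thus ?thesis unfolding P_val_def P_feas_iff by simp
qed

lemma P_val_opt:
  assumes "P_opt nx nu H f c A B a Ns T i xb db x u"
  shows "P_val nx nu H f c A B a Ns T i xb db = P_obj H f c Ns i x u"
proof -
  have o: "P.eopt True (0\<^sub>v nx) xb (P.target xb db) x u" using assms by (simp add: P_opt_iff)
  hence "P.efeas True xb (P.target xb db) x u" by (simp add: P.eopt_def)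
  from P_obj_eq[OF this] show ?thesis unfolding P_val_eq P.eopt_Inf[OF o] .
qed

lemma P_opt_exists:
  assumes "xb \<in> carrier_vec nx" "db \<in> carrier_vec (dim_col (T i))"
  shows "\<exists>x u. P_opt nx nu H f c A B a Ns T i xb db x u"
  unfolding P_opt_iff by (rule P.target_eopt_exists[OF assms])

lemma P_val_le:
  assumes x: "P_feas nx nu A B a Ns T i xb db x u" and db: "db \<in> carrier_vec (dim_col (T i))"
  shows "P_val nx nu H f c A B a Ns T i xb db \<le> P_obj H f c Ns i x u"
proof -
  have xb: "xb \<in> carrier_vec nx" using x by (auto simp: P_feas_def mpc_feas_def)
  obtain y v where "P_opt nx nu H f c A B a Ns T i xb db y v" using P_opt_exists[OF xb db] by blast
  thus ?thesis using P_val_opt x unfolding P_opt_def by metis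
qed

lemma P_reach:
  assumes "P.feas xb x u"
  shows "\<exists>db \<in> carrier_vec (dim_col (T i)). P_feas nx nu A B a Ns T i xb db x u"
  using P.feas_target[OF assms] assms by (simp add: P_feas_iff P.efeas_def)

lemma P_affine_solution:
  "\<exists>Kx kx Ku ku.
     (\<forall>t\<le>Ns i. Kx t \<in> carrier_mat nx (nx + dim_col (T i)) \<and> kx t \<in> carrier_vec nx) \<and>
     (\<forall>t<Ns i. Ku t \<in> carrier_mat (nu (tau Ns i + t)) (nx + dim_col (T i)) \<and>
                ku t \<in> carrier_vec (nu (tau Ns i + t))) \<and>
     (\<forall>xb \<in> carrier_vec nx. \<forall>db \<in> carrier_vec (dim_col (T i)).
        (\<exists>x u. P_feas nx nu A B a Ns T i xb db x u) \<and>
        (\<forall>x u. P_opt nx nu H f c A B a Ns T i xb db x u \<longleftrightarrow>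
           (\<forall>t\<le>Ns i. x t = Kx t *\<^sub>v (xb @\<^sub>v db) + kx t) \<and>
           (\<forall>t<Ns i. u t = Ku t *\<^sub>v (xb @\<^sub>v db) + ku t)))"
proof -
  obtain Kx kx Ku ku where K: "\<forall>t\<le>Ns i. Kx t \<in> carrier_mat nx (nx + dim_col (T i)) \<and> kx t \<in> carrier_vec nx"
     "\<forall>t<Ns i. Ku t \<in> carrier_mat (shift (tau Ns i) nu t) (nx + dim_col (T i)) \<and> ku t \<in> carrier_vec (shift (tau Ns i) nu t)"
     "\<forall>xb \<in> carrier_vec nx. \<forall>db \<in> carrier_vec (dim_col (T i)). \<forall>x u. P.eopt True (0\<^sub>v nx) xb (P.target xb db) x u \<longleftrightarrow>
        (\<forall>t\<le>Ns i. x t = Kx t *\<^sub>v (xb @\<^sub>v db) + kx t) \<and> (\<forall>t<Ns i. u t = Ku t *\<^sub>v (xb @\<^sub>v db) + ku t)"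
    using P.target_affine_solution by (elim exE conjE)
  have "\<exists>x u. P_feas nx nu A B a Ns T i xb db x u"
    if "xb \<in> carrier_vec nx" "db \<in> carrier_vec (dim_col (T i))" for xb db
    unfolding P_feas_iff by (rule P.target_feasible[OF that])
  hence "\<forall>xb \<in> carrier_vec nx. \<forall>db \<in> carrier_vec (dim_col (T i)).
        (\<exists>x u. P_feas nx nu A B a Ns T i xb db x u) \<and>
        (\<forall>x u. P_opt nx nu H f c A B a Ns T i xb db x u \<longleftrightarrow>
           (\<forall>t\<le>Ns i. x t = Kx t *\<^sub>v (xb @\<^sub>v db) + kx t) \<and>
           (\<forall>t<Ns i. u t = Ku t *\<^sub>v (xb @\<^sub>v db) + ku t))"
    using K(3) unfolding P_opt_iff by simp
  with K(1) K(2)[unfolded shift_def] show ?thesis by (intro exI conjI)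
qed

lemma P_value_quadratic:
  "\<exists>M g k. M \<in> carrier_mat (nx + dim_col (T i)) (nx + dim_col (T i)) \<and> g \<in> carrier_vec (nx + dim_col (T i)) \<and>
     sym_mat M \<and> psd_mat (nx + dim_col (T i)) M \<and>
     (\<forall>xb \<in> carrier_vec nx. \<forall>db \<in> carrier_vec (dim_col (T i)).
        P_val nx nu H f c A B a Ns T i xb db = quad M g k (xb @\<^sub>v db))"
  unfolding P_val_eq by (rule P.target_value_psd_quadratic)

lemma P_costate:
  assumes opt: "P_opt nx nu H f c A B a Ns T i xb db x u" and db: "db \<in> carrier_vec (dim_col (T i))"
    and M: "M \<in> carrier_mat (nx + dim_col (T i)) (nx + dim_col (T i))" "sym_mat M"
    and g: "g \<in> carrier_vec (nx + dim_col (T i))"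
    and V: "\<And>xb db. xb \<in> carrier_vec nx \<Longrightarrow> db \<in> carrier_vec (dim_col (T i)) \<Longrightarrow>
        P_val nx nu H f c A B a Ns T i xb db = quad M g k (xb @\<^sub>v db)"
    and l: "l \<in> carrier_vec nx" "l' \<in> carrier_vec nx"
    and stat: "vec_first (M *\<^sub>v (xb @\<^sub>v db) + g) nx - l + transpose_mat (blkAcal nx A Ns i) *\<^sub>v l' = 0\<^sub>v nx"
      "vec_last (M *\<^sub>v (xb @\<^sub>v db) + g) (dim_col (T i)) + transpose_mat (T i) *\<^sub>v l' = 0\<^sub>v (dim_col (T i))"
  shows "\<exists>lam. (\<forall>t\<le>Ns i. lam t \<in> carrier_vec nx) \<and>
    stage_stat nx (shift (tau Ns i) nu) (Ns i) (shift (tau Ns i) H) (shift (tau Ns i) f)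
      (shift (tau Ns i) A) (shift (tau Ns i) B) x u lam \<and> lam (Ns i) = l' \<and> lam 0 = l"
proof -
  have "stage_stat nx (shift (tau Ns i) nu) (Ns i) ((shift (tau Ns i) H)(Ns i := 0\<^sub>m nx nx)) ((shift (tau Ns i) f)(Ns i := 0\<^sub>v nx))
      (shift (tau Ns i) A) (shift (tau Ns i) B) x u lam \<longleftrightarrow>
    stage_stat nx (shift (tau Ns i) nu) (Ns i) (shift (tau Ns i) H) (shift (tau Ns i) f)
      (shift (tau Ns i) A) (shift (tau Ns i) B) x u lam" for lam
    by (simp add: stage_stat_def)
  with P.target_costate_exists[OF opt[unfolded P_opt_iff] db M g V[unfolded P_val_eq] _ _ l
      stat(1)[unfolded blkAcal_def] stat(2)]
  show ?thesis by simp
qed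

end

context mpc_split
begin

lemma block_locale: "i < p \<Longrightarrow> split_block nx nu N H f A B a p Ns T xbar i"
  by unfold_locales

section \<open>The last subproblem\<close>

sublocale Q: mpc_data nx "shift (tau Ns p) nu" "Ns p" "shift (tau Ns p) H" "shift (tau Ns p) f" "shift (tau Ns p) c"
    "shift (tau Ns p) A" "shift (tau Ns p) B" "shift (tau Ns p) a"
  by (rule last_block)

lemma Q_opt_iff: "Q_opt nx nu H f c A B a Ns p xb x u \<longleftrightarrow> Q.eopt False (0\<^sub>v nx) xb (0\<^sub>v nx) x u"
  unfolding Q_opt_def by (rule Q.eopt_free)

lemma Q_opt_exists: "xb \<in> carrier_vec nx \<Longrightarrow> \<exists>x u. Q_opt nx nu H f c A B a Ns p xb x u"
  unfolding Q_opt_iff by (rule Q.eopt_free_exists) simp_all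

lemma Q_val_eq: "Q_val nx nu H f c A B a Ns p xb = Inf {Q.obj x u | x u. Q.efeas False xb (0\<^sub>v nx) x u}"
  by (simp add: Q_val_def mpc_val_def Q.efeas_def)

lemma Q_val_opt:
  assumes "Q_opt nx nu H f c A B a Ns p xb x u"
  shows "Q_val nx nu H f c A B a Ns p xb = Q.obj x u"
  unfolding Q_val_eq by (rule Q.eopt_Inf[OF assms[unfolded Q_opt_iff]])

lemma Q_val_le:
  assumes "Q.feas xb x u"
  shows "Q_val nx nu H f c A B a Ns p xb \<le> Q.obj x u"
proof -
  have "xb \<in> carrier_vec nx" using assms by (auto simp: mpc_feas_def)
  then obtain y v where "Q_opt nx nu H f c A B a Ns p xb y v" using Q_opt_exists by blast
  thus ?thesis using Q_val_opt assms unfolding Q_opt_def mpc_opt_def by metis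
qed

lemma Q_affine_solution:
  "\<exists>Kx kx Ku ku.
     (\<forall>t\<le>Ns p. Kx t \<in> carrier_mat nx nx \<and> kx t \<in> carrier_vec nx) \<and>
     (\<forall>t<Ns p. Ku t \<in> carrier_mat (nu (tau Ns p + t)) nx \<and> ku t \<in> carrier_vec (nu (tau Ns p + t))) \<and>
     (\<forall>xb \<in> carrier_vec nx.
        (\<forall>x u. Q_opt nx nu H f c A B a Ns p xb x u \<longleftrightarrow>
           (\<forall>t\<le>Ns p. x t = Kx t *\<^sub>v xb + kx t) \<and>
           (\<forall>t<Ns p. u t = Ku t *\<^sub>v xb + ku t)))"
  using Q.eopt_affine_solution[OF affine_dep_const[OF zero_carrier_vec] affine_dep_id
      affine_dep_const[OF zero_carrier_vec] Q.eopt_free_exists[OF zero_carrier_vec]]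
  unfolding Q_opt_iff shift_def .

lemma Q_value_quadratic:
  "\<exists>M g k. M \<in> carrier_mat nx nx \<and> g \<in> carrier_vec nx \<and> sym_mat M \<and> psd_mat nx M \<and>
     (\<forall>xb \<in> carrier_vec nx. Q_val nx nu H f c A B a Ns p xb = quad M g k xb)"
  using Q.value_psd_quadratic[OF affine_dep_id affine_dep_const[OF zero_carrier_vec]
      Q.eopt_free_exists[OF zero_carrier_vec]]
  unfolding Q_val_eq psd_quadratic_def .

lemma value_functions_quadratic:
  "\<exists>Hh fh ch.
     (\<forall>i<p. Hh i \<in> carrier_mat (nx + dim_col (T i)) (nx + dim_col (T i)) \<and>
            fh i \<in> carrier_vec (nx + dim_col (T i)) \<and>
            sym_mat (Hh i) \<and> psd_mat (nx + dim_col (T i)) (Hh i) \<and>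
            (\<forall>xb \<in> carrier_vec nx. \<forall>db \<in> carrier_vec (dim_col (T i)).
               P_val nx nu H f c A B a Ns T i xb db = quad (Hh i) (fh i) (ch i) (xb @\<^sub>v db))) \<and>
     Hh p \<in> carrier_mat nx nx \<and> fh p \<in> carrier_vec nx \<and> sym_mat (Hh p) \<and> psd_mat nx (Hh p) \<and>
     (\<forall>xb \<in> carrier_vec nx. Q_val nx nu H f c A B a Ns p xb = quad (Hh p) (fh p) (ch p) xb)"
proof -
  define R where "R i M g k \<longleftrightarrow> M \<in> carrier_mat (nx + dim_col (T i)) (nx + dim_col (T i)) \<and>
            g \<in> carrier_vec (nx + dim_col (T i)) \<and> sym_mat M \<and> psd_mat (nx + dim_col (T i)) M \<and>
            (\<forall>xb \<in> carrier_vec nx. \<forall>db \<in> carrier_vec (dim_col (T i)).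
               P_val nx nu H f c A B a Ns T i xb db = quad M g k (xb @\<^sub>v db))" for i M g k
  have "\<forall>i. i < p \<longrightarrow> (\<exists>M g k. R i M g k)"
    unfolding R_def using split_block.P_value_quadratic[OF block_locale] by simp
  then obtain Hh fh ch where R: "\<And>i. i < p \<Longrightarrow> R i (Hh i) (fh i) (ch i)" by metis
  obtain M g k where Q: "M \<in> carrier_mat nx nx" "g \<in> carrier_vec nx" "sym_mat M" "psd_mat nx M"
     "\<forall>xb \<in> carrier_vec nx. Q_val nx nu H f c A B a Ns p xb = quad M g k xb"
    using Q_value_quadratic by (elim exE conjE)
  \<comment> \<open>The inner blocks use only indices below \<open>p\<close>, so the last value
    function can be stored at \<open>p\<close>.\<close>
  have "\<forall>i<p. R i ((Hh(p := M)) i) ((fh(p := g)) i) ((ch(p := k)) i)" using R by simp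
  thus ?thesis unfolding R_def
    by (intro exI[of _ "Hh(p := M)"] exI[of _ "fh(p := g)"] exI[of _ "ch(p := k)"] conjI) (simp_all add: Q)
qed

section \<open>Cutting and stitching trajectories\<close>

lemma obj_blocks:
  "obj x u = (\<Sum>i<p. P_obj H f c Ns i (shift (tau Ns i) x) (shift (tau Ns i) u)) +
     Q.obj (shift (tau Ns p) x) (shift (tau Ns p) u)"
proof -
  have "(\<Sum>t<N. stage_cost (H t) (f t) (c t) (x t) (u t)) =
    (\<Sum>i<Suc p. stages_obj (Ns i) (shift (tau Ns i) H) (shift (tau Ns i) f) (shift (tau Ns i) c)
      (shift (tau Ns i) x) (shift (tau Ns i) u))"
    unfolding tau_last(1)[symmetric] sum_blocks stages_obj_def shift_def ..
  thus ?thesis by (simp add: mpc_obj_def P_obj_def stages_obj_def[of N] shift_def tau_last(2))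
qed

abbreviation "block_feas i \<equiv> mpc_feas nx (shift (tau Ns i) nu) (Ns i) (shift (tau Ns i) A) (shift (tau Ns i) B) (shift (tau Ns i) a)"

lemma feas_blocks:
  "feas x0 x u \<longleftrightarrow> x 0 = x0 \<and> (\<forall>i\<le>p. block_feas i (x (tau Ns i)) (shift (tau Ns i) x) (shift (tau Ns i) u))"
proof -
  define R where "R t \<longleftrightarrow> x t \<in> carrier_vec nx \<and> u t \<in> carrier_vec (nu t) \<and>
    x (Suc t) = A t *\<^sub>v x t + B t *\<^sub>v u t + a t" for t
  have f: "feas x0 x u \<longleftrightarrow> x 0 = x0 \<and> x N \<in> carrier_vec nx \<and> (\<forall>i<Suc p. \<forall>s<Ns i. R (tau Ns i + s))"
    unfolding mpc_feas_alt R_def[symmetric] all_blocks[symmetric] tau_last(1) ..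
  have b: "block_feas i (x (tau Ns i)) (shift (tau Ns i) x) (shift (tau Ns i) u) \<longleftrightarrow>
    x (tau Ns i + Ns i) \<in> carrier_vec nx \<and> (\<forall>s<Ns i. R (tau Ns i + s))" for i
    by (simp add: mpc_feas_alt shift_def R_def)
  have "x (tau Ns i + Ns i) \<in> carrier_vec nx" if "feas x0 x u" "i \<le> p" for i
    using that tau_le by (simp add: mpc_feas_def)
  moreover have "x (tau Ns p + Ns p) \<in> carrier_vec nx \<Longrightarrow> x N \<in> carrier_vec nx" by (simp add: tau_last)
  ultimately show ?thesis unfolding b using f by (auto simp: less_Suc_eq_le)
qed

abbreviation "PO \<equiv> P_opt nx nu H f c A B a Ns T"
abbreviation "QO \<equiv> Q_opt nx nu H f c A B a Ns p"
abbreviation "MF \<equiv> master_feas nx A a Ns T p xbar"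
abbreviation "MO \<equiv> master_obj nx nu H f c A B a Ns T p"

text \<open>States are prescribed up to \<open>t = Ns i\<close>, so each interface state is fixed
  twice, each input once. Indices beyond the horizon stay free.\<close>

definition stitched where
  "stitched xs us x u \<longleftrightarrow> (\<forall>i\<le>p. \<forall>t\<le>Ns i. x (tau Ns i + t) = xs i t) \<and> (\<forall>i\<le>p. \<forall>t<Ns i. u (tau Ns i + t) = us i t)"

text \<open>Cutting: each piece is feasible for its own subproblem with a suitable parameter, and
  costs at least the value there.\<close>

lemma master_of_feas:
  assumes x: "feas xbar x u"
  shows "\<exists>xh uh. MF xh uh \<and> MO xh uh \<le> obj x u"
proof -
  have b: "block_feas i (x (tau Ns i)) (shift (tau Ns i) x) (shift (tau Ns i) u)" if "i \<le> p" for i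
    using x that unfolding feas_blocks by blast
  have "\<forall>i. \<exists>d. i < p \<longrightarrow> d \<in> carrier_vec (dim_col (T i)) \<and>
     P_feas nx nu A B a Ns T i (x (tau Ns i)) d (shift (tau Ns i) x) (shift (tau Ns i) u)"
    using split_block.P_reach[OF block_locale b] by (metis less_imp_le)
  then obtain uh where uh: "\<And>i. i < p \<Longrightarrow> uh i \<in> carrier_vec (dim_col (T i))"
    "\<And>i. i < p \<Longrightarrow> P_feas nx nu A B a Ns T i (x (tau Ns i)) (uh i) (shift (tau Ns i) x) (shift (tau Ns i) u)"
    by metis
  have "MF (\<lambda>i. x (tau Ns i)) uh"
    unfolding master_feas_def mpc_feas_def
  proof (intro conjI allI impI)
    show "x (tau Ns i) \<in> carrier_vec nx" if "i \<le> p" for i using x tau_le[OF that] by (simp add: mpc_feas_def)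
    show "x (tau Ns 0) = xbar" using x by (simp add: tau_def mpc_feas_def)
    show "x (tau Ns (Suc i)) = blkAcal nx A Ns i *\<^sub>v x (tau Ns i) + T i *\<^sub>v uh i + blkDa nx A a Ns i" if "i < p" for i
      using uh(2)[OF that] by (simp add: P_feas_def shift_def tau_Suc)
  qed (rule uh)
  moreover have "MO (\<lambda>i. x (tau Ns i)) uh \<le> obj x u"
    unfolding master_obj_def obj_blocks
    by (intro add_mono sum_mono Q_val_le b order_refl split_block.P_val_le[OF block_locale] uh) auto
  ultimately show ?thesis by blast
qed

lemma stitch_states:
  assumes m: "MF xh uh" and P: "\<And>i. i < p \<Longrightarrow> PO i (xh i) (uh i) (xs i) (us i)" and Q: "QO (xh p) (xs p) (us p)"
    and i: "i < p"
  shows "xs i (Ns i) = xs (Suc i) 0" "xs i (Ns i) = xh (Suc i)"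
proof -
  have "xs j 0 = xh j" if "j \<le> p" for j
  proof (cases "j = p")
    case True
    thus ?thesis using Q by (simp add: Q_opt_def mpc_opt_def mpc_feas_def)
  next
    case False
    thus ?thesis using P[of j] that by (simp add: P_opt_def P_feas_def mpc_feas_def)
  qed
  moreover show "xs i (Ns i) = xh (Suc i)"
    using P[OF i] m i by (simp add: P_opt_def P_feas_def master_feas_def mpc_feas_def)
  ultimately show "xs i (Ns i) = xs (Suc i) 0" using i by simp
qed

lemma stitch_exists:
  assumes "MF xh uh" "\<And>i. i < p \<Longrightarrow> PO i (xh i) (uh i) (xs i) (us i)" "QO (xh p) (xs p) (us p)"
  shows "\<exists>x u. stitched xs us x u"
proof -
  obtain x where "\<forall>i\<le>p. \<forall>t\<le>Ns i. x (tau Ns i + t) = xs i t"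
    using glue_states[of p xs Ns] stitch_states(1)[OF assms] by blast
  moreover obtain u where "\<forall>i\<le>p. \<forall>t<Ns i. u (tau Ns i + t) = us i t"
    using glue_inputs by blast
  ultimately show ?thesis unfolding stitched_def by blast
qed

text \<open>Stitching loses nothing, because every piece attains the value of its
  subproblem.\<close>

lemma stitch_feas_obj:
  assumes m: "MF xh uh" and P: "\<And>i. i < p \<Longrightarrow> PO i (xh i) (uh i) (xs i) (us i)" and Q: "QO (xh p) (xs p) (us p)"
    and st: "stitched xs us x u"
  shows "feas xbar x u" "obj x u = MO xh uh"
proof -
  have e: "t \<le> Ns i \<Longrightarrow> shift (tau Ns i) x t = xs i t" "t < Ns i \<Longrightarrow> shift (tau Ns i) u t = us i t"
    if "i \<le> p" for i t using st that by (auto simp: stitched_def shift_def)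
  have bf: "block_feas i (xh i) (xs i) (us i)" if "i \<le> p" for i
  proof (cases "i = p")
    case True
    thus ?thesis using Q by (simp add: Q_opt_def mpc_opt_def)
  next
    case False
    thus ?thesis using P[of i] that by (simp add: P_opt_def P_feas_def)
  qed
  have x0: "x (tau Ns i) = xh i" if "i \<le> p" for i
    using e(1)[OF that, of 0] bf[OF that] by (simp add: shift_def mpc_feas_def)
  show "feas xbar x u" unfolding feas_blocks
  proof (intro conjI allI impI)
    show "x 0 = xbar" using x0[of 0] m by (simp add: tau_def master_feas_def mpc_feas_def)
    show "block_feas i (x (tau Ns i)) (shift (tau Ns i) x) (shift (tau Ns i) u)" if "i \<le> p" for i
      unfolding x0[OF that] using bf[OF that]
      by (subst mpc_feas_cong[where x = "xs i" and u = "us i"]) (use e[OF that] in auto)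
  qed
  have "P_obj H f c Ns i (shift (tau Ns i) x) (shift (tau Ns i) u) = P_val nx nu H f c A B a Ns T i (xh i) (uh i)"
    if "i < p" for i
    using split_block.P_val_opt[OF block_locale[OF that] P[OF that]] e[of i] that
    by (simp add: P_obj_def stages_obj_def)
  moreover have "Q.obj (shift (tau Ns p) x) (shift (tau Ns p) u) = Q.obj (xs p) (us p)"
    by (rule mpc_obj_cong) (use e[of p] in auto)
  ultimately show "obj x u = MO xh uh"
    unfolding obj_blocks master_obj_def Q_val_opt[OF Q] by simp
qed

lemma block_optima_exist:
  assumes m: "MF xh uh"
  shows "\<exists>xs us. (\<forall>i<p. PO i (xh i) (uh i) (xs i) (us i)) \<and> QO (xh p) (xs p) (us p)"
proof -
  have c: "xh i \<in> carrier_vec nx" if "i \<le> p" for i using m that by (simp add: master_feas_def mpc_feas_def)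
  have d: "uh i \<in> carrier_vec (dim_col (T i))" if "i < p" for i using m that by (simp add: master_feas_def mpc_feas_def)
  have "\<forall>i. \<exists>x u. i < p \<longrightarrow> PO i (xh i) (uh i) x u"
    using split_block.P_opt_exists[OF block_locale c d] by (metis less_imp_le)
  then obtain xs us where P: "\<And>i. i < p \<Longrightarrow> PO i (xh i) (uh i) (xs i) (us i)" by metis
  obtain x u where Q: "QO (xh p) x u" using Q_opt_exists[OF c[OF order_refl]] by blast
  have "(\<forall>i<p. PO i (xh i) (uh i) ((xs(p := x)) i) ((us(p := u)) i)) \<and> QO (xh p) ((xs(p := x)) p) ((us(p := u)) p)"
    using P Q by simp
  thus ?thesis by blast
qed

lemma feas_of_master:
  assumes "MF xh uh"
  shows "\<exists>x u. feas xbar x u \<and> obj x u = MO xh uh"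
proof -
  obtain xs us where P: "\<And>i. i < p \<Longrightarrow> PO i (xh i) (uh i) (xs i) (us i)" and Q: "QO (xh p) (xs p) (us p)"
    using block_optima_exist[OF assms] by blast
  obtain x u where "stitched xs us x u" using stitch_exists[OF assms P Q] by blast
  from stitch_feas_obj[OF assms P Q this] show ?thesis by blast
qed

text \<open>The full problem attains its value; cutting its optimum gives a master point of at most
  that cost, and stitching excludes a smaller one.\<close>

lemma master_val_eq: "master_val nx nu H f c A B a Ns T p xbar = mpc_val nx nu N H f c A B a xbar"
proof -
  obtain x u where o: "mpc_opt nx nu N H f c A B a xbar x u"
    using eopt_free_exists[OF zero_carrier_vec xbar_carrier] eopt_free by blast
  hence fx: "feas xbar x u" and le: "\<And>x' u'. feas xbar x' u' \<Longrightarrow> obj x u \<le> obj x' u'" by (auto simp: mpc_opt_def)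
  have "mpc_val nx nu N H f c A B a xbar = obj x u"
    unfolding mpc_val_def by (rule cInf_eq_minimum) (use fx le in auto)
  moreover have "master_val nx nu H f c A B a Ns T p xbar = obj x u"
    unfolding master_val_def
  proof (rule cInf_eq_minimum)
    have ge: "obj x u \<le> MO xh uh" if "MF xh uh" for xh uh
      using feas_of_master[OF that] le by metis
    thus "obj x u \<le> r" if "r \<in> {MO xh uh | xh uh. MF xh uh}" for r using that by auto
    obtain xh uh where "MF xh uh" "MO xh uh \<le> obj x u" using master_of_feas[OF fx] by blast
    thus "obj x u \<in> {MO xh uh | xh uh. MF xh uh}" using ge[of xh uh] by (intro CollectI exI[of _ xh] exI[of _ uh]) simp
  qed
  ultimately show ?thesis by simp
qed

text \<open>A stitched trajectory is optimal since any competitor can be cut. The converse uses that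
  the optimum of the full problem is unique on the horizon.\<close>

lemma master_opt_stitched:
  assumes m: "master_opt nx nu H f c A B a Ns T p xbar xh uh"
    and P: "\<And>i. i < p \<Longrightarrow> PO i (xh i) (uh i) (xs i) (us i)" and Q: "QO (xh p) (xs p) (us p)"
  shows "mpc_opt nx nu N H f c A B a xbar x u \<longleftrightarrow> stitched xs us x u"
proof -
  have mf: "MF xh uh" and mo: "\<And>xh' uh'. MF xh' uh' \<Longrightarrow> MO xh uh \<le> MO xh' uh'"
    using m by (auto simp: master_opt_def)
  have opt: "mpc_opt nx nu N H f c A B a xbar y v" if st: "stitched xs us y v" for y v
    unfolding mpc_opt_def
  proof (intro conjI allI impI)
    note s = stitch_feas_obj[OF mf P Q st]
    show "feas xbar y v" by (rule s)
    fix x' u' assume "feas xbar x' u'"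
    from master_of_feas[OF this] obtain xh' uh' where "MF xh' uh'" "MO xh' uh' \<le> obj x' u'" by blast
    thus "obj y v \<le> obj x' u'" using mo[of xh' uh'] s(2) by simp
  qed
  show ?thesis
  proof
    assume o: "mpc_opt nx nu N H f c A B a xbar x u"
    obtain y v where st: "stitched xs us y v" using stitch_exists[OF mf P Q] by blast
    from eopt_unique[OF eopt_free[where xT = xbar, THEN iffD1, OF opt[OF st]]
        eopt_free[where xT = xbar, THEN iffD1, OF o] zero_carrier_vec]
    have e: "t \<le> N \<Longrightarrow> x t = y t" "t < N \<Longrightarrow> u t = v t" for t by blast+
    show "stitched xs us x u" unfolding stitched_def
    proof (intro conjI allI impI)
      fix i t assume i: "i \<le> p"
      show "x (tau Ns i + t) = xs i t" if "t \<le> Ns i"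
        using e(1)[of "tau Ns i + t"] tau_le[OF i] that st i by (simp add: stitched_def)
      show "u (tau Ns i + t) = us i t" if "t < Ns i"
        using e(2)[of "tau Ns i + t"] tau_le[OF i] that st i by (simp add: stitched_def)
    qed
  qed (rule opt)
qed

section \<open>Costates of the blocks and of the full horizon\<close>

lemma master_costates:
  assumes Hh: "\<forall>i<p. Hh i \<in> carrier_mat (nx + dim_col (T i)) (nx + dim_col (T i)) \<and>
             fh i \<in> carrier_vec (nx + dim_col (T i)) \<and> sym_mat (Hh i) \<and>
             (\<forall>xb \<in> carrier_vec nx. \<forall>db \<in> carrier_vec (dim_col (T i)).
                P_val nx nu H f c A B a Ns T i xb db = quad (Hh i) (fh i) (ch i) (xb @\<^sub>v db))"
    and Hp: "Hh p \<in> carrier_mat nx nx" "fh p \<in> carrier_vec nx" "sym_mat (Hh p)"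
      "\<forall>xb \<in> carrier_vec nx. Q_val nx nu H f c A B a Ns p xb = quad (Hh p) (fh p) (ch p) xb"
    and kkt: "mpc_kkt nx (\<lambda>i. dim_col (T i)) p Hh fh (blkAcal nx A Ns) T (blkDa nx A a Ns) xbar xh uh lh"
    and P: "\<And>i. i < p \<Longrightarrow> PO i (xh i) (uh i) (xs i) (us i)" and Q: "QO (xh p) (xs p) (us p)"
  shows "\<And>i. i < p \<Longrightarrow> \<exists>lam. P_kkt nx nu H f A B a Ns T i (xh i) (uh i) (xs i) (us i) lam (- lh (Suc i)) \<and> lam 0 = lh i"
    and "\<exists>lam. Q_kkt nx nu H f A B a Ns p (xh p) (xs p) (us p) lam \<and> lam 0 = lh p"
proof -
  \<comment> \<open>\<open>lh\<close> starts with the multiplier of the initial condition, so its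
    indices are one above those of the multipliers in the informal statement:
    \<open>lh (Suc i)\<close> belongs to the \<open>i\<close>-th master dynamics.\<close>
  have lh: "lh i \<in> carrier_vec nx" if "i \<le> p" for i using kkt that by (simp add: mpc_kkt_def)
  have uh: "uh i \<in> carrier_vec (dim_col (T i))" if "i < p" for i using kkt that by (simp add: mpc_kkt_def mpc_feas_def)
  have xhp: "xh p \<in> carrier_vec nx" using kkt by (simp add: mpc_kkt_def mpc_feas_def)
  show "\<exists>lam. P_kkt nx nu H f A B a Ns T i (xh i) (uh i) (xs i) (us i) lam (- lh (Suc i)) \<and> lam 0 = lh i"
    if i: "i < p" for i
  proof -
    have l: "lh i \<in> carrier_vec nx" "lh (Suc i) \<in> carrier_vec nx" using lh i by auto
    have st: "vec_first (Hh i *\<^sub>v (xh i @\<^sub>v uh i) + fh i) nx - lh i + transpose_mat (blkAcal nx A Ns i) *\<^sub>v lh (Suc i) = 0\<^sub>v nx"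
      "vec_last (Hh i *\<^sub>v (xh i @\<^sub>v uh i) + fh i) (dim_col (T i)) + transpose_mat (T i) *\<^sub>v lh (Suc i) = 0\<^sub>v (dim_col (T i))"
      using kkt i unfolding mpc_kkt_def stage_stat_def by blast+
    have V: "P_val nx nu H f c A B a Ns T i xb db = quad (Hh i) (fh i) (ch i) (xb @\<^sub>v db)"
      if "xb \<in> carrier_vec nx" "db \<in> carrier_vec (dim_col (T i))" for xb db
      using Hh i that by blast
    have M: "Hh i \<in> carrier_mat (nx + dim_col (T i)) (nx + dim_col (T i))" "sym_mat (Hh i)"
      "fh i \<in> carrier_vec (nx + dim_col (T i))" using Hh i by blast+
    obtain lam where lam: "\<forall>t\<le>Ns i. lam t \<in> carrier_vec nx"
      "stage_stat nx (shift (tau Ns i) nu) (Ns i) (shift (tau Ns i) H) (shift (tau Ns i) f)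
        (shift (tau Ns i) A) (shift (tau Ns i) B) (xs i) (us i) lam" "lam (Ns i) = lh (Suc i)" "lam 0 = lh i"
      using split_block.P_costate[OF block_locale[OF i] P[OF i] uh[OF i] M V l st] by blast
    have "P_feas nx nu A B a Ns T i (xh i) (uh i) (xs i) (us i)" using P[OF i] by (simp add: P_opt_def)
    \<comment> \<open>Stationarity of the block in its terminal state; this equation is where the
      minus sign of the terminal multiplier comes from.\<close>
    moreover have "- lh (Suc i) - - lh (Suc i) = 0\<^sub>v nx" using l by simp
    ultimately have "P_kkt nx nu H f A B a Ns T i (xh i) (uh i) (xs i) (us i) lam (- lh (Suc i))"
      unfolding P_kkt_def using lam l by simp
    thus ?thesis using lam(4) by blast
  qed
  have V: "Inf {Q.obj x u | x u. Q.feas xb x u} = quad (Hh p) (fh p) (ch p) xb" if "xb \<in> carrier_vec nx" for xb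
    using Hp(4)[rule_format, OF that] unfolding Q_val_eq by (simp add: Q.efeas_def)
  obtain lam where lam: "\<forall>t\<le>Ns p. lam t \<in> carrier_vec nx"
      "stage_stat nx (shift (tau Ns p) nu) (Ns p) (shift (tau Ns p) H) (shift (tau Ns p) f)
        (shift (tau Ns p) A) (shift (tau Ns p) B) (xs p) (us p) lam"
      "lam (Ns p) = shift (tau Ns p) H (Ns p) *\<^sub>v xs p (Ns p) + shift (tau Ns p) f (Ns p)"
      "lam 0 = Hh p *\<^sub>v xh p + fh p"
    using Q.free_costate_exists[OF Q[unfolded Q_opt_iff] Hp(1,3,2) V] by blast
  have "lam (Ns p) \<in> carrier_vec nx" using lam(1) by simp
  hence "Q_kkt nx nu H f A B a Ns p (xh p) (xs p) (us p) lam"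
    using lam(1,2) Q unfolding Q_kkt_def mpc_kkt_def Q_opt_def mpc_opt_def lam(3)[symmetric] by simp
  \<comment> \<open>Stationarity of the master problem in its last state equates the slope of the
    last value function with \<open>lh p\<close>.\<close>
  moreover have "Hh p *\<^sub>v xh p + fh p = lh p"
  proof (rule vec_eq_of_diff_zero)
    show "Hh p *\<^sub>v xh p + fh p - lh p = 0\<^sub>v nx" using kkt by (simp add: mpc_kkt_def)
    show "Hh p *\<^sub>v xh p + fh p \<in> carrier_vec nx"
      by (intro add_carrier_vec mult_mat_vec_carrier[OF Hp(1)] xhp Hp(2))
  qed (rule lh[OF order_refl])
  ultimately show "\<exists>lam. Q_kkt nx nu H f A B a Ns p (xh p) (xs p) (us p) lam \<and> lam 0 = lh p"
    using lam(4) by auto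
qed

text \<open>Fixing the terminal multiplier fixes the last costate and thereby all of them; left
  free, it may be ambiguous.\<close>

lemma P_kkt_unique:
  assumes i: "i < p"
    and k: "P_kkt nx nu H f A B a Ns T i xb db x u lam (- l)" "P_kkt nx nu H f A B a Ns T i xb db x u lam' (- l)"
    and l: "l \<in> carrier_vec nx" and t: "t \<le> Ns i"
  shows "lam t = lam' t" "lam (Ns i) = l"
proof -
  have eq: "p = l" if "- p - - l = 0\<^sub>v nx" "p \<in> carrier_vec nx" for p :: "real vec"
  proof (rule eq_vecI)
    fix j assume "j < dim_vec l"
    thus "p $ j = l $ j" using arg_cong[OF that(1), of "\<lambda>v. v $ j"] that(2) l by auto
  qed (use that l in auto)
  have c: "lam t \<in> carrier_vec nx" "lam' t \<in> carrier_vec nx" if "t \<le> Ns i" for t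
    using k that by (simp_all add: P_kkt_def)
  show N: "lam (Ns i) = l" using k(1) c(1)[OF order_refl] by - (rule eq, simp_all add: P_kkt_def)
  have N': "lam' (Ns i) = l" using k(2) c(2)[OF order_refl] by - (rule eq, simp_all add: P_kkt_def)
  have A: "shift (tau Ns i) A s \<in> carrier_mat nx nx" if "s < Ns i" for s
    using A_carrier tau_le[of i] i that by (simp add: shift_def)
  have st: "stage_stat nx (shift (tau Ns i) nu) (Ns i) (shift (tau Ns i) H) (shift (tau Ns i) f)
      (shift (tau Ns i) A) (shift (tau Ns i) B) x u lam"
    "stage_stat nx (shift (tau Ns i) nu) (Ns i) (shift (tau Ns i) H) (shift (tau Ns i) f)
      (shift (tau Ns i) A) (shift (tau Ns i) B) x u lam'"
    using k by (simp_all add: P_kkt_def)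
  show "lam t = lam' t"
    by (rule costate_unique[OF st c A _ t]) (simp_all add: N N')
qed

lemma mpc_kkt_unique:
  assumes k: "mpc_kkt nx nu N H f A B a x0 x u lam" "mpc_kkt nx nu N H f A B a x0 x u lam'" and t: "t \<le> N"
  shows "lam t = lam' t"
proof -
  have c: "lam t \<in> carrier_vec nx" "lam' t \<in> carrier_vec nx" if "t \<le> N" for t
    using k that by (simp_all add: mpc_kkt_def)
  have "x N \<in> carrier_vec nx" using k(1) by (simp add: mpc_kkt_def mpc_feas_def)
  hence g: "H N *\<^sub>v x N + f N \<in> carrier_vec nx"
    by (intro add_carrier_vec mult_mat_vec_carrier[OF HN_carrier] fN_carrier)
  have "H N *\<^sub>v x N + f N = lam N" "H N *\<^sub>v x N + f N = lam' N"
    by (rule vec_eq_of_diff_zero[OF _ g c(1)[OF order_refl]], use k in \<open>simp add: mpc_kkt_def\<close>)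
      (rule vec_eq_of_diff_zero[OF _ g c(2)[OF order_refl]], use k in \<open>simp add: mpc_kkt_def\<close>)
  hence N: "lam N = lam' N" by simp
  have st: "stage_stat nx nu N H f A B x u lam" "stage_stat nx nu N H f A B x u lam'"
    using k by (simp_all add: mpc_kkt_def)
  show ?thesis by (rule costate_unique[OF st c A_carrier N t])
qed

text \<open>Stationarity at stage \<open>t\<close> involves \<open>lam (Suc t)\<close>, which at the
  end of a block is the interface costate. As both neighbours agree on it, stationarity can be
  checked block by block; the converse is uniqueness of the multipliers.\<close>

lemma stitched_kkt:
  assumes x: "feas xbar x u" and st: "stitched xs us x u"
    and stat: "\<And>i. i \<le> p \<Longrightarrow> stage_stat nx (shift (tau Ns i) nu) (Ns i) (shift (tau Ns i) H) (shift (tau Ns i) f)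
      (shift (tau Ns i) A) (shift (tau Ns i) B) (xs i) (us i) (lb i)"
    and c: "\<And>i t. i \<le> p \<Longrightarrow> t \<le> Ns i \<Longrightarrow> lb i t \<in> carrier_vec nx"
    and lp: "H N *\<^sub>v xs p (Ns p) + f N - lb p (Ns p) = 0\<^sub>v nx"
    and glue: "\<And>i. i < p \<Longrightarrow> lb i (Ns i) = lb (Suc i) 0"
  shows "mpc_kkt nx nu N H f A B a xbar x u lam \<longleftrightarrow> (\<forall>i\<le>p. \<forall>t\<le>Ns i. lam (tau Ns i + t) = lb i t)"
proof -
  have e: "t \<le> Ns i \<Longrightarrow> x (tau Ns i + t) = xs i t" "t < Ns i \<Longrightarrow> u (tau Ns i + t) = us i t"
    if "i \<le> p" for i t using st that by (auto simp: stitched_def)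
  have kkt: "mpc_kkt nx nu N H f A B a xbar x u lam"
    if lam: "\<And>i t. i \<le> p \<Longrightarrow> t \<le> Ns i \<Longrightarrow> lam (tau Ns i + t) = lb i t" for lam
    unfolding mpc_kkt_def
  proof (intro conjI)
    have N: "x N = xs p (Ns p)" "lam N = lb p (Ns p)" using e(1)[of p "Ns p"] lam[of p "Ns p"] by (simp_all add: tau_last)
    show "H N *\<^sub>v x N + f N - lam N = 0\<^sub>v nx" unfolding N by (rule lp)
    have "\<forall>t<tau Ns (Suc p). lam t \<in> carrier_vec nx" unfolding all_blocks using lam c by simp
    thus "\<forall>t\<le>N. lam t \<in> carrier_vec nx" using N(2) c[of p "Ns p"] by (simp add: tau_last le_less)
    show "stage_stat nx nu N H f A B x u lam"
      unfolding stage_stat_def tau_last(1)[symmetric] all_blocks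
    proof (intro allI impI)
      fix i s assume i: "i < Suc p" and s: "s < Ns i"
      have "lam (Suc (tau Ns i + s)) = lb i (Suc s)" using lam[of i "Suc s"] i s by simp
      thus "vec_first (H (tau Ns i + s) *\<^sub>v (x (tau Ns i + s) @\<^sub>v u (tau Ns i + s)) + f (tau Ns i + s)) nx - lam (tau Ns i + s) +
          transpose_mat (A (tau Ns i + s)) *\<^sub>v lam (Suc (tau Ns i + s)) = 0\<^sub>v nx \<and>
        vec_last (H (tau Ns i + s) *\<^sub>v (x (tau Ns i + s) @\<^sub>v u (tau Ns i + s)) + f (tau Ns i + s)) (nu (tau Ns i + s)) +
          transpose_mat (B (tau Ns i + s)) *\<^sub>v lam (Suc (tau Ns i + s)) = 0\<^sub>v (nu (tau Ns i + s))"
        using stat[of i] e[of i s] lam[of i s] i s by (simp add: stage_stat_def shift_def)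
    qed
  qed (rule x)
  show ?thesis
  proof
    assume k: "mpc_kkt nx nu N H f A B a xbar x u lam"
    obtain lam' where lam': "\<forall>i\<le>p. \<forall>t\<le>Ns i. lam' (tau Ns i + t) = lb i t"
      using glue_states[of p lb Ns] glue by blast
    hence "mpc_kkt nx nu N H f A B a xbar x u lam'" by (intro kkt) simp
    from mpc_kkt_unique[OF k this] show "\<forall>i\<le>p. \<forall>t\<le>Ns i. lam (tau Ns i + t) = lb i t"
      using lam' tau_le by (metis add_le_cancel_left order_trans)
  qed (use kkt in simp)
qed

text \<open>Any admissible choice of block multipliers equals the constructed one, so the interface
  identities transfer to it.\<close>

lemma stitched_multipliers:
  assumes m: "MF xh uh" and lh: "\<And>i. i \<le> p \<Longrightarrow> lh i \<in> carrier_vec nx"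
    and P: "\<And>i. i < p \<Longrightarrow> PO i (xh i) (uh i) (xs i) (us i)" and Q: "QO (xh p) (xs p) (us p)"
    and exP: "\<And>i. i < p \<Longrightarrow> \<exists>lam. P_kkt nx nu H f A B a Ns T i (xh i) (uh i) (xs i) (us i) lam (- lh (Suc i)) \<and> lam 0 = lh i"
    and exQ: "\<exists>lam. Q_kkt nx nu H f A B a Ns p (xh p) (xs p) (us p) lam \<and> lam 0 = lh p"
    and lb: "\<And>i. i < p \<Longrightarrow> P_kkt nx nu H f A B a Ns T i (xh i) (uh i) (xs i) (us i) (lb i) (- lh (Suc i))"
      "Q_kkt nx nu H f A B a Ns p (xh p) (xs p) (us p) (lb p)"
  shows "lb 0 0 = lh 0" "\<And>i. i < p \<Longrightarrow> lb i (Ns i) = lh (Suc i) \<and> lb (Suc i) 0 = lh (Suc i)"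
    "stitched xs us x u \<Longrightarrow> mpc_kkt nx nu N H f A B a xbar x u lam \<longleftrightarrow>
       (\<forall>i\<le>p. \<forall>t\<le>Ns i. lam (tau Ns i + t) = lb i t)"
proof -
  have l0: "lb i 0 = lh i" if "i \<le> p" for i
  proof (cases "i = p")
    case True
    obtain lam where lam: "Q_kkt nx nu H f A B a Ns p (xh p) (xs p) (us p) lam" "lam 0 = lh p" using exQ by blast
    have "lb p 0 = lam 0"
    proof -
      \<comment> \<open>The last block viewed as a split into a single block, \<open>p = 0\<close>:
        uniqueness of the multipliers of a full horizon then applies to it.\<close>
      interpret R: mpc_split nx "shift (tau Ns p) nu" "Ns p" "shift (tau Ns p) H" "shift (tau Ns p) f" "shift (tau Ns p) c"
        "shift (tau Ns p) A" "shift (tau Ns p) B" "shift (tau Ns p) a" 0 "\<lambda>_. Ns p" T xbar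
        by unfold_locales (simp_all add: xbar_carrier)
      show ?thesis
        by (rule R.mpc_kkt_unique[OF lb(2)[unfolded Q_kkt_def] lam(1)[unfolded Q_kkt_def]]) simp
    qed
    thus ?thesis using lam(2) True by simp
  next
    case False
    hence i: "i < p" using that by simp
    obtain lam where lam: "P_kkt nx nu H f A B a Ns T i (xh i) (uh i) (xs i) (us i) lam (- lh (Suc i))" "lam 0 = lh i"
      using exP[OF i] by blast
    have "lb i 0 = lam 0" by (rule P_kkt_unique(1)[OF i lb(1)[OF i] lam(1) lh]) (use i in simp_all)
    thus ?thesis using lam(2) by simp
  qed
  show "lb 0 0 = lh 0" by (rule l0) simp
  have lN: "lb i (Ns i) = lh (Suc i)" if i: "i < p" for i
    by (rule P_kkt_unique(2)[OF i lb(1)[OF i] lb(1)[OF i] lh order_refl]) (use i in simp)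
  show "lb i (Ns i) = lh (Suc i) \<and> lb (Suc i) 0 = lh (Suc i)" if "i < p" for i
    using lN[OF that] l0[of "Suc i"] that by simp
  assume st: "stitched xs us x u"
  show "mpc_kkt nx nu N H f A B a xbar x u lam \<longleftrightarrow> (\<forall>i\<le>p. \<forall>t\<le>Ns i. lam (tau Ns i + t) = lb i t)"
  proof (rule stitched_kkt[OF stitch_feas_obj(1)[OF m P Q st] st])
    fix i assume i: "i \<le> p"
    show "stage_stat nx (shift (tau Ns i) nu) (Ns i) (shift (tau Ns i) H) (shift (tau Ns i) f)
      (shift (tau Ns i) A) (shift (tau Ns i) B) (xs i) (us i) (lb i)"
      using lb(1)[of i] lb(2) i by (cases "i = p") (simp_all add: P_kkt_def Q_kkt_def mpc_kkt_def)
    show "lb i t \<in> carrier_vec nx" if "t \<le> Ns i" for t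
      using lb(1)[of i] lb(2) i that by (cases "i = p") (simp_all add: P_kkt_def Q_kkt_def mpc_kkt_def)
  next
    show "H N *\<^sub>v xs p (Ns p) + f N - lb p (Ns p) = 0\<^sub>v nx"
      using lb(2) by (simp add: Q_kkt_def mpc_kkt_def shift_def tau_last)
    show "lb i (Ns i) = lb (Suc i) 0" if "i < p" for i using lN[OF that] l0[of "Suc i"] that by simp
  qed
qed

end

theorem theorem1:
  fixes nx N p :: nat and nu Ns :: "nat \<Rightarrow> nat"
    and A B H T :: "nat \<Rightarrow> real mat" and a f :: "nat \<Rightarrow> real vec" and c :: "nat \<Rightarrow> real"
    and xbar :: "real vec"
  assumes std: "mpc_std nx nu N H f A B a xbar"
    and N2: "N \<ge> 2"
    and p1: "1 \<le> p" and pN: "p < N"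
    and Ns_pos: "\<forall>i\<le>p. 1 \<le> Ns i"
    and Ns_sum: "(\<Sum>i\<le>p. Ns i) = N"
    and T_basis: "\<forall>i<p. col_basis nx (T i) (blkS_range nx nu A B Ns i)"
  shows
  \<comment> \<open>(a) feasibility, unique affine optimal solutions, quadratic convex value functions\<close>
   "((\<forall>i<p. \<exists>Kx kx Ku ku.
        (\<forall>t\<le>Ns i. Kx t \<in> carrier_mat nx (nx + dim_col (T i)) \<and> kx t \<in> carrier_vec nx) \<and>
        (\<forall>t<Ns i. Ku t \<in> carrier_mat (nu (tau Ns i + t)) (nx + dim_col (T i)) \<and>
                   ku t \<in> carrier_vec (nu (tau Ns i + t))) \<and>
        (\<forall>xb \<in> carrier_vec nx. \<forall>db \<in> carrier_vec (dim_col (T i)).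
           (\<exists>x u. P_feas nx nu A B a Ns T i xb db x u) \<and>
           (\<forall>x u. P_opt nx nu H f c A B a Ns T i xb db x u \<longleftrightarrow>
              (\<forall>t\<le>Ns i. x t = Kx t *\<^sub>v (xb @\<^sub>v db) + kx t) \<and>
              (\<forall>t<Ns i. u t = Ku t *\<^sub>v (xb @\<^sub>v db) + ku t)))) \<and>
    (\<exists>Kx kx Ku ku.
        (\<forall>t\<le>Ns p. Kx t \<in> carrier_mat nx nx \<and> kx t \<in> carrier_vec nx) \<and>
        (\<forall>t<Ns p. Ku t \<in> carrier_mat (nu (tau Ns p + t)) nx \<and> ku t \<in> carrier_vec (nu (tau Ns p + t))) \<and>
        (\<forall>xb \<in> carrier_vec nx.
           (\<forall>x u. Q_opt nx nu H f c A B a Ns p xb x u \<longleftrightarrow>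
              (\<forall>t\<le>Ns p. x t = Kx t *\<^sub>v xb + kx t) \<and>
              (\<forall>t<Ns p. u t = Ku t *\<^sub>v xb + ku t)))) \<and>
    (\<exists>Hh fh ch.
        (\<forall>i<p. Hh i \<in> carrier_mat (nx + dim_col (T i)) (nx + dim_col (T i)) \<and>
               fh i \<in> carrier_vec (nx + dim_col (T i)) \<and>
               sym_mat (Hh i) \<and> psd_mat (nx + dim_col (T i)) (Hh i) \<and>
               (\<forall>xb \<in> carrier_vec nx. \<forall>db \<in> carrier_vec (dim_col (T i)).
                  P_val nx nu H f c A B a Ns T i xb db = quad (Hh i) (fh i) (ch i) (xb @\<^sub>v db))) \<and>
        Hh p \<in> carrier_mat nx nx \<and> fh p \<in> carrier_vec nx \<and> sym_mat (Hh p) \<and> psd_mat nx (Hh p) \<and>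
        (\<forall>xb \<in> carrier_vec nx. Q_val nx nu H f c A B a Ns p xb = quad (Hh p) (fh p) (ch p) xb))) \<and>
  \<comment> \<open>(b) equivalence with the master problem MPC_p\<close>
   master_val nx nu H f c A B a Ns T p xbar = mpc_val nx nu N H f c A B a xbar \<and>
   (\<forall>xh uh. master_opt nx nu H f c A B a Ns T p xbar xh uh \<longrightarrow>
      (\<forall>xs us. (\<forall>i<p. P_opt nx nu H f c A B a Ns T i (xh i) (uh i) (xs i) (us i)) \<and>
               Q_opt nx nu H f c A B a Ns p (xh p) (xs p) (us p) \<longrightarrow>
         (\<forall>i<p. xs i (Ns i) = xs (Suc i) 0) \<and>
         (\<forall>x u. mpc_opt nx nu N H f c A B a xbar x u \<longleftrightarrow>
            (\<forall>i\<le>p. \<forall>t\<le>Ns i. x (tau Ns i + t) = xs i t) \<and>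
            (\<forall>i\<le>p. \<forall>t<Ns i. u (tau Ns i + t) = us i t)))) \<and>
  \<comment> \<open>(c) recovery of the multipliers\<close>
   (\<forall>Hh fh ch.
      (\<forall>i<p. Hh i \<in> carrier_mat (nx + dim_col (T i)) (nx + dim_col (T i)) \<and>
             fh i \<in> carrier_vec (nx + dim_col (T i)) \<and> sym_mat (Hh i) \<and>
             (\<forall>xb \<in> carrier_vec nx. \<forall>db \<in> carrier_vec (dim_col (T i)).
                P_val nx nu H f c A B a Ns T i xb db = quad (Hh i) (fh i) (ch i) (xb @\<^sub>v db))) \<and>
      Hh p \<in> carrier_mat nx nx \<and> fh p \<in> carrier_vec nx \<and> sym_mat (Hh p) \<and>
      (\<forall>xb \<in> carrier_vec nx. Q_val nx nu H f c A B a Ns p xb = quad (Hh p) (fh p) (ch p) xb) \<longrightarrow>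
    (\<forall>xh uh lh. master_opt nx nu H f c A B a Ns T p xbar xh uh \<and>
        mpc_kkt nx (\<lambda>i. dim_col (T i)) p Hh fh (blkAcal nx A Ns) T (blkDa nx A a Ns) xbar xh uh lh \<longrightarrow>
      (\<forall>xs us. (\<forall>i<p. P_opt nx nu H f c A B a Ns T i (xh i) (uh i) (xs i) (us i)) \<and>
               Q_opt nx nu H f c A B a Ns p (xh p) (xs p) (us p) \<longrightarrow>
         (\<forall>i<p. \<exists>lam lamtc. P_kkt nx nu H f A B a Ns T i (xh i) (uh i) (xs i) (us i) lam lamtc \<and>
                            lamtc = - lh (Suc i)) \<and>
         (\<exists>lam. Q_kkt nx nu H f A B a Ns p (xh p) (xs p) (us p) lam) \<and>
         (\<forall>lb ltc. (\<forall>i<p. P_kkt nx nu H f A B a Ns T i (xh i) (uh i) (xs i) (us i) (lb i) (ltc i) \<and>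
                          ltc i = - lh (Suc i)) \<and>
                   Q_kkt nx nu H f A B a Ns p (xh p) (xs p) (us p) (lb p) \<longrightarrow>
            lb 0 0 = lh 0 \<and>
            (\<forall>i<p. lb i (Ns i) = lh (Suc i) \<and> lb (Suc i) 0 = lh (Suc i)) \<and>
            (\<forall>x u lam. (\<forall>i\<le>p. \<forall>t\<le>Ns i. x (tau Ns i + t) = xs i t) \<and>
                       (\<forall>i\<le>p. \<forall>t<Ns i. u (tau Ns i + t) = us i t) \<longrightarrow>
               (mpc_kkt nx nu N H f A B a xbar x u lam \<longleftrightarrow>
                  (\<forall>i\<le>p. \<forall>t\<le>Ns i. lam (tau Ns i + t) = lb i t)))))))"
proof -
  interpret mpc_split nx nu N H f c A B a p Ns T xbar
    using std Ns_sum T_basis by unfold_locales (auto simp: mpc_std_def)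
  \<comment> \<open>Folds the pairs of state and input equations in the goals into
    \<open>stitched\<close>.\<close>
  note st = stitched_def[symmetric]
  show ?thesis
  proof (intro conjI)
    show "\<forall>i<p. \<exists>Kx kx Ku ku.
        (\<forall>t\<le>Ns i. Kx t \<in> carrier_mat nx (nx + dim_col (T i)) \<and> kx t \<in> carrier_vec nx) \<and>
        (\<forall>t<Ns i. Ku t \<in> carrier_mat (nu (tau Ns i + t)) (nx + dim_col (T i)) \<and>
                   ku t \<in> carrier_vec (nu (tau Ns i + t))) \<and>
        (\<forall>xb \<in> carrier_vec nx. \<forall>db \<in> carrier_vec (dim_col (T i)).
           (\<exists>x u. P_feas nx nu A B a Ns T i xb db x u) \<and>
           (\<forall>x u. P_opt nx nu H f c A B a Ns T i xb db x u \<longleftrightarrow>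
              (\<forall>t\<le>Ns i. x t = Kx t *\<^sub>v (xb @\<^sub>v db) + kx t) \<and>
              (\<forall>t<Ns i. u t = Ku t *\<^sub>v (xb @\<^sub>v db) + ku t)))"
      by (intro allI impI split_block.P_affine_solution[OF block_locale])
  next
    show "\<forall>xh uh. master_opt nx nu H f c A B a Ns T p xbar xh uh \<longrightarrow>
      (\<forall>xs us. (\<forall>i<p. P_opt nx nu H f c A B a Ns T i (xh i) (uh i) (xs i) (us i)) \<and>
               Q_opt nx nu H f c A B a Ns p (xh p) (xs p) (us p) \<longrightarrow>
         (\<forall>i<p. xs i (Ns i) = xs (Suc i) 0) \<and>
         (\<forall>x u. mpc_opt nx nu N H f c A B a xbar x u \<longleftrightarrow>
            (\<forall>i\<le>p. \<forall>t\<le>Ns i. x (tau Ns i + t) = xs i t) \<and>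
            (\<forall>i\<le>p. \<forall>t<Ns i. u (tau Ns i + t) = us i t)))"
      unfolding st
    proof (intro allI impI, elim conjE, intro conjI allI impI)
      fix xh uh xs us
      assume m: "master_opt nx nu H f c A B a Ns T p xbar xh uh"
        and P: "\<forall>i<p. PO i (xh i) (uh i) (xs i) (us i)" and Q: "QO (xh p) (xs p) (us p)"
      show "mpc_opt nx nu N H f c A B a xbar x u \<longleftrightarrow> stitched xs us x u" for x u
        by (rule master_opt_stitched[OF m P[rule_format] Q])
      have mf: "MF xh uh" using m by (simp add: master_opt_def)
      show "xs i (Ns i) = xs (Suc i) 0" if "i < p" for i
        by (rule stitch_states(1)[OF mf P[rule_format] Q that])
    qed
  next
    show "\<forall>Hh fh ch.
      (\<forall>i<p. Hh i \<in> carrier_mat (nx + dim_col (T i)) (nx + dim_col (T i)) \<and>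
             fh i \<in> carrier_vec (nx + dim_col (T i)) \<and> sym_mat (Hh i) \<and>
             (\<forall>xb \<in> carrier_vec nx. \<forall>db \<in> carrier_vec (dim_col (T i)).
                P_val nx nu H f c A B a Ns T i xb db = quad (Hh i) (fh i) (ch i) (xb @\<^sub>v db))) \<and>
      Hh p \<in> carrier_mat nx nx \<and> fh p \<in> carrier_vec nx \<and> sym_mat (Hh p) \<and>
      (\<forall>xb \<in> carrier_vec nx. Q_val nx nu H f c A B a Ns p xb = quad (Hh p) (fh p) (ch p) xb) \<longrightarrow>
    (\<forall>xh uh lh. master_opt nx nu H f c A B a Ns T p xbar xh uh \<and>
        mpc_kkt nx (\<lambda>i. dim_col (T i)) p Hh fh (blkAcal nx A Ns) T (blkDa nx A a Ns) xbar xh uh lh \<longrightarrow>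
      (\<forall>xs us. (\<forall>i<p. P_opt nx nu H f c A B a Ns T i (xh i) (uh i) (xs i) (us i)) \<and>
               Q_opt nx nu H f c A B a Ns p (xh p) (xs p) (us p) \<longrightarrow>
         (\<forall>i<p. \<exists>lam lamtc. P_kkt nx nu H f A B a Ns T i (xh i) (uh i) (xs i) (us i) lam lamtc \<and>
                            lamtc = - lh (Suc i)) \<and>
         (\<exists>lam. Q_kkt nx nu H f A B a Ns p (xh p) (xs p) (us p) lam) \<and>
         (\<forall>lb ltc. (\<forall>i<p. P_kkt nx nu H f A B a Ns T i (xh i) (uh i) (xs i) (us i) (lb i) (ltc i) \<and>
                          ltc i = - lh (Suc i)) \<and>
                   Q_kkt nx nu H f A B a Ns p (xh p) (xs p) (us p) (lb p) \<longrightarrow>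
            lb 0 0 = lh 0 \<and>
            (\<forall>i<p. lb i (Ns i) = lh (Suc i) \<and> lb (Suc i) 0 = lh (Suc i)) \<and>
            (\<forall>x u lam. (\<forall>i\<le>p. \<forall>t\<le>Ns i. x (tau Ns i + t) = xs i t) \<and>
                       (\<forall>i\<le>p. \<forall>t<Ns i. u (tau Ns i + t) = us i t) \<longrightarrow>
               (mpc_kkt nx nu N H f A B a xbar x u lam \<longleftrightarrow>
                  (\<forall>i\<le>p. \<forall>t\<le>Ns i. lam (tau Ns i + t) = lb i t))))))"
      unfolding st
    proof (intro allI impI, elim conjE)
      fix Hh fh ch xh uh lh xs us
      assume Hh: "\<forall>i<p. Hh i \<in> carrier_mat (nx + dim_col (T i)) (nx + dim_col (T i)) \<and>
             fh i \<in> carrier_vec (nx + dim_col (T i)) \<and> sym_mat (Hh i) \<and>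
             (\<forall>xb \<in> carrier_vec nx. \<forall>db \<in> carrier_vec (dim_col (T i)).
                P_val nx nu H f c A B a Ns T i xb db = quad (Hh i) (fh i) (ch i) (xb @\<^sub>v db))"
        and Hp: "Hh p \<in> carrier_mat nx nx" "fh p \<in> carrier_vec nx" "sym_mat (Hh p)"
        "\<forall>xb \<in> carrier_vec nx. Q_val nx nu H f c A B a Ns p xb = quad (Hh p) (fh p) (ch p) xb"
        and m: "master_opt nx nu H f c A B a Ns T p xbar xh uh"
        and kkt: "mpc_kkt nx (\<lambda>i. dim_col (T i)) p Hh fh (blkAcal nx A Ns) T (blkDa nx A a Ns) xbar xh uh lh"
        and P: "\<forall>i<p. PO i (xh i) (uh i) (xs i) (us i)" and Q: "QO (xh p) (xs p) (us p)"
      have mf: "MF xh uh" using m by (simp add: master_opt_def)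
      have lh: "lh i \<in> carrier_vec nx" if "i \<le> p" for i using kkt that by (simp add: mpc_kkt_def)
      have exP: "\<exists>lam. P_kkt nx nu H f A B a Ns T i (xh i) (uh i) (xs i) (us i) lam (- lh (Suc i)) \<and> lam 0 = lh i"
        if "i < p" for i by (rule master_costates(1)[OF Hh Hp kkt P[rule_format] Q that])
      have exQ: "\<exists>lam. Q_kkt nx nu H f A B a Ns p (xh p) (xs p) (us p) lam \<and> lam 0 = lh p"
        by (rule master_costates(2)[OF Hh Hp kkt P[rule_format] Q])
      show "(\<forall>i<p. \<exists>lam lamtc. P_kkt nx nu H f A B a Ns T i (xh i) (uh i) (xs i) (us i) lam lamtc \<and>
                            lamtc = - lh (Suc i)) \<and>
         (\<exists>lam. Q_kkt nx nu H f A B a Ns p (xh p) (xs p) (us p) lam) \<and>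
         (\<forall>lb ltc. (\<forall>i<p. P_kkt nx nu H f A B a Ns T i (xh i) (uh i) (xs i) (us i) (lb i) (ltc i) \<and>
                          ltc i = - lh (Suc i)) \<and>
                   Q_kkt nx nu H f A B a Ns p (xh p) (xs p) (us p) (lb p) \<longrightarrow>
            lb 0 0 = lh 0 \<and>
            (\<forall>i<p. lb i (Ns i) = lh (Suc i) \<and> lb (Suc i) 0 = lh (Suc i)) \<and>
            (\<forall>x u lam. stitched xs us x u \<longrightarrow>
               (mpc_kkt nx nu N H f A B a xbar x u lam \<longleftrightarrow>
                  (\<forall>i\<le>p. \<forall>t\<le>Ns i. lam (tau Ns i + t) = lb i t))))"
      proof (intro conjI allI impI)
        show "\<exists>lam lamtc. P_kkt nx nu H f A B a Ns T i (xh i) (uh i) (xs i) (us i) lam lamtc \<and> lamtc = - lh (Suc i)"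
          if "i < p" for i using exP[OF that] by blast
        show "\<exists>lam. Q_kkt nx nu H f A B a Ns p (xh p) (xs p) (us p) lam" using exQ by blast
        fix lb ltc
        assume lb: "(\<forall>i<p. P_kkt nx nu H f A B a Ns T i (xh i) (uh i) (xs i) (us i) (lb i) (ltc i) \<and>
                          ltc i = - lh (Suc i)) \<and>
                   Q_kkt nx nu H f A B a Ns p (xh p) (xs p) (us p) (lb p)"
        have lbP: "P_kkt nx nu H f A B a Ns T i (xh i) (uh i) (xs i) (us i) (lb i) (- lh (Suc i))" if "i < p" for i
          using lb that by metis
        have lbQ: "Q_kkt nx nu H f A B a Ns p (xh p) (xs p) (us p) (lb p)" using lb by blast
        note mult = stitched_multipliers[OF mf lh P[rule_format] Q exP exQ lbP lbQ]
        show "lb 0 0 = lh 0" by (rule mult(1))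
        have "lb i (Ns i) = lh (Suc i) \<and> lb (Suc i) 0 = lh (Suc i)" if i: "i < p" for i
          by (rule mult(2)) (use i in simp_all)
        thus "lb i (Ns i) = lh (Suc i)" "lb (Suc i) 0 = lh (Suc i)" if "i < p" for i using that by blast+
        show "mpc_kkt nx nu N H f A B a xbar x u lam \<longleftrightarrow> (\<forall>i\<le>p. \<forall>t\<le>Ns i. lam (tau Ns i + t) = lb i t)"
          if st: "stitched xs us x u" for x u lam by (rule mult(3)) (use st in simp_all)
      qed
    qed
  qed (rule Q_affine_solution value_functions_quadratic master_val_eq)+
qed

end
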